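(* Let $\mathbb C_+=\{z\in\mathbb C:\operatorname{Re}z>0\}$. The linear space $\operatorname{span}\{e^{\lambda z}:\lambda\le0\}$ is weak-star dense in $H^\infty(\mathbb C_+)$. Consequently, for every $p\in[1,\infty)$, $\operatorname{span}\{e^{\lambda z}:\lambda\le0\}$ is dense in $H^p(\mathbb C_+)$.
   Context: For a simply connected domain $D\subsetneq\mathbb C$ and $1\le p<\infty$, $H^p(D)$ is the Banach space of holomorphic $f$ on $D$ such that $|f|^p$ has a harmonic majorant (norm $\inf u(z_0)^{1/p}$ over harmonic majorants $u$); $H^\infty(D)$ is the space of bounded holomorphic functions. The weak-star topology of $H^\infty(\mathbb D)$ is induced by identifying it via boundary values with a subspace of $L^\infty(\partial\mathbb D)=L^1(\partial\mathbb D)^*$, and is transported to $H^\infty(D)$ via a Riemann map. *)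

theory Defs
  imports "HOL-Complex_Analysis.Complex_Analysis"
begin

definition C_plus :: "complex set" where
  "C_plus = {z. Re z > 0}"

definition harmonic_on :: "complex set \<Rightarrow> (complex \<Rightarrow> real) \<Rightarrow> bool" where
  "harmonic_on S u \<longleftrightarrow> open S \<and>
     (\<exists>ux uy uxx uxy uyx uyy.
        (\<forall>z\<in>S. (u has_derivative (\<lambda>h. Re h * ux z + Im h * uy z)) (at z)
              \<and> (ux has_derivative (\<lambda>h. Re h * uxx z + Im h * uxy z)) (at z)
              \<and> (uy has_derivative (\<lambda>h. Re h * uyx z + Im h * uyy z)) (at z)
              \<and> uxx z + uyy z = 0)
        \<and> continuous_on S uxx \<and> continuous_on S uxy
        \<and> continuous_on S uyx \<and> continuous_on S uyy)"

definition hardy :: "complex set \<Rightarrow> real \<Rightarrow> (complex \<Rightarrow> complex) \<Rightarrow> bool" where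
  "hardy D p f \<longleftrightarrow> f holomorphic_on D \<and>
     (\<exists>u. harmonic_on D u \<and> (\<forall>z\<in>D. norm (f z) powr p \<le> u z))"

definition hardy_norm :: "complex set \<Rightarrow> real \<Rightarrow> complex \<Rightarrow> (complex \<Rightarrow> complex) \<Rightarrow> real" where
  "hardy_norm D p z0 f = Inf {u z0 powr (1 / p) | u.
      harmonic_on D u \<and> (\<forall>z\<in>D. norm (f z) powr p \<le> u z)}"

definition hardy_inf :: "complex set \<Rightarrow> (complex \<Rightarrow> complex) \<Rightarrow> bool" where
  "hardy_inf D f \<longleftrightarrow> f holomorphic_on D \<and> bounded (f ` D)"

text \<open>Boundary values on the unit circle (radial limits, existing a.e. for H^\<infinity>(disc)),
  parametrised by t in [0, 2 pi].\<close>
definition boundary_val :: "(complex \<Rightarrow> complex) \<Rightarrow> real \<Rightarrow> complex" where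
  "boundary_val g t = Lim (at_left 1) (\<lambda>r::real. g (complex_of_real r * cis t))"

text \<open>Weak-star closure in H^\<infinity>(C_plus), transported by the Riemann map phi from the
  unit disc onto C_plus: the weak-star topology of H^\<infinity>(disc) is the one induced by the
  pairings with L^1 functions on the circle; f lies in the closure of S iff every basic
  weak-star neighbourhood of f meets S.\<close>
definition weak_star_closure_pt ::
    "(complex \<Rightarrow> complex) \<Rightarrow> (complex \<Rightarrow> complex) set \<Rightarrow> (complex \<Rightarrow> complex) \<Rightarrow> bool" where
  "weak_star_closure_pt \<phi> S f \<longleftrightarrow>
     (\<forall>hs :: (real \<Rightarrow> complex) list. \<forall>\<epsilon>>0.
        (\<forall>h\<in>set hs. integrable (lebesgue_on {0..2*pi}) h) \<longrightarrow>
        (\<exists>s\<in>S. \<forall>h\<in>set hs.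
           norm (LINT t|lebesgue_on {0..2*pi}.
                   (boundary_val (f \<circ> \<phi>) t - boundary_val (s \<circ> \<phi>) t) * h t) < \<epsilon>))"

definition weak_star_dense :: "(complex \<Rightarrow> complex) \<Rightarrow> (complex \<Rightarrow> complex) set \<Rightarrow> bool" where
  "weak_star_dense \<phi> S \<longleftrightarrow> (\<forall>f. hardy_inf C_plus f \<longrightarrow> weak_star_closure_pt \<phi> S f)"

definition exp_span :: "(complex \<Rightarrow> complex) set" where
  "exp_span = {(\<lambda>z. \<Sum>k<n. c k * exp (complex_of_real (l k) * z)) | (n::nat) (c::nat \<Rightarrow> complex) (l::nat \<Rightarrow> real).
                  (\<forall>k<n. l k \<le> 0)}"

end

theory Submission
  imports Defs
begin

text \<open>By the Schwarz lemma every Riemann map onto the half-plane is a Moebius map, so everything happens on the disc.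
  The finite geometric sums \<open>(1 - q) \<Sum>k. q\<^sup>k exp (-k z / m)\<close>, \<open>q = exp (-1/m)\<close>, lie in the span and converge boundedly
  to \<open>1 / (1 + z)\<close> on the closed half-plane; since the span is an algebra, polynomials in the disc coordinate
  are bounded pointwise limits of the span. A bounded \<open>g\<close> is the boundary limit of its dilations by Fatou's theorem,
  so dominated convergence yields weak-star density.

  For \<open>f\<close> in \<open>H\<^sup>p\<close> the subharmonic function \<open>|f|\<^bsup>p/2\<^esup>\<close> has circular means bounded in \<open>L\<^sup>2\<close>, hence
  \<open>|f|\<^sup>p \<le> |H|\<^sup>2\<close> with \<open>H\<close> in \<open>H\<^sup>2\<close> and \<open>Re H \<ge> 1\<close>. Then \<open>f (n / (n + H))\<^sup>2\<close> is bounded and approximates \<open>f\<close>,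
  which reduces the second claim to bounded functions, where small circular means are turned into a
  harmonic majorant with a small value at the base point.\<close>

section \<open>Means over the unit circle\<close>

text \<open>\<open>boundary_val\<close> is a \<open>Lim\<close>, so it carries information only
  where the radial limit exists; Fatou's theorem must precede every weak-star estimate. Its proof
  rests on square means: their growth with the radius gives almost everywhere convergence along one
  sequence of radii, which identifies the boundary derivative of a primitive. For the second claim
  the obstacle is that a harmonic majorant of \<open>|f|^p\<close> may carry a singular boundary
  measure; its circular means need not be uniformly integrable, and it gives no control over the
  error of a truncation. Half the exponent cures this: bounded square means force square summable
  Taylor coefficients, and removing finitely many terms leaves uniformly small square means. The
  approximants of a bounded function keep a bound independent of the accuracy, so closeness in mean
  upgrades to closeness of p-th powers. Finally \<open>hardy_norm\<close> is an infimum over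
  majorants and not a boundary integral, so small means count only once a majorant is manufactured
  from them; the construction used for exponent \<open>p/2\<close> serves again for
  \<open>p\<close>.\<close>

abbreviation circ :: "real measure" where
  "circ \<equiv> lebesgue_on {0..2*pi}"

lemma circ_integrable_continuous:
  fixes f :: "real \<Rightarrow> 'b::euclidean_space"
  shows "continuous_on {0..2*pi} f \<Longrightarrow> integrable circ f"
  by (rule continuous_imp_integrable_real)

lemma measure_circ [simp]: "measure circ {0..2*pi} = 2*pi"
  by (simp add: measure_restrict_space)

lemma finite_measure_circ: "finite_measure circ"
  by (rule finite_measure_lebesgue_on) auto

interpretation circ: finite_measure circ
  by (rule finite_measure_circ)

lemma circ_integral_const: "(LINT t|circ. c) = (2*pi) *\<^sub>R (c::'b::euclidean_space)"
  by simp

lemma circ_mean_value: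
  fixes f :: "complex \<Rightarrow> complex"
  assumes "continuous_on (cball 0 r) f" "f holomorphic_on ball 0 r" "r > 0"
  shows "(LINT t|circ. f (of_real r * cis t)) = 2 * pi * f 0"
proof -
  have "((\<lambda>u. f u/(u-0)) has_contour_integral (2 * of_real pi * \<i> * f 0)) (circlepath 0 r)"
    by (rule Cauchy_integral_circlepath) (use assms in auto)
  then have "((\<lambda>t. f (r * cis t) / (r * cis t) * r * \<i> * cis t) has_integral (2 * of_real pi * \<i> * f 0)) {0..2*pi}"
    unfolding circlepath_def by (subst (asm) has_contour_integral_part_circlepath_iff) auto
  moreover have "f (r * cis t) / (r * cis t) * r * \<i> * cis t = \<i> * f (r * cis t)" for t
    using assms by (simp add: field_simps)
  ultimately have "((\<lambda>t. \<i> * f (r * cis t)) has_integral (\<i> * (2 * of_real pi * f 0))) {0..2*pi}"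
    by (simp add: mult_ac)
  then have "((\<lambda>t. -\<i> * (\<i> * f (r * cis t))) has_integral (-\<i> * (\<i> * (2 * of_real pi * f 0)))) {0..2*pi}"
    by (rule has_integral_mult_right)
  then have 1: "((\<lambda>t. f (r * cis t)) has_integral (2 * of_real pi * f 0)) {0..2*pi}"
    by (simp add: algebra_simps)
  have "integrable circ (\<lambda>t. f (r * cis t))"
    by (rule circ_integrable_continuous)
      (use assms in \<open>auto intro!: continuous_intros continuous_on_compose2[OF assms(1)] simp: norm_mult\<close>)
  then show ?thesis
    using 1 by (subst lebesgue_integral_eq_integral) (auto intro: integral_unique)
qed

lemma circ_integral_cis_int:
  "(LINT t|circ. cis (of_int k * t)) = (if k = 0 then 2*pi else 0)"
proof -
  have pos: "(LINT t|circ. cis (real n * t)) = (if n = 0 then 2*pi else 0)" for n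
  proof -
    have "(LINT t|circ. (\<lambda>w. w^n) (of_real 1 * cis t)) = 2 * pi * (\<lambda>w::complex. w^n) 0"
      by (rule circ_mean_value) (auto intro!: continuous_intros holomorphic_intros)
    then show ?thesis by (auto simp: Complex.DeMoivre power_0_left)
  qed
  show ?thesis
  proof (cases "k \<ge> 0")
    case True then show ?thesis using pos[of "nat k"] by simp
  next
    case False
    have "(LINT t|circ. cis (of_int k * t)) = (LINT t|circ. cnj (cis (real (nat (-k)) * t)))"
      using False by (auto simp: cis_cnj)
    also have "\<dots> = cnj (LINT t|circ. cis (real (nat (-k)) * t))"
      by simp
    finally show ?thesis using pos[of "nat (-k)"] False by simp
  qed
qed

lemma circ_parseval_finite:
  "(LINT t|circ. (cmod (\<Sum>n<N. c n * cis t ^ n))\<^sup>2) = 2 * pi * (\<Sum>n<N. (cmod (c n))\<^sup>2)"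
proof -
  have int: "integrable circ (\<lambda>t. c n * cnj (c m) * cis (of_int (int n - int m) * t))" for n m
    by (rule circ_integrable_continuous) (intro continuous_intros)
  have eq: "of_real ((cmod (\<Sum>n<N. c n * cis t ^ n))\<^sup>2) =
      (\<Sum>n<N. \<Sum>m<N. c n * cnj (c m) * cis (of_int (int n - int m) * t))" for t
  proof -
    have "cis (real n * t) * cnj (cis (real m * t)) = cis (of_int (int n - int m) * t)" for n m
      by (simp add: cis_cnj cis_mult algebra_simps)
    then show ?thesis
      unfolding complex_norm_square cnj_sum sum_product
      by (intro sum.cong refl) (simp only: Complex.DeMoivre complex_cnj_mult mult_ac)
  qed
  have "of_real (LINT t|circ. (cmod (\<Sum>n<N. c n * cis t ^ n))\<^sup>2) =
     (LINT t|circ. (of_real ((cmod (\<Sum>n<N. c n * cis t ^ n))\<^sup>2) :: complex))"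
    by (rule integral_complex_of_real[symmetric])
  also have "\<dots> = (LINT t|circ. (\<Sum>n<N. \<Sum>m<N. c n * cnj (c m) * cis (of_int (int n - int m) * t)))"
    by (simp only: eq)
  also have "\<dots> = (\<Sum>n<N. \<Sum>m<N. (LINT t|circ. c n * cnj (c m) * cis (of_int (int n - int m) * t)))"
    by (subst Bochner_Integration.integral_sum; (subst Bochner_Integration.integral_sum)?)
      (use int in auto)
  also have "\<dots> = (\<Sum>n<N. \<Sum>m<N. c n * cnj (c m) * (if n = m then 2*pi else 0))"
    by (simp only: integral_mult_right_zero circ_integral_cis_int) (auto intro!: sum.cong)
  also have "\<dots> = (\<Sum>n<N. c n * cnj (c n) * (2*pi))"
    by (intro sum.cong refl) (simp add: if_distrib[of "\<lambda>x. _ * x"] if_distrib[of of_real] sum.delta cong: if_cong)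
  also have "\<dots> = of_real (2 * pi * (\<Sum>n<N. (cmod (c n))\<^sup>2))"
    by (simp add: sum_distrib_left mult_ac flip: complex_norm_square)
  finally show ?thesis by (simp only: of_real_eq_iff)
qed

lemma circ_integral_uniform_limit:
  fixes F :: "nat \<Rightarrow> real \<Rightarrow> 'b::euclidean_space"
  assumes "uniform_limit {0..2*pi} F g sequentially" "\<And>n. continuous_on {0..2*pi} (F n)"
  shows "(\<lambda>n. LINT t|circ. F n t) \<longlonglongrightarrow> (LINT t|circ. g t)"
proof -
  have g: "continuous_on {0..2*pi} g"
    by (rule uniform_limit_theorem[OF _ assms(1)]) (use assms(2) in auto)
  obtain I J where I: "\<And>n. (F n has_integral I n) {0..2*pi}" and J: "(g has_integral J) {0..2*pi}" and "I \<longlonglongrightarrow> J"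
    using uniform_limit_integral[OF assms(1)] assms(2) by auto
  moreover have "(LINT t|circ. F n t) = I n" for n
    using I[of n] circ_integrable_continuous[OF assms(2)[of n]]
    by (simp add: lebesgue_integral_eq_integral integral_unique)
  moreover have "(LINT t|circ. g t) = J"
    using J circ_integrable_continuous[OF g] by (simp add: lebesgue_integral_eq_integral integral_unique)
  ultimately show ?thesis by simp
qed

text \<open>Convergence on a larger disc makes the series absolutely convergent on the circle, so
  the finite identity passes to a uniform limit. The hypothesis is a power series and not holomorphy
  because it is also applied to differences of dilations and to Taylor remainders, whose
  coefficients are known explicitly.\<close>

lemma circ_parseval:
  assumes f: "\<And>w. cmod w < R \<Longrightarrow> (\<lambda>n. a n * w ^ n) sums f w" and r: "0 \<le> r" "r < R"
  shows "(\<lambda>n. (cmod (a n))\<^sup>2 * r^(2*n)) sums ((LINT t|circ. (cmod (f (of_real r * cis t)))\<^sup>2) / (2*pi))"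
proof -
  obtain r' where r': "r < r'" "r' < R" using r dense by blast
  have "summable (\<lambda>n. a n * of_real r' ^ n)"
    using f[of "of_real r'"] r r' by (auto simp: sums_iff)
  then have sm: "summable (\<lambda>n. norm (a n * of_real r ^ n))"
    by (rule powser_insidea) (use r r' in auto)
  have "uniform_limit {0..2*pi} (\<lambda>N t. \<Sum>n<N. (a n * of_real r ^ n) * cis t ^ n)
      (\<lambda>t. \<Sum>n. (a n * of_real r ^ n) * cis t ^ n) sequentially"
    by (rule Weierstrass_m_test[OF _ sm]) (simp add: norm_mult norm_power)
  moreover have "(\<Sum>n. (a n * of_real r ^ n) * cis t ^ n) = f (of_real r * cis t)" for t
    using f[of "of_real r * cis t"] r by (simp add: sums_iff norm_mult power_mult_distrib mult_ac)
  ultimately have u: "uniform_limit {0..2*pi} (\<lambda>N t. \<Sum>n<N. (a n * of_real r ^ n) * cis t ^ n)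
      (\<lambda>t. f (of_real r * cis t)) sequentially" by simp
  have c: "continuous_on {0..2*pi} (\<lambda>t. f (of_real r * cis t))"
    by (rule uniform_limit_theorem[OF _ u]) (auto intro!: always_eventually continuous_intros)
  have b: "bounded ((\<lambda>t. f (of_real r * cis t)) ` {0..2*pi})"
    using compact_continuous_image[OF c] compact_imp_bounded by auto
  have "uniform_limit {0..2*pi} (\<lambda>N t. (\<Sum>n<N. (a n * of_real r ^ n) * cis t ^ n) * cnj (\<Sum>n<N. (a n * of_real r ^ n) * cis t ^ n))
      (\<lambda>t. f (of_real r * cis t) * cnj (f (of_real r * cis t))) sequentially"
    by (rule uniform_lim_mult[OF u bounded_linear.uniform_limit[OF bounded_linear_cnj u]])
      (use b in \<open>auto simp: image_image bounded_iff\<close>)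
  then have "uniform_limit {0..2*pi} (\<lambda>N t. Re ((\<Sum>n<N. (a n * of_real r ^ n) * cis t ^ n) * cnj (\<Sum>n<N. (a n * of_real r ^ n) * cis t ^ n)))
      (\<lambda>t. Re (f (of_real r * cis t) * cnj (f (of_real r * cis t)))) sequentially"
    by (rule bounded_linear.uniform_limit[OF bounded_linear_Re])
  then have u2: "uniform_limit {0..2*pi} (\<lambda>N t. (cmod (\<Sum>n<N. (a n * of_real r ^ n) * cis t ^ n))\<^sup>2)
      (\<lambda>t. (cmod (f (of_real r * cis t)))\<^sup>2) sequentially"
    by (simp only: complex_norm_square[symmetric] Re_complex_of_real)
  have "(\<lambda>N. (LINT t|circ. (cmod (\<Sum>n<N. (a n * of_real r ^ n) * cis t ^ n))\<^sup>2))
     \<longlonglongrightarrow> (LINT t|circ. (cmod (f (of_real r * cis t)))\<^sup>2)"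
    by (rule circ_integral_uniform_limit[OF u2]) (intro continuous_intros)
  then have "(\<lambda>N. 2 * pi * (\<Sum>n<N. (cmod (a n * of_real r ^ n))\<^sup>2) / (2*pi)) \<longlonglongrightarrow> (LINT t|circ. (cmod (f (of_real r * cis t)))\<^sup>2)/(2*pi)"
    unfolding circ_parseval_finite by (intro tendsto_intros) auto
  then show ?thesis
    using r by (simp add: sums_def norm_mult norm_power power_mult_distrib power_even_eq mult.commute flip: power_mult)
qed

section \<open>Radial limits of bounded holomorphic functions\<close>

text \<open>The contour is the unit circle itself, where \<open>E\<close> is merely continuous; this
  is how boundary estimates of \<open>E\<close> reach its derivative inside.\<close>

lemma circ_cauchy_deriv:
  assumes c: "continuous_on (cball 0 1) E" and h: "E holomorphic_on ball 0 1" and w: "cmod w < 1"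
  shows "deriv E w = (LINT t|circ. E (cis t) * cis t / (cis t - w)\<^sup>2) / (2*pi)"
proof -
  let ?I = "contour_integral (circlepath 0 1) (\<lambda>u. E u / (u-w)^2)"
  have d: "(E has_field_derivative (1 / (2 * of_real pi * \<i>) * ?I)) (at w)"
    and i: "(\<lambda>u. E u/(u-w)^2) contour_integrable_on (circlepath 0 1)"
    using Cauchy_derivative_integral_circlepath[OF c h] w by auto
  from has_contour_integral_integral[OF i]
  have "((\<lambda>t. E (cis t) / (cis t - w)\<^sup>2 * \<i> * cis t) has_integral ?I) {0..2*pi}"
    unfolding circlepath_def by (subst (asm) has_contour_integral_part_circlepath_iff) auto
  then have "((\<lambda>t. -\<i> * (E (cis t) / (cis t - w)\<^sup>2 * \<i> * cis t)) has_integral (-\<i> * ?I)) {0..2*pi}"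
    by (rule has_integral_mult_right)
  then have 1: "((\<lambda>t. E (cis t) * cis t / (cis t - w)\<^sup>2) has_integral (-\<i> * ?I)) {0..2*pi}"
    by (simp add: algebra_simps)
  have "integrable circ (\<lambda>t. E (cis t) * cis t / (cis t - w)\<^sup>2)"
    by (rule circ_integrable_continuous)
      (use w in \<open>auto intro!: continuous_intros continuous_on_compose2[OF c]\<close>)
  then have "(LINT t|circ. E (cis t) * cis t / (cis t - w)\<^sup>2) = -\<i> * ?I"
    using 1 by (subst lebesgue_integral_eq_integral) (auto intro: integral_unique)
  moreover have "deriv E w = (-\<i> * ?I) / (2*pi)"
    unfolding DERIV_imp_deriv[OF d] by (simp add: field_simps)
  ultimately show ?thesis by simp
qed

lemma norm_one_minus_circle:
  assumes "cmod z = 1"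
  shows "cmod (1 - of_real r * z) = cmod (z - of_real r)"
proof -
  have "z * cnj z = 1" using assms by (simp flip: complex_norm_square)
  then have "1 - of_real r * z = z * cnj (z - of_real r)" by (simp add: algebra_simps)
  then show ?thesis using assms by (simp add: norm_mult del: complex_cnj_diff)
qed

text \<open>On the circle the kernel is the real part of \<open>(1 + r z) / (1 - r z)\<close>, whose
  value at the centre is 1.\<close>

lemma poisson_kernel_mean:
  assumes "0 \<le> r" "r < 1"
  shows "integrable circ (\<lambda>t. (1 - r\<^sup>2) / (cmod (cis t - of_real r))\<^sup>2)"
    and "(LINT t|circ. (1 - r\<^sup>2) / (cmod (cis t - of_real r))\<^sup>2) = 2 * pi"
proof -
  define f :: "complex \<Rightarrow> complex" where "f = (\<lambda>z. (1 + of_real r * z) / (1 - of_real r * z))"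
  have nz: "1 - of_real r * z \<noteq> 0" if "cmod z \<le> 1" for z
  proof
    assume "1 - of_real r * z = 0"
    then have "cmod (of_real r * z) = 1" by simp
    moreover have "cmod (of_real r * z) \<le> r * 1"
      unfolding norm_mult by (intro mult_mono) (use assms that in auto)
    ultimately show False using assms by simp
  qed
  have c: "continuous_on (cball 0 1) f" and h: "f holomorphic_on ball 0 1"
    unfolding f_def using nz by (auto intro!: continuous_intros holomorphic_intros)
  have k: "Re (f (cis t)) = (1 - r\<^sup>2) / (cmod (cis t - of_real r))\<^sup>2" for t
  proof -
    have "(1 + of_real r * cis t) * cnj (1 - of_real r * cis t) = 1 - of_real (r\<^sup>2) * (cis t * cnj (cis t)) + of_real r * (cis t - cnj (cis t))"
      by (simp add: algebra_simps power2_eq_square)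
    then have "Re ((1 + of_real r * cis t) * cnj (1 - of_real r * cis t)) = 1 - r\<^sup>2"
      by (simp add: cis_mult cis_cnj)
    moreover have "f (cis t) = (1 + of_real r * cis t) * cnj (1 - of_real r * cis t) / of_real ((cmod (1 - of_real r * cis t))\<^sup>2)"
      unfolding f_def by (subst complex_div_cnj) simp
    ultimately show ?thesis
      by (simp only: Re_divide_of_real norm_one_minus_circle norm_cis)
  qed
  have i: "integrable circ (\<lambda>t. f (cis t))"
    by (rule circ_integrable_continuous) (auto intro!: continuous_intros continuous_on_compose2[OF c])
  from integrable_Re[OF i] show "integrable circ (\<lambda>t. (1 - r\<^sup>2) / (cmod (cis t - of_real r))\<^sup>2)"
    by (simp only: k)
  have "(LINT t|circ. f (cis t)) = 2 * pi"
    using circ_mean_value[OF c h] by (simp add: f_def)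
  then have "Re (LINT t|circ. f (cis t)) = 2 * pi" by simp
  then show "(LINT t|circ. (1 - r\<^sup>2) / (cmod (cis t - of_real r))\<^sup>2) = 2 * pi"
    by (simp only: integral_Re[OF i, symmetric] k)
qed

text \<open>The factor \<open>1 - ((z - r) / (1 - r z))\<^sup>2\<close> has the value 1 and a vanishing derivative at \<open>r\<close>, and on the
  circle it carries a zero at 1; it turns the Cauchy kernel of the derivative, whose \<open>L\<^sup>1\<close> norm
  against \<open>|z - 1|\<close> diverges logarithmically, into one dominated by the Poisson kernel.\<close>

lemma radial_deriv_bound:
  assumes c: "continuous_on (cball 0 1) E" and h: "E holomorphic_on ball 0 1" and r: "0 \<le> r" "r < 1"
    and bd: "\<And>z. cmod z = 1 \<Longrightarrow> cmod (E z) \<le> \<epsilon> * cmod (z - 1) + K * cmod (z - 1) ^ 3"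
    and eK: "0 \<le> \<epsilon>" "0 \<le> K"
  shows "cmod (deriv E (of_real r)) \<le> 16 * \<epsilon> + 64 * K * (1 - r)"
proof -
  define A :: "complex \<Rightarrow> complex" where "A = (\<lambda>z. ((z - of_real r) / (1 - of_real r * z))\<^sup>2)"
  define E' where "E' = (\<lambda>z. E z * (1 - A z))"
  have nz: "1 - of_real r * z \<noteq> 0" if "cmod z \<le> 1" for z
  proof
    assume "1 - of_real r * z = 0"
    then have "cmod (of_real r * z) = 1" by simp
    moreover have "cmod (of_real r * z) \<le> r * 1"
      unfolding norm_mult by (intro mult_mono) (use r that in auto)
    ultimately show False using r by simp
  qed
  have c': "continuous_on (cball 0 1) E'" and h': "E' holomorphic_on ball 0 1"
    unfolding E'_def A_def using nz c h by (auto intro!: continuous_intros holomorphic_intros)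
  have dE: "(E has_field_derivative deriv E r) (at (of_real r))"
    by (rule holomorphic_derivI[OF h]) (use r in auto)
  have "(A has_field_derivative 0) (at (of_real r))"
    unfolding A_def by (rule derivative_eq_intros refl | use nz[of "of_real r"] r in simp)+
  then have "(E' has_field_derivative (deriv E r * (1 - A r) + (0 - 0) * E r)) (at (of_real r))"
    unfolding E'_def by (intro DERIV_mult dE DERIV_diff DERIV_const)
  then have "deriv E' r = deriv E r"
    by (simp add: A_def DERIV_imp_deriv)
  then have eq: "deriv E r = (LINT t|circ. E' (cis t) * cis t / (cis t - of_real r)\<^sup>2) / (2*pi)"
    using circ_cauchy_deriv[OF c' h', of "of_real r"] r by simp
  \<comment> \<open>Write \<open>m\<close> for the distance of \<open>z\<close> to 1 and
    \<open>n\<close> for its distance to \<open>r\<close>. The zero of \<open>1 - A\<close> at 1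
    turns the two terms of \<open>bd\<close> into multiples of \<open>m\<^sup>2 / n ^ 4\<close> and
    \<open>m ^ 4 / n ^ 4\<close>. As \<open>m \<le> 2 * n\<close>, the first is controlled by the
    Poisson kernel and the second is bounded, with a factor \<open>1 - r\<close> to spare.\<close>
  define B where "B = (\<lambda>t. 16 * \<epsilon> * ((1 - r\<^sup>2) / (cmod (cis t - of_real r))\<^sup>2) + 64 * K * (1 - r))"
  have bound: "cmod (E' (cis t) * cis t / (cis t - of_real r)\<^sup>2) \<le> B t" for t
  proof -
    define z where "z = cis t"
    have z: "cmod z = 1" by (simp add: z_def)
    define n where "n = cmod (z - of_real r)"
    define m where "m = cmod (z - 1)"
    have n1: "1 - r \<le> n"
      using norm_triangle_ineq2[of z "of_real r"] z r by (simp add: n_def)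
    have npos: "n > 0" using n1 r by simp
    have m0: "0 \<le> m" by (simp add: m_def)
    have mn: "m \<le> 2 * n"
    proof -
      have "m \<le> n + cmod (of_real r - 1)"
        unfolding m_def n_def using norm_triangle_ineq[of "z - of_real r" "of_real r - 1"] by simp
      also have "cmod (of_real r - 1) = 1 - r"
        using r by (metis abs_of_nonneg norm_of_real of_real_1 of_real_diff norm_minus_commute diff_ge_0_iff_ge less_imp_le)
      finally show ?thesis using n1 by simp
    qed
    have nn: "cmod (1 - of_real r * z) = n"
      using norm_one_minus_circle[OF z] by (simp add: n_def)
    have nz1: "1 - of_real r * z \<noteq> 0" "z - of_real r \<noteq> 0"
      using nn npos by (auto simp: n_def)
    have "1 - A z = (1 + of_real r) * (1 - z) * (1 - of_real r) * (1 + z) / (1 - of_real r * z)\<^sup>2"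
    proof -
      have "(1 - of_real r * z)\<^sup>2 - (z - of_real r)\<^sup>2 = (1 + of_real r) * (1 - z) * (1 - of_real r) * (1 + z)"
        by algebra
      then show ?thesis
        using nz1 by (simp add: A_def power_divide diff_divide_eq_iff)
    qed
    moreover have "cmod (1 + of_real r) = 1 + r" "cmod (1 - of_real r) = 1 - r"
      using r norm_of_real[of "1 + r", where 'a=complex] norm_of_real[of "1 - r", where 'a=complex] by auto
    ultimately have "cmod (1 - A z) = (1 + r) * m * (1 - r) * cmod (1 + z) / n\<^sup>2"
      using nn by (simp add: norm_divide norm_mult norm_power m_def norm_minus_commute)
    also have "\<dots> \<le> 2 * m * (1 - r) * 2 / n\<^sup>2"
      using r z m0 norm_triangle_ineq[of 1 z] by (intro divide_right_mono mult_mono) auto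
    finally have A: "cmod (1 - A z) \<le> 4 * m * (1 - r) / n\<^sup>2" by simp
    have "cmod (E' z * z / (z - of_real r)\<^sup>2) = cmod (E z) * cmod (1 - A z) / n\<^sup>2"
      using z by (simp add: E'_def norm_divide norm_mult norm_power n_def)
    also have "\<dots> \<le> (\<epsilon> * m + K * m ^ 3) * (4 * m * (1 - r) / n\<^sup>2) / n\<^sup>2"
      using bd[OF z] A eK m0 by (intro divide_right_mono mult_mono) (auto simp: m_def)
    also have "\<dots> = 4 * \<epsilon> * (1 - r) * (m\<^sup>2 / n^4) + 4 * K * (1 - r) * (m^4 / n^4)"
      using npos by (simp add: field_simps power2_eq_square power3_eq_cube power4_eq_xxxx)
    also have "\<dots> \<le> 4 * \<epsilon> * (1 - r\<^sup>2) * (4 / n\<^sup>2) + 4 * K * (1 - r) * 16"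
    proof (rule add_mono)
      have "m\<^sup>2 \<le> (2 * n)\<^sup>2" using mn m0 by (rule power_mono)
      then have "m\<^sup>2 / n\<^sup>2 \<le> 4" using npos by (simp add: divide_le_eq power_mult_distrib)
      then have "m\<^sup>2 / n\<^sup>2 / n\<^sup>2 \<le> 4 / n\<^sup>2" by (rule divide_right_mono) simp
      then have 1: "m\<^sup>2 / n^4 \<le> 4 / n\<^sup>2" by (simp flip: power_add)
      have "r\<^sup>2 \<le> r" using r by (simp add: power2_eq_square mult_left_le)
      then have "4 * \<epsilon> * (1 - r) \<le> 4 * \<epsilon> * (1 - r\<^sup>2)" using eK by (intro mult_left_mono) auto
      then show "4 * \<epsilon> * (1 - r) * (m\<^sup>2 / n^4) \<le> 4 * \<epsilon> * (1 - r\<^sup>2) * (4 / n\<^sup>2)"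
        by (rule mult_mono[OF _ 1]) (use r eK \<open>r\<^sup>2 \<le> r\<close> in auto)
      have "m^4 \<le> (2 * n)^4" using mn m0 by (rule power_mono)
      then have "m^4 / n^4 \<le> 16" using npos by (simp add: divide_le_eq power_mult_distrib)
      then show "4 * K * (1 - r) * (m^4 / n^4) \<le> 4 * K * (1 - r) * 16"
        by (rule mult_left_mono) (use r eK in auto)
    qed
    also have "\<dots> = B t" by (simp add: B_def n_def z_def)
    finally show ?thesis by (simp add: z_def)
  qed
  have Bi: "integrable circ B"
    unfolding B_def using poisson_kernel_mean(1)[OF r] by (intro Bochner_Integration.integrable_add Bochner_Integration.integrable_mult_right) auto
  have "cmod (LINT t|circ. E' (cis t) * cis t / (cis t - of_real r)\<^sup>2) \<le> (LINT t|circ. cmod (E' (cis t) * cis t / (cis t - of_real r)\<^sup>2))"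
    by (rule integral_norm_bound)
  also have "\<dots> \<le> (LINT t|circ. B t)"
  proof (rule integral_mono[OF _ Bi bound])
    have "cis t \<noteq> of_real r" for t
    proof
      assume "cis t = of_real r"
      then have "cmod (cis t) = cmod (of_real r)" by simp
      then show False using r by simp
    qed
    then show "integrable circ (\<lambda>t. cmod (E' (cis t) * cis t / (cis t - of_real r)\<^sup>2))"
      by (intro circ_integrable_continuous)
        (auto intro!: continuous_intros continuous_on_compose2[OF c'])
  qed
  also have "\<dots> = 16 * \<epsilon> * (2*pi) + 64 * K * (1 - r) * (2 * pi)"
  proof -
    have "(LINT t|circ. B t) = (LINT t|circ. 16 * \<epsilon> * ((1 - r\<^sup>2) / (cmod (cis t - of_real r))\<^sup>2)) + (LINT t|circ. 64 * K * (1 - r))"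
      unfolding B_def using poisson_kernel_mean(1)[OF r]
      by (intro Bochner_Integration.integral_add Bochner_Integration.integrable_mult_right) auto
    then show ?thesis
      by (simp only: integral_mult_right_zero poisson_kernel_mean(2)[OF r] circ_integral_const real_scaleR_def) simp
  qed
  also have "\<dots> = (16 * \<epsilon> + 64 * K * (1 - r)) * (2 * pi)" by algebra
  finally have "cmod (LINT t|circ. E' (cis t) * cis t / (cis t - of_real r)\<^sup>2) / (2 * pi) \<le> 16 * \<epsilon> + 64 * K * (1 - r)"
    by (simp add: pos_divide_le_eq)
  then show ?thesis
    unfolding eq by (simp add: norm_divide norm_mult)
qed

text \<open>Lebesgue differentiation is available for right-hand averages. Applied to the reflected
  function it yields the left-hand ones, with the exceptional set negated. Extension by zero makes
  the integrand integrable on every interval.\<close>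

lemma has_vector_derivative_AE_of_has_integral:
  fixes k :: "real \<Rightarrow> 'b::euclidean_space"
  assumes has: "\<And>s t. a \<le> s \<Longrightarrow> s \<le> t \<Longrightarrow> t \<le> b \<Longrightarrow> (k has_integral (\<Gamma> t - \<Gamma> s)) {s..t}"
  obtains N where "negligible N" "\<And>t. a < t \<Longrightarrow> t < b \<Longrightarrow> t \<notin> N \<Longrightarrow> (\<Gamma> has_vector_derivative k t) (at t)"
proof (cases "a \<le> b")
  case False
  then show ?thesis using that[of "{}"] by auto
next
  case True
  define k0 where "k0 = (\<lambda>x. if x \<in> {a..b} then k x else 0)"
  have "k integrable_on {a..b}" using has[of a b] True by (auto simp: integrable_on_def)
  then have "k0 integrable_on UNIV"
    unfolding k0_def by (simp only: integrable_restrict_UNIV)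
  then have i0: "k0 integrable_on cbox c d" for c d
    by (rule integrable_on_subcbox) auto
  have i1: "(\<lambda>x. k0 (-x)) integrable_on cbox c d" for c d
    using i0[of "-d" "-c"] integrable_reflect[of k0 "-c" "-d"] by simp
  obtain N1 where N1: "negligible N1" "\<And>x e. \<lbrakk>x \<notin> N1; 0 < e\<rbrakk> \<Longrightarrow>
       \<exists>d>0. \<forall>h. 0 < h \<and> h < d \<longrightarrow> norm (integral {x..x+h} k0 /\<^sub>R h - k0 x) < e"
    using integrable_ccontinuous_explicit[OF i0] by (auto simp: cbox_interval)
  obtain N2 where N2: "negligible N2" "\<And>x e. \<lbrakk>x \<notin> N2; 0 < e\<rbrakk> \<Longrightarrow>
       \<exists>d>0. \<forall>h. 0 < h \<and> h < d \<longrightarrow> norm (integral {x..x+h} (\<lambda>x. k0 (-x)) /\<^sub>R h - k0 (-x)) < e"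
    using integrable_ccontinuous_explicit[OF i1] by (auto simp: cbox_interval)
  show ?thesis
  proof (rule that[of "N1 \<union> uminus ` N2"])
    have "negligible (uminus ` N2)"
      by (rule negligible_differentiable_image_negligible[OF _ N2(1)]) (auto intro!: derivative_intros)
    then show "negligible (N1 \<union> uminus ` N2)" using N1(1) by auto
    fix t assume t: "a < t" "t < b" "t \<notin> N1 \<union> uminus ` N2"
    have k0t: "k0 t = k t" using t by (simp add: k0_def)
    have t2: "-t \<notin> N2" using t(3) by force
    have int: "integral {s..u} k0 = \<Gamma> u - \<Gamma> s" if "a \<le> s" "s \<le> u" "u \<le> b" for s u
    proof -
      have "(k0 has_integral (\<Gamma> u - \<Gamma> s)) {s..u}"
        by (rule has_integral_eq[OF _ has[OF that]]) (use that in \<open>auto simp: k0_def\<close>)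
      then show ?thesis by (rule integral_unique)
    qed
    show "(\<Gamma> has_vector_derivative k t) (at t)"
      unfolding has_vector_derivative_def has_derivative_at
    proof (intro conjI bounded_linear_scaleR_left)
      show "(\<lambda>h. norm (\<Gamma> (t + h) - \<Gamma> t - h *\<^sub>R k t) / norm h) \<midarrow>0\<rightarrow> 0"
      proof (rule LIM_I)
        fix e :: real assume e: "e > 0"
        obtain d1 where d1: "d1 > 0" "\<And>h. 0 < h \<Longrightarrow> h < d1 \<Longrightarrow> norm (integral {t..t+h} k0 /\<^sub>R h - k t) < e"
          using N1(2)[of t e] t(3) e k0t by auto
        obtain d2 where d2: "d2 > 0" "\<And>h. 0 < h \<Longrightarrow> h < d2 \<Longrightarrow> norm (integral {-t..-t+h} (\<lambda>x. k0 (-x)) /\<^sub>R h - k t) < e"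
          using N2(2)[OF t2 e] k0t by auto
        have "norm (\<Gamma> (t + h) - \<Gamma> t - h *\<^sub>R k t) / norm h < e" if h: "h \<noteq> 0" "\<bar>h\<bar> < Min {d1, d2, b - t, t - a}" for h
        proof (cases "h > 0")
          case True
          have eq: "integral {t..t+h} k0 = \<Gamma> (t + h) - \<Gamma> t" using True h t by (intro int) auto
          have "norm (\<Gamma> (t + h) - \<Gamma> t - h *\<^sub>R k t) / norm h = norm ((\<Gamma> (t + h) - \<Gamma> t - h *\<^sub>R k t) /\<^sub>R h)"
            using True by (simp add: divide_inverse)
          also have "(\<Gamma> (t + h) - \<Gamma> t - h *\<^sub>R k t) /\<^sub>R h = integral {t..t+h} k0 /\<^sub>R h - k t"
            using True by (simp add: eq scaleR_diff_right)
          finally show ?thesis using d1(2)[of h] True h by simp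
        next
          case False
          define j where "j = -h"
          have j: "j > 0" "h = -j" using False h by (auto simp: j_def)
          have "integral {-t..-t+j} (\<lambda>x. k0 (-x)) = integral {t-j..t} k0"
          proof -
            have "-t + j = -(t - j)" by simp
            then show ?thesis by (simp only: Henstock_Kurzweil_Integration.integral_reflect_real)
          qed
          also have "\<dots> = \<Gamma> t - \<Gamma> (t - j)" using j h t by (intro int) auto
          finally have eq: "integral {-t..-t+j} (\<lambda>x. k0 (-x)) = \<Gamma> t - \<Gamma> (t - j)" .
          have m: "\<Gamma> (t + h) - \<Gamma> t - h *\<^sub>R k t = - (\<Gamma> t - \<Gamma> (t - j) - j *\<^sub>R k t)"
            using j by simp
          have "norm (\<Gamma> (t + h) - \<Gamma> t - h *\<^sub>R k t) / norm h = norm ((\<Gamma> t - \<Gamma> (t - j) - j *\<^sub>R k t) /\<^sub>R j)"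
            unfolding m norm_minus_cancel norm_scaleR using j by (simp only: divide_inverse mult.commute) simp
          also have "(\<Gamma> t - \<Gamma> (t - j) - j *\<^sub>R k t) /\<^sub>R j = integral {-t..-t+j} (\<lambda>x. k0 (-x)) /\<^sub>R j - k t"
            unfolding eq using j by (simp add: scaleR_diff_right)
          finally show ?thesis using d2(2)[of j] j h by simp
        qed
        moreover have "Min {d1, d2, b - t, t - a} > 0" using d1 d2 t by simp
        ultimately show "\<exists>s>0. \<forall>x. x \<noteq> 0 \<and> norm (x - 0) < s \<longrightarrow> norm (norm (\<Gamma> (t + x) - \<Gamma> t - x *\<^sub>R k t) / norm x - 0) < e"
          by (intro exI[of _ "Min {d1, d2, b - t, t - a}"]) (auto simp: abs_divide)
      qed
    qed
  qed
qed

section \<open>Square means and almost everywhere limits along a sequence of radii\<close>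

lemma circ_continuous_radial:
  assumes "f holomorphic_on ball 0 R" "0 \<le> r" "r < R"
  shows "continuous_on A (\<lambda>t. f (of_real r * cis t))"
  using assms(2,3)
  by (auto intro!: continuous_intros continuous_on_compose2[OF holomorphic_on_imp_continuous_on[OF assms(1)]]
      simp: norm_mult)

lemma circ_parseval_holomorphic:
  assumes "f holomorphic_on ball 0 R" "0 \<le> r" "r < R"
  shows "(\<lambda>n. (cmod ((deriv ^^ n) f 0 / fact n))\<^sup>2 * r^(2*n)) sums ((LINT t|circ. (cmod (f (of_real r * cis t)))\<^sup>2) / (2*pi))"
  by (rule circ_parseval[OF _ assms(2,3)]) (use holomorphic_power_series[OF assms(1)] in auto)

text \<open>By Parseval this is the inequality \<open>(r^n - s^n)^2 \<le> r^(2n) - s^(2n)\<close>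
  for each coefficient. Bounded square means thus make the dilations Cauchy in mean square.\<close>

lemma circ_square_diff_le:
  assumes g: "g holomorphic_on ball 0 1" and rs: "0 \<le> s" "s \<le> r" "r < 1"
  shows "(LINT t|circ. (cmod (g (of_real r * cis t) - g (of_real s * cis t)))\<^sup>2)
     \<le> (LINT t|circ. (cmod (g (of_real r * cis t)))\<^sup>2) - (LINT t|circ. (cmod (g (of_real s * cis t)))\<^sup>2)"
proof -
  define a where "a = (\<lambda>n. (deriv ^^ n) g 0 / fact n)"
  \<comment> \<open>Parseval is needed on the circle of radius 1 for
    \<open>g (r w) - g (s w)\<close>; the radius \<open>R = 1 / r'\<close> exceeds 1 and keeps
    \<open>r w\<close> and \<open>s w\<close> inside the unit disc.\<close>
  define r' where "r' = (1 + r) / 2"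
  have r': "r < r'" "r' < 1" "r' > 0" using rs by (auto simp: r'_def)
  define R where "R = 1 / r'"
  have R: "R > 1" using r' by (simp add: R_def)
  have rr: "cmod (of_real x * w) < 1" if "cmod w < R" "0 \<le> x" "x \<le> r" for x w
  proof -
    have "cmod (of_real x * w) \<le> r' * cmod w" using that r' by (auto simp: norm_mult intro!: mult_right_mono)
    also have "\<dots> < r' * R" using that r' by simp
    finally show ?thesis using r' by (simp add: R_def)
  qed
  have pw: "(\<lambda>n. a n * w ^ n) sums g w" if "cmod w < 1" for w
    using holomorphic_power_series[OF g, of w] that by (simp add: a_def)
  have 1: "(\<lambda>n. (cmod (a n * (of_real r ^ n - of_real s ^ n)))\<^sup>2 * 1^(2*n)) sums
      ((LINT t|circ. (cmod ((\<lambda>w. g (of_real r * w) - g (of_real s * w)) (of_real 1 * cis t)))\<^sup>2) / (2*pi))"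
  proof (rule circ_parseval)
    fix w assume w: "cmod w < R"
    show "(\<lambda>n. a n * (of_real r ^ n - of_real s ^ n) * w ^ n) sums (g (of_real r * w) - g (of_real s * w))"
      using sums_diff[OF pw[OF rr[OF w, of r]] pw[OF rr[OF w, of s]]] rs
      by (simp add: power_mult_distrib algebra_simps)
  qed (use R in auto)
  have 2: "(\<lambda>n. (cmod (a n))\<^sup>2 * r^(2*n) - (cmod (a n))\<^sup>2 * s^(2*n)) sums
     ((LINT t|circ. (cmod (g (of_real r * cis t)))\<^sup>2) / (2*pi) - (LINT t|circ. (cmod (g (of_real s * cis t)))\<^sup>2) / (2*pi))"
    unfolding a_def using rs by (intro sums_diff circ_parseval_holomorphic[OF g]) auto
  have "(cmod (a n * (of_real r ^ n - of_real s ^ n)))\<^sup>2 * 1^(2*n) \<le> (cmod (a n))\<^sup>2 * r^(2*n) - (cmod (a n))\<^sup>2 * s^(2*n)" for n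
  proof -
    have sr: "s ^ n \<le> r ^ n" "0 \<le> s ^ n" using rs by (auto intro: power_mono)
    have "(r^n - s^n)\<^sup>2 \<le> (r^n)\<^sup>2 - (s^n)\<^sup>2"
      using mult_left_mono[OF sr(1) sr(2)] by (simp add: power2_eq_square algebra_simps)
    moreover have "cmod (of_real r ^ n - of_real s ^ n) = \<bar>r ^ n - s ^ n\<bar>"
      by (metis norm_of_real of_real_diff of_real_power)
    then have "(cmod (a n * (of_real r ^ n - of_real s ^ n)))\<^sup>2 = (cmod (a n))\<^sup>2 * (r^n - s^n)\<^sup>2"
      by (simp only: norm_mult power_mult_distrib power2_abs)
    ultimately show ?thesis
      using mult_left_mono[of "(r^n - s^n)\<^sup>2" "(r^n)\<^sup>2 - (s^n)\<^sup>2" "(cmod (a n))\<^sup>2"]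
      by (simp only: power_mult mult.commute[of 2] power_one mult_1_right right_diff_distrib zero_le_power2)
  qed
  from sums_le[OF this 1 2] show ?thesis by (simp add: divide_le_cancel flip: diff_divide_distrib)
qed

text \<open>The norms of the increments have a finite total integral, hence a finite sum almost
  everywhere, and the sequence telescopes.\<close>

lemma AE_convergent_of_summable_L1:
  fixes u :: "nat \<Rightarrow> 'a \<Rightarrow> 'b::{banach, second_countable_topology}"
  assumes i: "\<And>n. integrable M (u n)"
    and b: "\<And>n. (LINT x|M. norm (u (Suc n) x - u n x)) \<le> c n" and c: "summable c"
  shows "AE x in M. convergent (\<lambda>n. u n x)"
proof -
  have m: "\<And>n. u n \<in> borel_measurable M" using i by auto
  let ?d = "\<lambda>n x. norm (u (Suc n) x - u n x)"
  have id: "integrable M (?d n)" for n using i by auto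
  have c0: "0 \<le> c n" for n using order_trans[OF integral_nonneg_AE b] by simp
  have "(\<integral>\<^sup>+x. (\<Sum>n. ennreal (?d n x)) \<partial>M) = (\<Sum>n. \<integral>\<^sup>+x. ennreal (?d n x) \<partial>M)"
    using m by (intro nn_integral_suminf) auto
  also have "\<dots> = (\<Sum>n. ennreal (LINT x|M. ?d n x))"
    by (intro suminf_cong nn_integral_eq_integral id) auto
  also have "\<dots> \<le> (\<Sum>n. ennreal (c n))"
    using b by (intro suminf_le ennreal_leI) auto
  also have "\<dots> = ennreal (suminf c)" using c c0 by (intro suminf_ennreal2) auto
  finally have "(\<integral>\<^sup>+x. (\<Sum>n. ennreal (?d n x)) \<partial>M) \<noteq> \<infinity>" by (auto simp: top_unique)
  then have "AE x in M. (\<Sum>n. ennreal (?d n x)) \<noteq> \<infinity>"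
    using m by (intro nn_integral_noteq_infinite) auto
  then show ?thesis
  proof eventually_elim
    case (elim x)
    then have "summable (\<lambda>n. ?d n x)"
      by (intro summable_suminf_not_top) auto
    then have "summable (\<lambda>n. u (Suc n) x - u n x)" by (rule summable_norm_cancel)
    then have "convergent (\<lambda>n. \<Sum>i<n. u (Suc i) x - u i x)" by (simp add: summable_iff_convergent)
    then have "convergent (\<lambda>n. u n x - u 0 x)" by (simp only: sum_lessThan_telescope[of "\<lambda>n. u n x"])
    then have "convergent (\<lambda>n. (u n x - u 0 x) + u 0 x)" by (intro convergent_add convergent_const)
    then show ?case by simp
  qed
qed

text \<open>Square means increase with the radius and are bounded, so radii can be picked whose
  means lie within \<open>(1/4)^k\<close> of the supremum; consecutive dilations are then summably
  close. The passage from these radii to all radii is left to the differentiability argument in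
  Fatou's theorem.\<close>

lemma radial_sequence_AE_convergent:
  assumes g: "g holomorphic_on ball 0 1" and M: "\<And>w. cmod w < 1 \<Longrightarrow> cmod (g w) \<le> M"
  obtains \<rho> :: "nat \<Rightarrow> real" where "\<And>k. 0 \<le> \<rho> k" "\<And>k. \<rho> k < 1" "\<rho> \<longlonglongrightarrow> 1"
    "AE t in circ. convergent (\<lambda>k. g (of_real (\<rho> k) * cis t))"
proof -
  define A where "A = (\<lambda>r. LINT t|circ. (cmod (g (of_real r * cis t)))\<^sup>2)"
  have cont: "continuous_on {0..2*pi} (\<lambda>t. g (of_real r * cis t))" if "0 \<le> r" "r < 1" for r
    using circ_continuous_radial[OF g] that by auto
  have diff: "(LINT t|circ. (cmod (g (of_real r * cis t) - g (of_real s * cis t)))\<^sup>2) \<le> A r - A s"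
    if "0 \<le> s" "s \<le> r" "r < 1" for r s
    using circ_square_diff_le[OF g that] by (simp add: A_def)
  have mono: "A s \<le> A r" if "0 \<le> s" "s \<le> r" "r < 1" for r s
  proof -
    have "0 \<le> (LINT t|circ. (cmod (g (of_real r * cis t) - g (of_real s * cis t)))\<^sup>2)" by simp
    with diff[OF that] show ?thesis by linarith
  qed
  have bd: "A r \<le> 2 * pi * M\<^sup>2" if "0 \<le> r" "r < 1" for r
  proof -
    have "A r \<le> (LINT t|circ. M\<^sup>2)"
      unfolding A_def
    proof (rule integral_mono)
      show "integrable circ (\<lambda>t. (cmod (g (of_real r * cis t)))\<^sup>2)"
        by (rule circ_integrable_continuous) (intro continuous_intros cont that)
      show "(cmod (g (of_real r * cis t)))\<^sup>2 \<le> M\<^sup>2" for t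
        by (rule power_mono[OF M]) (use that in \<open>auto simp: norm_mult\<close>)
    qed auto
    then show ?thesis by simp
  qed
  define L where "L = Sup (A ` {0..<1})"
  have bda: "bdd_above (A ` {0..<1})" using bd by (intro bdd_aboveI[of _ "2 * pi * M\<^sup>2"]) auto
  have AL: "A r \<le> L" if "0 \<le> r" "r < 1" for r
    unfolding L_def using bda that by (intro cSup_upper) auto
  have "\<exists>r. 1 - inverse (real (Suc k)) \<le> r \<and> 0 \<le> r \<and> r < 1 \<and> L - (1/4)^k \<le> A r" for k
  proof -
    have "L - (1/4)^k < L" by simp
    then obtain x where x: "0 \<le> x" "x < 1" "L - (1/4)^k < A x"
      unfolding L_def using less_cSup_iff[OF _ bda] by auto
    define r where "r = max x (1 - inverse (real (Suc k)))"
    have "inverse (real (Suc k)) \<le> 1" "inverse (real (Suc k)) > 0" by (auto simp: inverse_le_1_iff)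
    then have r: "1 - inverse (real (Suc k)) \<le> r" "0 \<le> r" "r < 1" "x \<le> r"
      using x by (auto simp: r_def)
    then show ?thesis using mono[of x r] x by (intro exI[of _ r]) auto
  qed
  then obtain \<rho> where \<rho>: "\<And>k. 1 - inverse (real (Suc k)) \<le> \<rho> k" "\<And>k. 0 \<le> \<rho> k" "\<And>k. \<rho> k < 1"
     "\<And>k. L - (1/4)^k \<le> A (\<rho> k)" by metis
  show ?thesis
  proof (rule that[OF \<rho>(2,3)])
    have "(\<lambda>k. 1 - inverse (real (Suc k))) \<longlonglongrightarrow> 1 - 0"
      by (intro tendsto_intros LIMSEQ_inverse_real_of_nat)
    then show "\<rho> \<longlonglongrightarrow> 1"
      by (intro tendsto_sandwich[OF _ _ _ tendsto_const, of "\<lambda>k. 1 - inverse (real (Suc k))" \<rho> _ 1])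
        (use \<rho> in \<open>auto intro!: always_eventually less_imp_le\<close>)
    show "AE t in circ. convergent (\<lambda>k. g (of_real (\<rho> k) * cis t))"
    proof (rule AE_convergent_of_summable_L1)
      show "integrable circ (\<lambda>t. g (of_real (\<rho> n) * cis t))" for n
        by (rule circ_integrable_continuous) (intro cont \<rho>)
      show "summable (\<lambda>k. (pi + 1/2) * (1/2)^k :: real)"
        by (intro summable_mult summable_geometric) auto
      fix k
      let ?d = "\<lambda>t. g (of_real (\<rho> (Suc k)) * cis t) - g (of_real (\<rho> k) * cis t)"
      have cd: "continuous_on {0..2*pi} ?d" by (intro continuous_intros cont \<rho>)
      have q: "(1/4::real)^Suc k \<le> (1/4)^k" by simp
      \<comment> \<open>The chosen radii need not increase with \<open>k\<close>, so both orders
        occur; the mean at either radius is within \<open>(1/4)^k\<close> of the supremum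
        \<open>L\<close>.\<close>
      have sq: "(LINT t|circ. (cmod (?d t))\<^sup>2) \<le> (1/4)^k"
      proof (cases "\<rho> k \<le> \<rho> (Suc k)")
        case True
        have "A (\<rho> (Suc k)) - A (\<rho> k) \<le> (1/4)^k"
          using AL[of "\<rho> (Suc k)"] \<rho> by (smt (verit))
        with diff[OF \<rho>(2) True \<rho>(3)] show ?thesis by linarith
      next
        case False
        have "A (\<rho> k) - A (\<rho> (Suc k)) \<le> (1/4)^k"
          using AL[of "\<rho> k"] \<rho>(2,3)[of k] \<rho>(4)[of "Suc k"] q by linarith
        with diff[OF \<rho>(2) _ \<rho>(3), of "Suc k" k] False show ?thesis by (simp add: norm_minus_commute)
      qed
      \<comment> \<open>A weighted arithmetic-geometric mean inequality, replacing Cauchy-Schwarz: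
        the weight \<open>2^k\<close> balances the square mean \<open>(1/4)^k\<close> and leaves an
        integral of order \<open>(1/2)^k\<close>.\<close>
      have am: "x \<le> (1/2)^k/2 + 2^k/2 * x\<^sup>2" for x :: real
      proof -
        have "0 \<le> 2^k/2 * (x - (1/2)^k)\<^sup>2" by simp
        also have "\<dots> = (1/2)^k/2 + 2^k/2 * x\<^sup>2 - x"
          by (simp add: power2_eq_square algebra_simps power_one_over)
        finally show ?thesis by simp
      qed
      have i: "integrable circ (\<lambda>t. (cmod (?d t))\<^sup>2)"
        by (rule circ_integrable_continuous) (intro continuous_intros cd)
      have "(LINT t|circ. cmod (?d t)) \<le> (LINT t|circ. (1/2)^k/2 + 2^k/2 * (cmod (?d t))\<^sup>2)"
        by (intro integral_mono am circ_integrable_continuous continuous_intros cont \<rho>)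
      also have "\<dots> = (LINT t|circ. (1/2)^k/2) + (LINT t|circ. 2^k/2 * (cmod (?d t))\<^sup>2)"
        using i by (intro Bochner_Integration.integral_add Bochner_Integration.integrable_mult_right) auto
      also have "\<dots> = pi * (1/2)^k + 2^k/2 * (LINT t|circ. (cmod (?d t))\<^sup>2)"
        by (simp only: integral_mult_right_zero circ_integral_const) simp
      also have "\<dots> \<le> pi * (1/2)^k + 2^k/2 * (1/4)^k"
        using sq by (intro add_left_mono mult_left_mono) auto
      also have "2^k/2 * (1/4)^k = (1/2::real) * (1/2)^k"
        by (simp add: power_divide field_simps flip: power_mult_distrib)
      finally show "(LINT t|circ. cmod (?d t)) \<le> (pi + 1/2) * (1/2)^k"
        by (simp add: algebra_simps)
    qed
  qed
qed

section \<open>Fatou's theorem\<close>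

lemma circ_AE_iff_negligible: "(AE t in circ. P t) \<longleftrightarrow> negligible {t\<in>{0..2*pi}. \<not> P t}"
proof -
  have "(AE t in circ. P t) \<longleftrightarrow> (AE t in lebesgue. t \<in> {0..2*pi} \<longrightarrow> P t)"
    by (rule AE_restrict_space_iff) simp
  then show ?thesis
    by (simp add: completion.AE_iff_null_sets negligible_iff_null_sets Int_def)
qed

lemma has_vector_derivative_cis: "(cis has_vector_derivative \<i> * cis t) (at t)"
proof -
  have "((\<lambda>z. exp (\<i> * z)) has_field_derivative \<i> * exp (\<i> * of_real t)) (at (of_real t))"
    by (auto intro!: derivative_eq_intros)
  from has_vector_derivative_real_field[OF this]
  have "((\<lambda>t. exp (\<i> * of_real t)) has_vector_derivative \<i> * exp (\<i> * of_real t)) (at t)" .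
  then show ?thesis by (simp add: cis_conv_exp[abs_def])
qed

text \<open>Fatou's theorem: the primitive of \<open>g\<close> is Lipschitz up to the circle, its boundary function is
  differentiable almost everywhere, and the radial limit exists at every point of differentiability.\<close>

theorem fatou_radial_limit:
  assumes g: "g holomorphic_on ball 0 1" and M: "\<And>w. cmod w < 1 \<Longrightarrow> cmod (g w) \<le> M"
  shows "AE t in circ. \<exists>l. ((\<lambda>r. g (of_real r * cis t)) \<longlongrightarrow> l) (at_left 1)"
proof -
  have M0: "0 \<le> M" using order_trans[OF norm_ge_zero M[of 0]] by simp
  obtain \<rho> :: "nat \<Rightarrow> real" where \<rho>: "\<And>k. 0 \<le> \<rho> k" "\<And>k. \<rho> k < 1" "\<rho> \<longlonglongrightarrow> 1"
    and AE: "AE t in circ. convergent (\<lambda>k. g (of_real (\<rho> k) * cis t))"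
    using radial_sequence_AE_convergent[OF g M] by blast
  define N0 where "N0 = {t\<in>{0..2*pi}. \<not> convergent (\<lambda>k. g (of_real (\<rho> k) * cis t))}"
  have N0: "negligible N0" using AE by (simp add: circ_AE_iff_negligible N0_def)
  define \<kappa> where "\<kappa> = (\<lambda>t. lim (\<lambda>k. g (of_real (\<rho> k) * cis t)))"
  define k0 where "k0 = (\<lambda>t. if t \<in> N0 then 0 else \<i> * cis t * \<kappa> t)"
  obtain G0 where G0: "\<And>x. x \<in> ball 0 1 \<Longrightarrow> (G0 has_field_derivative g x) (at x within ball 0 1)"
    using holomorphic_convex_primitive'[OF convex_ball open_ball g] by blast
  have "M-lipschitz_on (ball 0 1) G0"
  proof (rule lipschitz_onI[OF _ M0])
    fix x y :: complex assume "x \<in> ball 0 1" "y \<in> ball 0 1"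
    then have "cmod (G0 x - G0 y) \<le> M * cmod (x - y)"
      by (intro field_differentiable_bound[OF convex_ball G0 M]) auto
    then show "dist (G0 x) (G0 y) \<le> M * dist x y" by (simp add: dist_norm)
  qed
  from lipschitz_extend_closure[OF this] obtain G where
    lip: "M-lipschitz_on (cball 0 1) G" and GG0: "\<And>x. x \<in> ball 0 1 \<Longrightarrow> G x = G0 x"
    by (auto simp: closure_ball)
  have cG: "continuous_on (cball 0 1) G" by (rule lipschitz_on_continuous_on[OF lip])
  have dG: "(G has_field_derivative g x) (at x)" if "cmod x < 1" for x
  proof -
    have "(G0 has_field_derivative g x) (at x)"
      using G0[of x] that by (simp add: at_within_open[of x "ball 0 1"])
    then show ?thesis
      by (rule DERIV_cong_ev[THEN iffD1, rotated -1])
        (use that GG0 in \<open>auto intro!: eventually_nhds_in_open[THEN eventually_mono, of "ball 0 1"]\<close>)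
  qed
  have hG: "G holomorphic_on ball 0 1"
    unfolding holomorphic_on_open[OF open_ball] using dG by (metis mem_ball_0)
  \<comment> \<open>The fundamental theorem of calculus on the circles of radius
    \<open>\<rho> k\<close>, in the limit. Integrands are set to 0 on the null set \<open>N0\<close>
    so that convergence holds at every point, as the dominated convergence rule demands.\<close>
  have has: "(k0 has_integral (G (cis t) - G (cis s))) {s..t}" if st: "0 \<le> s" "s \<le> t" "t \<le> 2*pi" for s t
  proof (rule has_integral_dominated_convergence)
    define f where "f = (\<lambda>k x. if x \<in> N0 then 0 else \<i> * cis x * (of_real (\<rho> k) * g (of_real (\<rho> k) * cis x)))"
    fix k
    have "((\<lambda>x. \<i> * cis x * (of_real (\<rho> k) * g (of_real (\<rho> k) * cis x))) has_integral
        (G (of_real (\<rho> k) * cis t) - G (of_real (\<rho> k) * cis s))) {s..t}"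
    proof (rule fundamental_theorem_of_calculus[where f = "\<lambda>x. G (of_real (\<rho> k) * cis x)", OF st(2)])
      fix x
      have "cmod (of_real (\<rho> k) * cis x) < 1" using \<rho>(1,2)[of k] by (simp add: norm_mult)
      from dG[OF this] have D: "(G has_field_derivative g (of_real (\<rho> k) * cis x)) (at (of_real (\<rho> k) * cis x))" .
      have "((\<lambda>x. of_real (\<rho> k) * cis x) has_vector_derivative (of_real (\<rho> k) * (\<i> * cis x))) (at x)"
        by (rule has_vector_derivative_mult_right[OF has_vector_derivative_cis])
      from field_vector_diff_chain_at[where f = "\<lambda>x. of_real (\<rho> k) * cis x" and g = G, OF this D]
      have D2: "((\<lambda>x. G (of_real (\<rho> k) * cis x)) has_vector_derivative \<i> * cis x * (of_real (\<rho> k) * g (of_real (\<rho> k) * cis x))) (at x)"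
        by (simp only: o_def mult_ac)
      show "((\<lambda>x. G (of_real (\<rho> k) * cis x)) has_vector_derivative \<i> * cis x * (of_real (\<rho> k) * g (of_real (\<rho> k) * cis x))) (at x within {s..t})"
        by (rule has_vector_derivative_at_within[OF D2])
    qed
    then show "(f k has_integral (G (of_real (\<rho> k) * cis t) - G (of_real (\<rho> k) * cis s))) {s..t}"
      by (rule has_integral_spike[OF N0, rotated]) (auto simp: f_def)
    show "\<forall>x\<in>{s..t}. norm (f k x) \<le> M"
    proof
      fix x
      have "\<rho> k * cmod (g (of_real (\<rho> k) * cis x)) \<le> 1 * M"
        by (intro mult_mono M) (use \<rho>(1,2)[of k] in \<open>auto simp: norm_mult intro: less_imp_le\<close>)
      then show "norm (f k x) \<le> M" using M0 \<rho>(1)[of k] by (auto simp: f_def norm_mult)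
    qed
  next
    show "(\<lambda>x. M) integrable_on {s..t}" by (rule integrable_const_ivl)
  next
    let ?f = "(\<lambda>k x. if x \<in> N0 then 0 else \<i> * cis x * (of_real (\<rho> k) * g (of_real (\<rho> k) * cis x)))"
    show "\<forall>x\<in>{s..t}. (\<lambda>k. ?f k x) \<longlonglongrightarrow> k0 x"
    proof
      fix x assume x: "x \<in> {s..t}"
      show "(\<lambda>k. ?f k x) \<longlonglongrightarrow> k0 x"
      proof (cases "x \<in> N0")
        case False
        then have "convergent (\<lambda>k. g (of_real (\<rho> k) * cis x))" using x st by (auto simp: N0_def)
        then have "(\<lambda>k. g (of_real (\<rho> k) * cis x)) \<longlonglongrightarrow> \<kappa> x"
          unfolding \<kappa>_def by (rule convergent_LIMSEQ_iff[THEN iffD1])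
        then have "(\<lambda>k. \<i> * cis x * (of_real (\<rho> k) * g (of_real (\<rho> k) * cis x))) \<longlonglongrightarrow> \<i> * cis x * (of_real 1 * \<kappa> x)"
          by (intro tendsto_intros \<rho>)
        then show ?thesis using False by (simp add: k0_def)
      qed (auto simp: k0_def)
    qed
    have lim: "(\<lambda>k. G (of_real (\<rho> k) * cis x)) \<longlonglongrightarrow> G (cis x)" for x
    proof (rule continuous_on_tendsto_compose[OF cG])
      have "(\<lambda>k. of_real (\<rho> k) * cis x) \<longlonglongrightarrow> of_real 1 * cis x" by (intro tendsto_intros \<rho>)
      then show "(\<lambda>k. of_real (\<rho> k) * cis x) \<longlonglongrightarrow> cis x" by simp
    qed (use \<rho> in \<open>auto simp: norm_mult intro!: always_eventually less_imp_le\<close>)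
    show "(\<lambda>k. G (of_real (\<rho> k) * cis t) - G (of_real (\<rho> k) * cis s)) \<longlonglongrightarrow> G (cis t) - G (cis s)"
      by (intro tendsto_diff lim)
  qed
  obtain N1 where N1: "negligible N1"
    "\<And>t. 0 < t \<Longrightarrow> t < 2*pi \<Longrightarrow> t \<notin> N1 \<Longrightarrow> ((\<lambda>t. G (cis t)) has_vector_derivative k0 t) (at t)"
    using has_vector_derivative_AE_of_has_integral[of 0 "2*pi" k0 "\<lambda>t. G (cis t)"] has by blast
  have main: "((\<lambda>r. g (of_real r * cis t)) \<longlongrightarrow> \<kappa> t) (at_left 1)"
    if t: "0 < t" "t < 2*pi" "t \<notin> N0" "t \<notin> N1" for t
  proof -
    define c where "c = \<kappa> t"
    \<comment> \<open>After rotating the boundary point to 1, \<open>E\<close> is \<open>G\<close>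
      minus the affine function it would osculate if the radial limit were \<open>c\<close>. Since
      \<open>deriv E r\<close> equals \<open>cis t * (g (r cis t) - c)\<close>, bounding this
      derivative is the whole claim.\<close>
    define E where "E = (\<lambda>z. G (cis t * z) - G (cis t) - c * cis t * (z - 1))"
    have "((\<lambda>x. G (cis x) - c * cis x) has_vector_derivative (k0 t - c * (\<i> * cis t))) (at t)"
      by (intro has_vector_derivative_diff N1 t has_vector_derivative_mult_right has_vector_derivative_cis)
    then have D0: "((\<lambda>x. G (cis x) - c * cis x) has_vector_derivative 0) (at t)"
      using t by (simp add: k0_def c_def mult_ac)
    have cE: "continuous_on (cball 0 1) E"
      unfolding E_def by (auto intro!: continuous_intros continuous_on_compose2[OF cG] simp: norm_mult)
    have dE: "(E has_field_derivative (cis t * (g (cis t * z) - c))) (at z)" if "cmod z < 1" for z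
    proof -
      have "((\<lambda>z. G (cis t * z)) has_field_derivative (g (cis t * z) * (cis t * 1))) (at z)"
        by (rule DERIV_chain2[OF dG]) (use that in \<open>auto simp: norm_mult intro!: derivative_eq_intros\<close>)
      then show ?thesis
        unfolding E_def by (auto intro!: derivative_eq_intros simp: algebra_simps)
    qed
    have hE: "E holomorphic_on ball 0 1"
      unfolding holomorphic_on_open[OF open_ball] using dE by (metis mem_ball_0)
    have Elip: "cmod (E z) \<le> (M + cmod c) * cmod (z - 1)" if z: "cmod z = 1" for z
    proof -
      have "cmod (G (cis t * z) - G (cis t)) \<le> M * cmod (cis t * z - cis t)"
        using lipschitz_onD[OF lip, of "cis t * z" "cis t"] z by (simp add: dist_norm norm_mult)
      also have "cis t * z - cis t = cis t * (z - 1)" by (simp add: algebra_simps)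
      finally have "cmod (G (cis t * z) - G (cis t)) \<le> M * cmod (z - 1)" by (simp add: norm_mult)
      moreover have "cmod (E z) \<le> cmod (G (cis t * z) - G (cis t)) + cmod (c * cis t * (z - 1))"
        unfolding E_def by (rule norm_triangle_ineq4)
      moreover have "cmod (c * cis t * (z - 1)) = cmod c * cmod (z - 1)" by (simp only: norm_mult norm_cis mult_1_right)
      ultimately show ?thesis by (simp add: distrib_right)
    qed
    \<comment> \<open>Near 1, differentiability of the boundary curve gives a small slope. Farther
      away only the Lipschitz bound remains; there \<open>cmod (z - 1)\<close> is at least
      \<open>d'\<close>, so that bound is absorbed into the cubic term.\<close>
    have bound: "\<exists>K\<ge>0. \<forall>z. cmod z = 1 \<longrightarrow> cmod (E z) \<le> (2 * e) * cmod (z - 1) + K * cmod (z - 1) ^ 3" if e: "e > 0" for e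
    proof -
      obtain d where d: "d > 0" "\<And>x. \<bar>x - t\<bar> < d \<Longrightarrow>
          cmod ((G (cis x) - c * cis x) - (G (cis t) - c * cis t)) \<le> e * \<bar>x - t\<bar>"
        using D0 e unfolding has_vector_derivative_def has_derivative_at_alt by fastforce
      \<comment> \<open>\<open>1/2\<close> ensures that the argument of \<open>z\<close> is at most
        twice \<open>cmod (z - 1)\<close>; \<open>d/2\<close> then keeps that argument below
        \<open>d\<close>.\<close>
      define d' where "d' = min (1/2) (d/2)"
      have d': "d' > 0" using d by (simp add: d'_def)
      define K where "K = (M + cmod c) / d'\<^sup>2"
      have K: "K \<ge> 0" using M0 by (simp add: K_def)
      have "cmod (E z) \<le> (2 * e) * cmod (z - 1) + K * cmod (z - 1) ^ 3" if z: "cmod z = 1" for z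
      proof (cases "cmod (z - 1) < d'")
        case True
        define s where "s = Im (Ln z)"
        have z0: "z \<noteq> 0" using z by auto
        have "Re (Ln z) = 0" using z z0 by simp
        then have "Ln z = \<i> * of_real s" by (simp add: complex_eq_iff s_def)
        then have zs: "z = cis s" using exp_Ln[OF z0] by (simp add: cis_conv_exp)
        have "cmod (Ln z) \<le> 2 * cmod (z - 1)"
        proof -
          have h: "cmod (z - 1) < 1/2" using True by (simp add: d'_def)
          have "cmod (Ln (1 + (z - 1)) - (z - 1)) \<le> (cmod (z - 1))\<^sup>2 / (1 - cmod (z - 1))"
            by (rule Ln_approx_linear) (use h in auto)
          also have "\<dots> \<le> cmod (z - 1)"
            using h by (simp add: pos_divide_le_eq power2_eq_square mult_left_mono)
          finally show ?thesis using norm_triangle_ineq2[of "Ln z" "z - 1"] by simp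
        qed
        then have s: "\<bar>s\<bar> \<le> 2 * cmod (z - 1)" using abs_Im_le_cmod[of "Ln z"] by (simp add: s_def)
        have "E z = (G (cis (t + s)) - c * cis (t + s)) - (G (cis t) - c * cis t)"
          unfolding E_def zs by (simp add: algebra_simps flip: cis_mult)
        also have "cmod \<dots> \<le> e * \<bar>t + s - t\<bar>" using s True by (intro d) (auto simp: d'_def)
        also have "\<dots> \<le> e * (2 * cmod (z - 1))" using s e by (intro mult_left_mono) auto
        finally have "cmod (E z) \<le> 2 * e * cmod (z - 1)" by simp
        then show ?thesis using K by (simp add: add_increasing2)
      next
        case False
        then have "d'\<^sup>2 \<le> (cmod (z - 1))\<^sup>2" using d' by (intro power_mono) auto
        then have "1 \<le> (cmod (z - 1))\<^sup>2 / d'\<^sup>2" using d' by (simp add: pos_le_divide_eq)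
        then have "(M + cmod c) * cmod (z - 1) * 1 \<le> (M + cmod c) * cmod (z - 1) * ((cmod (z - 1))\<^sup>2 / d'\<^sup>2)"
          using M0 by (intro mult_left_mono) auto
        also have "\<dots> = K * cmod (z - 1) ^ 3" by (simp add: K_def power2_eq_square power3_eq_cube)
        finally show ?thesis using Elip[OF z] e by (simp add: add_increasing)
      qed
      then show ?thesis using K by blast
    qed
    show ?thesis
    proof (rule tendstoI)
      fix \<epsilon> :: real assume \<epsilon>: "\<epsilon> > 0"
      \<comment> \<open>The derivative bound multiplies the slope \<open>2 * (\<epsilon>/64)\<close>
        by 16, which leaves \<open>\<epsilon>/2\<close>.\<close>
      obtain K where K: "K \<ge> 0" "\<And>z. cmod z = 1 \<Longrightarrow> cmod (E z) \<le> (2 * (\<epsilon>/64)) * cmod (z - 1) + K * cmod (z - 1) ^ 3"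
        using bound[of "\<epsilon>/64"] \<epsilon> by auto
      have "((\<lambda>r::real. 64 * K * (1 - r)) \<longlongrightarrow> 64 * K * (1 - 1)) (at_left 1)"
        by (intro tendsto_intros)
      then have ev1: "\<forall>\<^sub>F r in at_left (1::real). 64 * K * (1 - r) < \<epsilon>/2"
        using \<epsilon> by (intro order_tendstoD(2)) auto
      have ev2: "\<forall>\<^sub>F r in at_left (1::real). r > 0"
        using eventually_at_left_real[of 0 1] by (auto elim: eventually_mono)
      have ev3: "\<forall>\<^sub>F r in at_left (1::real). r < 1" by (simp add: eventually_at_filter)
      show "\<forall>\<^sub>F r in at_left 1. dist (g (of_real r * cis t)) (\<kappa> t) < \<epsilon>"
        using ev1 ev2 ev3
      proof eventually_elim
        case (elim r)
        have "cmod (deriv E (of_real r)) \<le> 16 * (2 * (\<epsilon>/64)) + 64 * K * (1 - r)"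
          by (rule radial_deriv_bound[OF cE hE _ _ K(2)]) (use elim \<epsilon> K(1) in auto)
        moreover have "deriv E (of_real r) = cis t * (g (cis t * of_real r) - c)"
          by (rule DERIV_imp_deriv[OF dE]) (use elim in auto)
        ultimately have "cmod (g (cis t * of_real r) - c) \<le> \<epsilon>/2 + 64 * K * (1 - r)"
          by (simp add: norm_mult)
        then have "cmod (g (cis t * of_real r) - c) < \<epsilon>" using elim(1) by linarith
        then show ?case by (simp add: dist_norm c_def mult.commute)
      qed
    qed
  qed
  \<comment> \<open>The endpoints are discarded because the derivative of the boundary curve is
    two-sided.\<close>
  have "negligible (N0 \<union> N1 \<union> {0, 2*pi})" using N0 N1(1) by auto
  then show ?thesis
    unfolding circ_AE_iff_negligible
    by (rule negligible_subset) (use main in \<open>force simp: less_le\<close>)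
qed

section \<open>Weak-star density\<close>

text \<open>Free choice of a finite index set lets sums and products of span elements be indexed by
  disjoint unions and cartesian products, with no merging of equal exponents.\<close>

lemma exp_spanI_sum:
  assumes "finite A" "\<And>i. i \<in> A \<Longrightarrow> l i \<le> 0"
  shows "(\<lambda>z. \<Sum>i\<in>A. c i * exp (complex_of_real (l i) * z)) \<in> exp_span"
proof -
  obtain n and e :: "nat \<Rightarrow> 'a" where e: "bij_betw e {..<n} A"
    using ex_bij_betw_nat_finite[OF assms(1)] by (auto simp: atLeast0LessThan)
  have "(\<Sum>i\<in>A. c i * exp (complex_of_real (l i) * z)) =
      (\<Sum>k<n. (c \<circ> e) k * exp (complex_of_real ((l \<circ> e) k) * z))" for z
    by (simp add: sum.reindex_bij_betw[OF e, of "\<lambda>i. c i * exp (complex_of_real (l i) * z)"])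
  moreover have "\<forall>k<n. (l \<circ> e) k \<le> 0" using e assms(2) by (auto simp: bij_betw_def)
  ultimately show ?thesis unfolding exp_span_def by blast
qed

lemma exp_span_exp: "l \<le> 0 \<Longrightarrow> (\<lambda>z. c * exp (complex_of_real l * z)) \<in> exp_span"
  using exp_spanI_sum[of "{()}" "\<lambda>_. l" "\<lambda>_. c"] by simp

lemma exp_span_const: "(\<lambda>z. c) \<in> exp_span"
  using exp_span_exp[of 0 c] by simp

lemma exp_span_add:
  assumes "f \<in> exp_span" "g \<in> exp_span"
  shows "(\<lambda>z. f z + g z) \<in> exp_span"
proof -
  obtain n c l where f: "f = (\<lambda>z. \<Sum>k<n. c k * exp (complex_of_real (l k) * z))" "\<forall>k<n::nat. l k \<le> 0"
    using assms(1) unfolding exp_span_def by blast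
  obtain m d j where g: "g = (\<lambda>z. \<Sum>k<m. d k * exp (complex_of_real (j k) * z))" "\<forall>k<m::nat. j k \<le> 0"
    using assms(2) unfolding exp_span_def by blast
  have "(\<lambda>z. \<Sum>i\<in>{..<n} <+> {..<m}. case_sum c d i * exp (complex_of_real (case_sum l j i) * z)) \<in> exp_span"
    by (rule exp_spanI_sum) (use f g in auto)
  then show ?thesis by (simp add: f g sum.Plus)
qed

lemma exp_span_mult:
  assumes "f \<in> exp_span" "g \<in> exp_span"
  shows "(\<lambda>z. f z * g z) \<in> exp_span"
proof -
  obtain n c l where f: "f = (\<lambda>z. \<Sum>k<n. c k * exp (complex_of_real (l k) * z))" "\<forall>k<n::nat. l k \<le> 0"
    using assms(1) unfolding exp_span_def by blast
  obtain m d j where g: "g = (\<lambda>z. \<Sum>k<m. d k * exp (complex_of_real (j k) * z))" "\<forall>k<m::nat. j k \<le> 0"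
    using assms(2) unfolding exp_span_def by blast
  have "(\<lambda>z. \<Sum>i\<in>{..<n} \<times> {..<m}. (c (fst i) * d (snd i)) * exp (complex_of_real (l (fst i) + j (snd i)) * z)) \<in> exp_span"
    by (rule exp_spanI_sum) (use f g in \<open>auto intro: add_nonpos_nonpos\<close>)
  then show ?thesis
    by (simp add: f g sum_product sum.cartesian_product case_prod_beta exp_add distrib_left distrib_right mult_ac)
qed

lemma exp_span_power: "f \<in> exp_span \<Longrightarrow> (\<lambda>z. f z ^ n) \<in> exp_span"
  by (induction n) (auto intro: exp_span_const exp_span_mult)

lemma exp_span_sum: "(\<And>i. i \<in> A \<Longrightarrow> f i \<in> exp_span) \<Longrightarrow> (\<lambda>z. \<Sum>i\<in>A. f i z) \<in> exp_span"
  by (induction A rule: infinite_finite_induct) (auto intro: exp_span_const exp_span_add)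

lemma exp_span_holomorphic: "s \<in> exp_span \<Longrightarrow> s holomorphic_on A"
  unfolding exp_span_def by (auto intro!: holomorphic_intros)

text \<open>\<open>geom_exp a m\<close> is a partial sum of the geometric series for
  \<open>(1 - q) / (1 - q exp (-v/m))\<close> with \<open>q = exp (-1/m)\<close> and \<open>v = (z - \<i> Im a) / Re a\<close>; as \<open>m\<close> grows it
  tends to \<open>1 / (1 + v) = Re a / (z + cnj a)\<close>.\<close>

definition geom_exp :: "complex \<Rightarrow> nat \<Rightarrow> complex \<Rightarrow> complex" where
  "geom_exp a m z = (1 - exp (- 1 / real m)) *
     (\<Sum>k<m\<^sup>2. exp (- (of_nat k / of_nat m) * (1 + (z - \<i> * Im a) / Re a)))"

text \<open>The target is the Cayley transform
  \<open>(z - a) / (z + cnj a) = 1 - 2 * Re a / (z + cnj a)\<close>. The denominator compensates the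
  worst truncation error, so that the approximants stay in the closed unit disc.\<close>

definition cayley_approx :: "complex \<Rightarrow> nat \<Rightarrow> complex \<Rightarrow> complex" where
  "cayley_approx a m z = (1 - 2 * geom_exp a m z) / (1 + 2 * exp (- real m))"

lemma geom_exp_in_exp_span:
  assumes "Re a > 0"
  shows "geom_exp a m \<in> exp_span"
proof -
  have "(\<lambda>z. \<Sum>k<m\<^sup>2. ((1 - exp (- 1 / real m)) * exp (- (of_nat k / of_nat m) * (1 - \<i> * Im a / Re a)))
      * exp (complex_of_real (- (real k / (real m * Re a))) * z)) \<in> exp_span"
    by (rule exp_spanI_sum) (use assms in auto)
  moreover have "geom_exp a m z = (\<Sum>k<m\<^sup>2. ((1 - exp (- 1 / real m)) * exp (- (of_nat k / of_nat m) * (1 - \<i> * Im a / Re a)))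
      * exp (complex_of_real (- (real k / (real m * Re a))) * z))" for z
  proof -
    have "- (of_nat k / of_nat m) * (1 + (z - \<i> * Im a) / Re a) =
        - (of_nat k / of_nat m) * (1 - \<i> * Im a / Re a) + complex_of_real (- (real k / (real m * Re a))) * z" for k
      by (simp add: ring_distribs diff_divide_distrib)
    then have "exp (- (of_nat k / of_nat m) * (1 + (z - \<i> * Im a) / Re a)) =
        exp (- (of_nat k / of_nat m) * (1 - \<i> * Im a / Re a)) * exp (complex_of_real (- (real k / (real m * Re a))) * z)" for k
      by (simp only: exp_add)
    then show ?thesis unfolding geom_exp_def by (simp add: sum_distrib_left mult_ac)
  qed
  ultimately show ?thesis by presburger
qed

lemma cayley_approx_in_exp_span:
  assumes "Re a > 0"
  shows "cayley_approx a m \<in> exp_span"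
proof -
  have "(\<lambda>z. inverse (1 + 2 * exp (- of_real (real m))) * (1 + (-2) * geom_exp a m z)) \<in> exp_span"
    by (intro exp_span_mult exp_span_add exp_span_const geom_exp_in_exp_span assms)
  moreover have "cayley_approx a m = (\<lambda>z. inverse (1 + 2 * exp (- of_real (real m))) * (1 + (-2) * geom_exp a m z))"
    by (simp add: cayley_approx_def fun_eq_iff divide_inverse exp_of_real[symmetric])
  ultimately show ?thesis by simp
qed

definition geom_lim :: "complex \<Rightarrow> nat \<Rightarrow> complex \<Rightarrow> complex" where
  "geom_lim a m z = (1 - exp (- 1 / real m)) / (1 - exp (- (1 / of_nat m) * (1 + (z - \<i> * Im a) / Re a)))"

text \<open>The ratio of the series has modulus at most \<open>q = exp (-1/m)\<close>, and
  \<open>m\<^sup>2\<close> terms leave a remainder of at most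
  \<open>q ^ m\<^sup>2 = exp (-m)\<close>. The second bound places the full sum
  \<open>(1 - q) / (1 - y)\<close> in the disc with centre and radius 1/2, which amounts to
  \<open>Re y \<le> q\<close>.\<close>

lemma geom_bounds:
  assumes a: "Re a > 0" and z: "Re z \<ge> 0" and m: "m > 0"
  shows "cmod (geom_exp a m z - geom_lim a m z) \<le> exp (- real m)"
    and "cmod (1 - 2 * geom_lim a m z) \<le> 1"
proof -
  define q :: real where "q = exp (- 1 / real m)"
  define v where "v = (z - \<i> * Im a) / Re a"
  define X where "X = exp (- (1 / of_nat m) * v)"
  have q: "0 < q" "q < 1" using m by (auto simp: q_def)
  have "Re v \<ge> 0" using a z by (simp add: v_def)
  then have X: "cmod X \<le> 1" using m by (simp add: X_def)
  have qX: "exp (- (1 / of_nat m) * (1 + v)) = q * X"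
    by (simp add: q_def X_def distrib_left exp_add exp_of_real[symmetric] exp_diff exp_minus divide_inverse)
  have n1: "cmod (of_real q * X) \<le> q" using q X by (simp add: norm_mult)
  have d: "1 - q \<le> cmod (1 - of_real q * X)"
    using norm_triangle_ineq2[of 1 "of_real q * X"] n1 by simp
  have d0: "1 - of_real q * X \<noteq> 0" using d q by auto
  have L: "geom_lim a m z = of_real (1 - q) / (1 - of_real q * X)"
    unfolding geom_lim_def v_def[symmetric] qX by (simp add: q_def exp_of_real[symmetric])
  have "exp (- (of_nat k / of_nat m) * (1 + v)) = (of_real q * X) ^ k" for k
    unfolding qX[symmetric] exp_of_nat_mult[symmetric] by simp
  then have "geom_exp a m z = of_real (1 - q) * (\<Sum>k<m\<^sup>2. (of_real q * X) ^ k)"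
    unfolding geom_exp_def v_def[symmetric] by (simp add: q_def exp_of_real[symmetric])
  also have "\<dots> = geom_lim a m z * (1 - (of_real q * X) ^ m\<^sup>2)"
  proof -
    have "of_real q * X \<noteq> 1" using d0 by auto
    then show ?thesis unfolding L by (simp add: sum_gp_strict)
  qed
  finally have "geom_exp a m z - geom_lim a m z = - (geom_lim a m z * (of_real q * X) ^ m\<^sup>2)"
    by (simp add: algebra_simps)
  then have "cmod (geom_exp a m z - geom_lim a m z) = cmod (geom_lim a m z) * cmod (of_real q * X) ^ m\<^sup>2"
    by (simp only: norm_minus_cancel norm_mult norm_power)
  also have "\<dots> \<le> 1 * q ^ m\<^sup>2"
  proof (intro mult_mono power_mono n1)
    have "cmod (of_real (1 - q)) = 1 - q" using q by (simp only: norm_of_real)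
    then show "cmod (geom_lim a m z) \<le> 1"
      unfolding L norm_divide using d q d0 by (simp add: divide_le_eq_1 del: of_real_diff)
  qed auto
  also have "q ^ m\<^sup>2 = exp (- real m)"
    using m by (simp add: q_def exp_of_nat_mult[symmetric] power2_eq_square)
  finally show "cmod (geom_exp a m z - geom_lim a m z) \<le> exp (- real m)" by simp
  have "1 - 2 * geom_lim a m z = ((1 - of_real q * X) - 2 * of_real (1 - q)) / (1 - of_real q * X)"
    unfolding L by (subst diff_divide_distrib) (use d0 in simp)
  moreover have "cmod ((1 - of_real q * X) - 2 * of_real (1 - q)) \<le> cmod (1 - of_real q * X)"
  proof -
    define y where "y = of_real q * X"
    have y: "Re y \<le> q" using n1 complex_Re_le_cmod[of y] by (simp add: y_def)
    have "(cmod (1 - y - 2 * of_real (1 - q)))\<^sup>2 = (cmod (1 - y))\<^sup>2 - 4 * (1 - q) * (q - Re y)"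
      unfolding cmod_power2 by (simp add: power2_eq_square algebra_simps)
    also have "\<dots> \<le> (cmod (1 - y))\<^sup>2" using y q by simp
    finally show ?thesis unfolding y_def by (rule power2_le_imp_le) simp
  qed
  ultimately show "cmod (1 - 2 * geom_lim a m z) \<le> 1"
    using d0 by (simp add: norm_divide divide_le_eq_1)
qed

lemma cayley_approx_norm_le:
  assumes a: "Re a > 0" and z: "Re z \<ge> 0" and m: "m > 0"
  shows "cmod (cayley_approx a m z) \<le> 1"
proof -
  have "1 - 2 * geom_exp a m z = (1 - 2 * geom_lim a m z) - 2 * (geom_exp a m z - geom_lim a m z)"
    by simp
  then have "cmod (1 - 2 * geom_exp a m z) \<le> cmod (1 - 2 * geom_lim a m z) + cmod (2 * (geom_exp a m z - geom_lim a m z))"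
    by (metis norm_triangle_ineq4)
  also have "\<dots> \<le> 1 + 2 * exp (- real m)"
    using geom_bounds[OF assms] unfolding norm_mult by simp
  finally have 1: "cmod (1 - 2 * geom_exp a m z) \<le> 1 + 2 * exp (- real m)" .
  have p: "0 < 1 + 2 * exp (- real m)" by (simp add: add_pos_pos)
  have "cmod (of_real (1 + 2 * exp (- real m))) = 1 + 2 * exp (- real m)"
    using p by (simp only: norm_of_real)
  then show ?thesis
    unfolding cayley_approx_def using 1 p by (simp add: norm_divide divide_le_eq_1)
qed

lemma cayley_approx_tendsto:
  assumes a: "Re a > 0" and z: "Re z \<ge> 0"
  shows "(\<lambda>m. cayley_approx a (Suc m) z) \<longlonglongrightarrow> (z - a) / (z + cnj a)"
proof -
  define v where "v = (z - \<i> * Im a) / Re a"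
  have v: "Re v \<ge> 0" using a z by (simp add: v_def)
  have v1: "1 + v \<noteq> 0" using v by (auto simp: complex_eq_iff)
  \<comment> \<open>\<open>geom_lim\<close> is a ratio of two difference quotients of
    \<open>exp\<close> at 0, with increments \<open>h\<close> and \<open>h * (1 + v)\<close>; hence
    the limit \<open>1 / (1 + v)\<close>.\<close>
  define h where "h = (\<lambda>m. - (1 / real (Suc m)))"
  have h0: "h \<longlonglongrightarrow> 0" unfolding h_def using LIMSEQ_inverse_real_of_nat tendsto_minus
    by (fastforce simp: divide_inverse)
  have hne: "h m \<noteq> 0" for m by (simp add: h_def)
  have e: "(\<lambda>m. (exp (of_real (h m) * w) - 1) / of_real (h m)) \<longlonglongrightarrow> w" for w :: complex
  proof -
    have "((\<lambda>x. exp (x * w)) has_field_derivative w) (at 0)"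
      by (auto intro!: derivative_eq_intros)
    then have "((\<lambda>x. (exp (x * w) - 1) / x) \<longlongrightarrow> w) (at 0)"
      by (simp add: has_field_derivative_iff)
    moreover have "filterlim (\<lambda>m. complex_of_real (h m)) (at 0) sequentially"
      unfolding filterlim_at using hne tendsto_of_real[OF h0, where 'a=complex] by auto
    ultimately show ?thesis by (rule filterlim_compose)
  qed
  have "(\<lambda>m. ((exp (of_real (h m) * 1) - 1) / of_real (h m)) / ((exp (of_real (h m) * (1 + v)) - 1) / of_real (h m))) \<longlonglongrightarrow> 1 / (1 + v)"
    by (intro tendsto_divide e v1)
  moreover have "((exp (of_real (h m) * 1) - 1) / of_real (h m)) / ((exp (of_real (h m) * (1 + v)) - 1) / of_real (h m)) = geom_lim a (Suc m) z" for m
  proof -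
    have "((exp (of_real (h m) * 1) - 1) / of_real (h m)) / ((exp (of_real (h m) * (1 + v)) - 1) / of_real (h m))
       = (1 - exp (of_real (h m))) / (1 - exp (of_real (h m) * (1 + v)))"
      using hne[of m] minus_divide_divide[of "1 - exp (of_real (h m))" "1 - exp (of_real (h m) * (1 + v))"] by simp
    then show ?thesis
      unfolding geom_lim_def v_def[symmetric] by (simp add: h_def exp_of_real[symmetric])
  qed
  ultimately have 1: "(\<lambda>m. geom_lim a (Suc m) z) \<longlonglongrightarrow> 1 / (1 + v)" by simp
  have ex: "(\<lambda>m. exp (- real (Suc m))) \<longlonglongrightarrow> 0"
  proof -
    have "(\<lambda>m. exp (-1) ^ Suc m :: real) \<longlonglongrightarrow> 0"
      by (intro LIMSEQ_Suc LIMSEQ_power_zero) simp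
    then show ?thesis by (simp add: exp_of_nat_mult[symmetric] del: power_Suc)
  qed
  have "(\<lambda>m. geom_exp a (Suc m) z - geom_lim a (Suc m) z) \<longlonglongrightarrow> 0"
    by (rule Lim_null_comparison[OF _ ex]) (intro always_eventually allI geom_bounds(1)[OF a z] zero_less_Suc)
  from tendsto_add[OF this 1] have 2: "(\<lambda>m. geom_exp a (Suc m) z) \<longlonglongrightarrow> 1 / (1 + v)" by simp
  have "(\<lambda>m. (1 - 2 * geom_exp a (Suc m) z) / (1 + 2 * of_real (exp (- real (Suc m))))) \<longlonglongrightarrow> (1 - 2 * (1 / (1 + v))) / (1 + 2 * of_real 0)"
    by (intro tendsto_intros 2 ex) auto
  moreover have "1 - 2 * (1 / (1 + v)) = (z - a) / (z + cnj a)"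
  proof -
    have r: "z + cnj a = Re a * (1 + v)" "z - a = Re a * (v - 1)"
      using a by (auto simp: v_def field_simps complex_eq_iff)
    show ?thesis unfolding r using v1 a by (simp add: divide_simps)
  qed
  ultimately show ?thesis by (simp add: cayley_approx_def)
qed

section \<open>Moebius maps onto the half-plane and rigidity of Riemann maps\<close>

text \<open>For \<open>Re a > 0\<close> and \<open>cmod u = 1\<close> this is the general conformal
  map of the disc onto the right half-plane sending 0 to \<open>a\<close>. Its inverse is the Cayley
  transform followed by division by \<open>u\<close>.\<close>

definition mob :: "complex \<Rightarrow> complex \<Rightarrow> complex \<Rightarrow> complex" where
  "mob a u w = (a + cnj a * (u * w)) / (1 - u * w)"

lemma mob_minus_plus:
  fixes u w :: complex
  assumes "u * w \<noteq> 1"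
  shows "mob a u w - a = 2 * Re a * (u * w) / (1 - u * w)" "mob a u w + cnj a = 2 * Re a / (1 - u * w)"
proof -
  have nz: "1 - u * w \<noteq> 0" using assms by auto
  have e: "complex_of_real (2 * Re a) = a + cnj a" by (simp add: complex_add_cnj)
  have "mob a u w - a = (a + cnj a * (u * w) - a * (1 - u * w)) / (1 - u * w)"
    unfolding mob_def using nz by (subst diff_divide_distrib) simp
  also have "a + cnj a * (u * w) - a * (1 - u * w) = (a + cnj a) * (u * w)" by algebra
  finally show "mob a u w - a = 2 * Re a * (u * w) / (1 - u * w)" unfolding e .
  have "mob a u w + cnj a = (a + cnj a * (u * w) + cnj a * (1 - u * w)) / (1 - u * w)"
    unfolding mob_def using nz by (subst add_divide_distrib) simp
  also have "a + cnj a * (u * w) + cnj a * (1 - u * w) = a + cnj a" by algebra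
  finally show "mob a u w + cnj a = 2 * Re a / (1 - u * w)" unfolding e .
qed

lemma mob_cayley:
  assumes "u * w \<noteq> 1" "Re a > 0"
  shows "(mob a u w - a) / (mob a u w + cnj a) = u * w"
proof -
  have "1 - u * w \<noteq> 0" using assms by auto
  then show ?thesis unfolding mob_minus_plus[OF assms(1)] using assms by (simp add: divide_simps)
qed

lemma Re_mob:
  assumes "cmod u = 1"
  shows "Re (mob a u w) = Re a * (1 - (cmod w)\<^sup>2) / (cmod (1 - u * w))\<^sup>2"
proof -
  define y where "y = u * w"
  have y: "cmod y = cmod w" using assms by (simp add: y_def norm_mult)
  have "mob a u w = (a + cnj a * y) * cnj (1 - y) / of_real ((cmod (1 - y))\<^sup>2)"
    unfolding mob_def y_def[symmetric] by (subst complex_div_cnj) simp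
  moreover have "Re ((a + cnj a * y) * cnj (1 - y)) = Re a * (1 - (cmod y)\<^sup>2)"
    unfolding cmod_power2 by (simp add: algebra_simps power2_eq_square)
  ultimately show ?thesis by (simp only: Re_divide_of_real y_def[symmetric] y)
qed

lemma unit_mult_neq_1: "cmod u = 1 \<Longrightarrow> cmod w < 1 \<Longrightarrow> u * w \<noteq> 1"
  by (metis mult_1 norm_mult norm_one less_irrefl)

lemma Re_mob_pos:
  assumes "cmod u = 1" "Re a > 0" "cmod w < 1"
  shows "Re (mob a u w) > 0"
  unfolding Re_mob[OF assms(1)] using assms unit_mult_neq_1[OF assms(1,3)]
  by (auto simp: abs_square_less_1 intro!: divide_pos_pos mult_pos_pos)

lemma Re_mob_nonneg:
  assumes "cmod u = 1" "Re a > 0" "cmod w \<le> 1"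
  shows "Re (mob a u w) \<ge> 0"
  unfolding Re_mob[OF assms(1)] using assms
  by (auto simp: abs_square_le_1 intro!: divide_nonneg_nonneg mult_nonneg_nonneg)

lemma mob_holomorphic: "cmod u = 1 \<Longrightarrow> mob a u holomorphic_on ball 0 1"
  unfolding mob_def using unit_mult_neq_1[of u] by (auto intro!: holomorphic_intros)

lemma mob_0 [simp]: "mob a u 0 = a"
  by (simp add: mob_def)

lemma cayley_lt_1:
  assumes "Re a > 0" "Re z > 0"
  shows "cmod ((z - a) / (z + cnj a)) < 1"
proof -
  have "(cmod (z - a))\<^sup>2 = (cmod (z + cnj a))\<^sup>2 - 4 * (Re z * Re a)"
    unfolding cmod_power2 by (simp add: power2_eq_square algebra_simps)
  also have "\<dots> < (cmod (z + cnj a))\<^sup>2" using assms by simp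
  finally have "cmod (z - a) < cmod (z + cnj a)" by (rule power_less_imp_less_base) simp
  then show ?thesis by (simp add: norm_divide divide_less_eq_1)
qed

lemma plus_cnj_nonzero: "Re a > 0 \<Longrightarrow> Re z \<ge> 0 \<Longrightarrow> z + cnj a \<noteq> 0"
  by (auto simp: complex_eq_iff)

text \<open>The Cayley transform turns \<open>\<phi>\<close> into a self-map \<open>f\<close> of the
  disc fixing 0, and the Schwarz lemma applies to \<open>f\<close> and to its inverse
  \<open>F\<close>. The two inequalities give equality at one nonzero point, so \<open>f\<close> is
  a rotation.\<close>

lemma riemann_map_C_plus:
  assumes hol: "\<phi> holomorphic_on ball 0 1" and bij: "bij_betw \<phi> (ball 0 1) C_plus"
  obtains u where "cmod u = 1" "\<And>w. cmod w < 1 \<Longrightarrow> \<phi> w = mob (\<phi> 0) u w"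
proof -
  define a where "a = \<phi> 0"
  have pos: "Re (\<phi> w) > 0" if "cmod w < 1" for w
    using bij_betwE[OF bij, rule_format, of w] that by (simp add: C_plus_def)
  have a: "Re a > 0" unfolding a_def by (rule pos) simp
  define f where "f = (\<lambda>w. (\<phi> w - a) / (\<phi> w + cnj a))"
  have nz: "\<phi> w + cnj a \<noteq> 0" if "cmod w < 1" for w
    using plus_cnj_nonzero[OF a, of "\<phi> w"] pos[OF that] by simp
  have f: "f holomorphic_on ball 0 1" unfolding f_def using nz by (intro holomorphic_intros hol) auto
  have f0: "f 0 = 0" by (simp add: f_def a_def)
  have f1: "cmod (f w) < 1" if "cmod w < 1" for w
    unfolding f_def by (rule cayley_lt_1[OF a pos[OF that]])
  have inj: "inj_on \<phi> (ball 0 1)" and im: "\<phi> ` ball 0 1 = C_plus"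
    using bij by (auto simp: bij_betw_def)
  obtain g where g: "g holomorphic_on C_plus" "\<And>z. z \<in> ball 0 1 \<Longrightarrow> g (\<phi> z) = z"
    using holomorphic_has_inverse[OF hol open_ball inj] im by metis
  have gz: "cmod (g z) < 1" "\<phi> (g z) = z" if z: "Re z > 0" for z
  proof -
    have "z \<in> \<phi> ` ball 0 1" using z im by (simp add: C_plus_def)
    then obtain w where w: "w \<in> ball 0 1" "z = \<phi> w" by blast
    show "cmod (g z) < 1" "\<phi> (g z) = z" using w g(2)[of w] by auto
  qed
  define F where "F = g \<circ> mob a 1"
  have F: "F holomorphic_on ball 0 1"
    unfolding F_def by (rule holomorphic_on_compose_gen[OF mob_holomorphic g(1)])
      (use Re_mob_pos[of 1, OF _ a] in \<open>auto simp: C_plus_def\<close>)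
  have F0: "F 0 = 0" using g(2)[of 0] by (simp add: F_def a_def)
  have F1: "cmod (F w) < 1" if "cmod w < 1" for w
    unfolding F_def o_def by (rule gz(1)[OF Re_mob_pos[OF _ a that]]) simp
  have fF: "f (F w) = w" if "cmod w < 1" for w
    unfolding f_def F_def o_def gz(2)[OF Re_mob_pos[OF norm_one a that]]
    using mob_cayley[OF unit_mult_neq_1[OF norm_one that] a] by simp
  \<comment> \<open>Since \<open>f z = 1/2\<close>, the two Schwarz inequalities read
    \<open>1/2 \<le> cmod z \<le> 1/2\<close>.\<close>
  define z where "z = F (1/2)"
  have "cmod (f z) = 1/2" unfolding z_def by (subst fF) auto
  moreover have "cmod z \<le> 1/2"
    using Schwarz_Lemma(1)[OF F F0 F1, of "1/2"] by (simp add: z_def)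
  moreover have "cmod (f z) \<le> cmod z"
    by (rule Schwarz_Lemma(1)[OF f f0 f1]) (use \<open>cmod z \<le> 1/2\<close> in auto)
  ultimately have "cmod z < 1 \<and> z \<noteq> 0 \<and> cmod (f z) = cmod z" by auto
  then obtain u where u: "\<And>w. cmod w < 1 \<Longrightarrow> f w = u * w" "cmod u = 1"
    using Schwarz_Lemma(3)[OF f f0 f1, of 0] by auto
  show ?thesis
  proof (rule that[OF u(2)])
    fix w :: complex assume w: "cmod w < 1"
    have "\<phi> w - a = u * w * (\<phi> w + cnj a)"
      using u(1)[OF w] nz[OF w] by (simp add: f_def divide_eq_eq)
    then have "\<phi> w * (1 - u * w) = a + cnj a * (u * w)" by algebra
    then show "\<phi> w = mob (\<phi> 0) u w"
      using unit_mult_neq_1[OF u(2) w] by (simp add: mob_def eq_divide_eq a_def)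
  qed
qed

section \<open>Boundary values of bounded functions\<close>

text \<open>Existence of limits is not assumed: functions agreeing along the radius have the same
  limit predicate, so \<open>Lim\<close> selects the same value even where nothing
  converges.\<close>

lemma boundary_val_cong:
  assumes "\<And>w. cmod w < 1 \<Longrightarrow> f w = g w"
  shows "boundary_val f t = boundary_val g t"
proof -
  have "\<forall>\<^sub>F r::real in at_left 1. f (of_real r * cis t) = g (of_real r * cis t)"
    using eventually_at_left_real[of "0::real" 1]
    by (auto elim!: eventually_mono intro!: assms simp: norm_mult)
  then have "((\<lambda>r. f (of_real r * cis t)) \<longlongrightarrow> l) (at_left 1) \<longleftrightarrow> ((\<lambda>r. g (of_real r * cis t)) \<longlongrightarrow> l) (at_left (1::real))" for l
    by (rule tendsto_cong)
  then show ?thesis unfolding boundary_val_def Topological_Spaces.Lim_def by simp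
qed

text \<open>The sequence starts with \<open>rad 0 = 0\<close>; arguments that need a positive radius
  shift the index by one.\<close>

definition rad :: "nat \<Rightarrow> real" where "rad n = 1 - inverse (real (Suc n))"

lemma rad: "0 \<le> rad n" "rad n < 1" "rad \<longlonglongrightarrow> 1" "filterlim rad (at_left 1) sequentially"
proof -
  show 1: "0 \<le> rad n" "rad n < 1" for n by (auto simp: rad_def inverse_le_1_iff)
  have "rad \<longlonglongrightarrow> 1 - 0"
    unfolding rad_def[abs_def] by (intro tendsto_intros LIMSEQ_inverse_real_of_nat)
  then show 2: "rad \<longlonglongrightarrow> 1" by simp
  show "filterlim rad (at_left 1) sequentially"
    unfolding filterlim_at using 1 2 by (auto intro!: always_eventually less_imp_neq)
qed

text \<open>\<open>boundary_val\<close> is uncontrolled on the null set where the radial limit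
  fails, so its measurability depends on completeness of Lebesgue measure.\<close>

lemma circ_borel_measurable_AE_LIMSEQ:
  fixes f :: "nat \<Rightarrow> real \<Rightarrow> complex"
  assumes m: "\<And>n. f n \<in> borel_measurable circ" and l: "AE t in circ. (\<lambda>n. f n t) \<longlonglongrightarrow> g t"
  shows "g \<in> borel_measurable circ"
proof -
  define N where "N = {t\<in>{0..2*pi}. \<not> (\<lambda>n. f n t) \<longlonglongrightarrow> g t}"
  have N: "N \<in> null_sets lebesgue"
    using l by (simp add: circ_AE_iff_negligible N_def negligible_iff_null_sets)
  define F where "F = (\<lambda>n t. if t \<in> N then 0 else if t \<in> {0..2*pi} then f n t else 0)"
  define G where "G = (\<lambda>t. if t \<in> N then 0 else if t \<in> {0..2*pi} then g t else 0)"
  have F: "F n \<in> borel_measurable lebesgue" for n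
  proof -
    have "(\<lambda>t. if t \<in> {0..2*pi} then f n t else 0) \<in> borel_measurable lebesgue"
      using m[of n] by (subst borel_measurable_if) auto
    from measurable_If_set[OF measurable_const this, of 0 N] show ?thesis
      unfolding F_def using null_setsD2[OF N] by simp
  qed
  have "G \<in> borel_measurable lebesgue"
  proof (rule borel_measurable_LIMSEQ_metric[OF F])
    fix t show "(\<lambda>n. F n t) \<longlonglongrightarrow> G t"
      by (cases "t \<in> N"; cases "t \<in> {0..2*pi}") (auto simp: F_def G_def N_def)
  qed
  moreover have "AE t in lebesgue. G t = (if t \<in> {0..2*pi} then g t else 0)"
    using AE_not_in[OF N] by eventually_elim (auto simp: G_def)
  ultimately have "(\<lambda>t. if t \<in> {0..2*pi} then g t else 0) \<in> borel_measurable lebesgue"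
    by (rule borel_measurable_AE)
  then show ?thesis by (subst (asm) borel_measurable_if) auto
qed

lemma bounded_boundary_val:
  assumes g: "g holomorphic_on ball 0 1" and bd: "\<forall>w\<in>ball 0 1. cmod (g w) \<le> M"
  shows "AE t in circ. ((\<lambda>r. g (of_real r * cis t)) \<longlongrightarrow> boundary_val g t) (at_left 1)"
    and "AE t in circ. (\<lambda>n. g (of_real (rad n) * cis t)) \<longlonglongrightarrow> boundary_val g t"
    and "AE t in circ. cmod (boundary_val g t) \<le> M"
    and "boundary_val g \<in> borel_measurable circ"
    and "\<And>n. (\<lambda>t. g (of_real (rad n) * cis t)) \<in> borel_measurable circ"
proof -
  have M: "\<And>w. cmod w < 1 \<Longrightarrow> cmod (g w) \<le> M" using bd by simp
  show 1: "AE t in circ. ((\<lambda>r. g (of_real r * cis t)) \<longlongrightarrow> boundary_val g t) (at_left 1)"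
  proof -
    have "AE t in circ. \<exists>l. ((\<lambda>r. g (of_real r * cis t)) \<longlongrightarrow> l) (at_left 1)"
      by (rule fatou_radial_limit[OF g M])
    then show ?thesis
    proof eventually_elim
      case (elim t)
      then obtain l where l: "((\<lambda>r. g (of_real r * cis t)) \<longlongrightarrow> l) (at_left 1)" by blast
      have "boundary_val g t = l"
        unfolding boundary_val_def by (rule tendsto_Lim[OF _ l]) simp
      with l show ?case by simp
    qed
  qed
  then show 2: "AE t in circ. (\<lambda>n. g (of_real (rad n) * cis t)) \<longlonglongrightarrow> boundary_val g t"
    by eventually_elim (rule filterlim_compose[OF _ rad(4)])
  then show "AE t in circ. cmod (boundary_val g t) \<le> M"
  proof eventually_elim
    case (elim t)
    show ?case
      by (rule tendsto_upperbound[OF tendsto_norm[OF elim]])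
        (use rad in \<open>auto intro!: always_eventually M simp: norm_mult\<close>)
  qed
  show 3: "(\<lambda>t. g (of_real (rad n) * cis t)) \<in> borel_measurable circ" for n
    using circ_integrable_continuous[OF circ_continuous_radial[OF g rad(1,2)]] by auto
  show "boundary_val g \<in> borel_measurable circ"
    by (rule circ_borel_measurable_AE_LIMSEQ[OF 3 2])
qed

lemma circ_integrable_bounded_mult:
  fixes f :: "real \<Rightarrow> complex" and h :: "real \<Rightarrow> real"
  assumes "f \<in> borel_measurable circ" "AE t in circ. cmod (f t) \<le> B" "integrable circ h"
  shows "integrable circ (\<lambda>t. cmod (f t) * h t)"
proof (rule Bochner_Integration.integrable_bound)
  show "integrable circ (\<lambda>t. B * \<bar>h t\<bar>)" using assms by auto
  show "(\<lambda>t. cmod (f t) * h t) \<in> borel_measurable circ" using assms by auto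
  show "AE t in circ. norm (cmod (f t) * h t) \<le> norm (B * \<bar>h t\<bar>)"
    using assms(2)
  proof eventually_elim
    case (elim t)
    moreover have "0 \<le> B" using order_trans[OF norm_ge_zero elim] .
    ultimately show ?case by (simp add: abs_mult mult_right_mono)
  qed
qed

lemma circ_dominated_mult:
  fixes f :: "nat \<Rightarrow> real \<Rightarrow> complex" and h :: "real \<Rightarrow> real"
  assumes f: "\<And>n. f n \<in> borel_measurable circ" and g: "g \<in> borel_measurable circ"
    and h: "integrable circ h"
    and fB: "\<And>n. AE t in circ. cmod (f n t) \<le> B" and gB: "AE t in circ. cmod (g t) \<le> B"
    and lim: "AE t in circ. (\<lambda>n. f n t) \<longlonglongrightarrow> g t"
  shows "(\<lambda>n. LINT t|circ. cmod (g t - f n t) * h t) \<longlonglongrightarrow> 0"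
proof -
  have "(\<lambda>n. LINT t|circ. cmod (g t - f n t) * h t) \<longlonglongrightarrow> (LINT t|circ. 0)"
  proof (rule integral_dominated_convergence[where w = "\<lambda>t. 2 * B * \<bar>h t\<bar>"])
    show "AE t in circ. (\<lambda>n. cmod (g t - f n t) * h t) \<longlonglongrightarrow> 0"
      using lim
    proof eventually_elim
      case (elim t)
      then have "(\<lambda>n. cmod (g t - f n t) * h t) \<longlonglongrightarrow> cmod (g t - g t) * h t"
        by (intro tendsto_intros)
      then show ?case by simp
    qed
    show "AE t in circ. norm (cmod (g t - f n t) * h t) \<le> 2 * B * \<bar>h t\<bar>" for n
      using fB[of n] gB
    proof eventually_elim
      case (elim t)
      have "cmod (g t - f n t) \<le> 2 * B" using norm_triangle_ineq4[of "g t" "f n t"] elim by simp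
      then show ?case by (simp add: abs_mult mult_right_mono)
    qed
    show "integrable circ (\<lambda>t. 2 * B * \<bar>h t\<bar>)" using h by auto
  qed (use f g h in auto)
  then show ?thesis by simp
qed

text \<open>The excluded point \<open>inverse u\<close> is the pole of \<open>mob a u\<close>. It
  corresponds to at most one parameter in the half-open interval; \<open>2*pi\<close> is excluded
  separately.\<close>

lemma AE_circ_unit_mult_neq_1:
  assumes "cmod u = 1"
  shows "AE t in circ. u * cis t \<noteq> 1"
proof -
  have "inj_on cis {0..<2*pi}"
  proof (rule inj_onI)
    fix x y assume xy: "x \<in> {0..<2*pi}" "y \<in> {0..<2*pi}" "cis x = cis y"
    then have "sin x = sin y \<and> cos x = cos y" by (simp add: complex_eq_iff)
    then obtain n :: int where n: "x = y + 2 * pi * n" using sin_cos_eq_iff by blast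
    then have e: "2 * pi * real_of_int n = x - y" by simp
    have "2 * pi * real_of_int n < 2 * pi * 1" "2 * pi * (-1) < 2 * pi * real_of_int n"
      unfolding e using xy(1,2) by auto
    then have "real_of_int n < 1" "-1 < real_of_int n"
      by (simp_all only: mult_less_cancel_left_pos pi_gt_zero zero_less_mult_iff zero_less_numeral simp_thms)
    then have "n = 0" by linarith
    then show "x = y" using n by simp
  qed
  then have "finite (cis -` {inverse u} \<inter> {0..<2*pi})" by (intro finite_vimage_IntI) auto
  then have "negligible ((cis -` {inverse u} \<inter> {0..<2*pi}) \<union> {2*pi})" by auto
  then show ?thesis
    unfolding circ_AE_iff_negligible
    by (rule negligible_subset) (auto simp: inverse_unique)
qed

section \<open>Approximation of bounded functions by the span\<close>

lemma taylor_uniform_approx: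
  assumes g: "g holomorphic_on ball 0 1" and r: "0 \<le> r" "r < 1" and e: "e > 0"
  obtains N and c :: "nat \<Rightarrow> complex" where "\<And>w. cmod w \<le> 1 \<Longrightarrow> cmod (g (of_real r * w) - (\<Sum>n<N. c n * w ^ n)) < e"
proof -
  define a where "a = (\<lambda>n. (deriv ^^ n) g 0 / fact n)"
  have pw: "(\<lambda>n. a n * w ^ n) sums g w" if "cmod w < 1" for w
    using holomorphic_power_series[OF g, of w] that by (simp add: a_def)
  obtain r' where r': "r < r'" "r' < 1" using r dense by blast
  have "summable (\<lambda>n. a n * of_real r' ^ n)"
    using pw[of "of_real r'"] r r' by (auto simp: sums_iff)
  then have sm: "summable (\<lambda>n. norm (a n * of_real r ^ n))"
    by (rule powser_insidea) (use r r' in auto)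
  have "uniform_limit (cball 0 1) (\<lambda>N w. \<Sum>n<N. (a n * of_real r ^ n) * w ^ n)
      (\<lambda>w. \<Sum>n. (a n * of_real r ^ n) * w ^ n) sequentially"
    by (rule Weierstrass_m_test[OF _ sm]) (simp add: norm_mult norm_power mult_left_le power_le_one)
  from uniform_limitD[OF this e] obtain N where
    N: "\<forall>w\<in>cball 0 1. dist (\<Sum>n<N. (a n * of_real r ^ n) * w ^ n) (\<Sum>n. (a n * of_real r ^ n) * w ^ n) < e"
    unfolding eventually_sequentially by blast
  have eq: "(\<Sum>n. (a n * of_real r ^ n) * w ^ n) = g (of_real r * w)" if "cmod w \<le> 1" for w
  proof -
    have "r * cmod w \<le> r * 1" using r that by (intro mult_left_mono) auto
    then have "cmod (of_real r * w) < 1" using r by (simp add: norm_mult)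
    from pw[OF this] show ?thesis by (simp add: sums_iff power_mult_distrib mult_ac)
  qed
  show ?thesis
    by (rule that[of "\<lambda>n. a n * of_real r ^ n" N]) (use N eq in \<open>simp add: dist_norm norm_minus_commute\<close>)
qed

lemma boundary_val_exp_span:
  assumes s: "s \<in> exp_span" and u: "u * cis t \<noteq> 1"
  shows "boundary_val (s \<circ> mob a u) t = s (mob a u (cis t))"
proof -
  have "((\<lambda>r::real. mob a u (of_real r * cis t)) \<longlongrightarrow> mob a u (of_real 1 * cis t)) (at_left 1)"
    unfolding mob_def by (intro tendsto_intros) (use u in auto)
  moreover have "isCont s z" for z
    using holomorphic_on_imp_continuous_on[OF exp_span_holomorphic[OF s, of UNIV]]
    by (simp add: continuous_on_eq_continuous_at)
  ultimately have "((\<lambda>r::real. s (mob a u (of_real r * cis t))) \<longlongrightarrow> s (mob a u (of_real 1 * cis t))) (at_left 1)"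
    by (rule isCont_tendsto_compose[rotated])
  from tendsto_Lim[OF _ this] show ?thesis by (simp add: boundary_val_def)
qed

text \<open>Three replacements share the error: \<open>g\<close> by a dilation, the dilation by a
  Taylor polynomial \<open>Q\<close>, and the variable of \<open>Q\<close> by an element of the
  span. The bound \<open>M + 1\<close> does not depend on \<open>e\<close>; this is what later turns
  smallness in mean into smallness of p-th powers.\<close>

lemma exp_span_approx:
  fixes h :: "real \<Rightarrow> real"
  assumes a: "Re a > 0" and u: "cmod u = 1"
    and g: "g holomorphic_on ball 0 1" and Mb: "\<forall>w\<in>ball 0 1. cmod (g w) \<le> M"
    and h: "integrable circ h" and h0: "\<And>t. 0 \<le> h t" and e: "e > 0"
  obtains s where "s \<in> exp_span" "\<And>z. Re z \<ge> 0 \<Longrightarrow> cmod (s z) \<le> M + 1"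
    "(LINT t|circ. cmod (boundary_val g t - boundary_val (s \<circ> mob a u) t) * h t) < e"
proof -
  have M: "\<And>w. cmod w < 1 \<Longrightarrow> cmod (g w) \<le> M" using Mb by simp
  note bg = bounded_boundary_val[OF g Mb]
  have M0: "0 \<le> M" using order_trans[OF norm_ge_zero M[of 0]] by simp
  have u0: "u \<noteq> 0" using u by auto
  let ?gr = "\<lambda>r t. g (of_real r * cis t)"
  have grM: "cmod (?gr (rad n) t) \<le> M" for n t
    by (rule M) (use rad in \<open>auto simp: norm_mult\<close>)
  have "(\<lambda>n. LINT t|circ. cmod (boundary_val g t - ?gr (rad n) t) * h t) \<longlonglongrightarrow> 0"
    by (rule circ_dominated_mult[OF bg(5,4) h _ bg(3,2)]) (use grM in auto)
  then have "\<forall>\<^sub>F n in sequentially. (LINT t|circ. cmod (boundary_val g t - ?gr (rad n) t) * h t) < e/3"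
    using e by (intro order_tendstoD(2)) auto
  then obtain n where n: "(LINT t|circ. cmod (boundary_val g t - ?gr (rad n) t) * h t) < e/3"
    by (auto simp: eventually_sequentially)
  define H where "H = (LINT t|circ. h t)"
  have H0: "0 \<le> H" unfolding H_def by (rule integral_nonneg_AE) (use h0 in auto)
  \<comment> \<open>The cap 1 yields the bound \<open>M + 1\<close> for \<open>Q\<close>; the other
    term keeps the uniform error, weighted by \<open>h\<close>, below \<open>e/3\<close>, and
    \<open>1 + H\<close> avoids dividing by zero.\<close>
  define \<eta> where "\<eta> = min 1 (e / (3 * (1 + H)))"
  have \<eta>: "\<eta> > 0" using e H0 by (simp add: \<eta>_def)
  obtain N and c :: "nat \<Rightarrow> complex" where
    c: "\<And>w. cmod w \<le> 1 \<Longrightarrow> cmod (g (of_real (rad n) * w) - (\<Sum>n<N. c n * w ^ n)) < \<eta>"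
    using taylor_uniform_approx[OF g rad(1,2) \<eta>] by blast
  define Q where "Q = (\<lambda>w. \<Sum>n<N. c n * w ^ n)"
  have QM: "cmod (Q w) \<le> M + 1" if "cmod w \<le> 1" for w
  proof -
    have "rad n * cmod w \<le> rad n * 1" using rad(1)[of n] that by (intro mult_left_mono) auto
    then have "cmod (of_real (rad n) * w) < 1" using rad(1,2)[of n] by (simp add: norm_mult)
    from M[OF this] c[OF that] show ?thesis
      using norm_triangle_ineq2[of "Q w" "g (of_real (rad n) * w)"] by (simp add: Q_def \<eta>_def norm_minus_commute)
  qed
  have contQ: "isCont Q w" for w unfolding Q_def by (intro continuous_intros)
  \<comment> \<open>Along \<open>mob a u\<close> the Cayley approximants tend to
    \<open>u * w\<close>, so division by \<open>u\<close> recovers the disc coordinate. They stay in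
    the closed disc, where \<open>Q\<close> is bounded.\<close>
  define s where "s = (\<lambda>m z. Q (inverse u * cayley_approx a (Suc m) z))"
  have s: "s m \<in> exp_span" for m
    unfolding s_def Q_def
    by (intro exp_span_sum exp_span_mult exp_span_power exp_span_const cayley_approx_in_exp_span a)
  have sM: "cmod (s m z) \<le> M + 1" if "Re z \<ge> 0" for m z
    unfolding s_def using cayley_approx_norm_le[OF a that, of "Suc m"] u
    by (intro QM) (simp add: norm_mult norm_inverse)
  define S where "S = (\<lambda>m. s m \<circ> mob a u)"
  have sh: "S m holomorphic_on ball 0 1" for m
    unfolding S_def by (rule holomorphic_on_compose_gen[OF mob_holomorphic[OF u] exp_span_holomorphic[OF s, where A = UNIV]]) auto
  have sb: "\<forall>w\<in>ball 0 1. cmod (S m w) \<le> M + 1" for m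
    unfolding S_def o_def by (intro ballI sM Re_mob_nonneg[OF u a]) auto
  note bs = bounded_boundary_val[OF sh sb]
  have Qm: "(\<lambda>t. Q (cis t)) \<in> borel_measurable circ"
    unfolding Q_def
    by (intro borel_measurable_integrable circ_integrable_continuous continuous_intros)
  have lim: "AE t in circ. (\<lambda>m. boundary_val (S m) t) \<longlonglongrightarrow> Q (cis t)"
    using AE_circ_unit_mult_neq_1[OF u]
  proof eventually_elim
    case (elim t)
    have "(\<lambda>m. cayley_approx a (Suc m) (mob a u (cis t))) \<longlonglongrightarrow> u * cis t"
      using cayley_approx_tendsto[OF a Re_mob_nonneg[OF u a, of "cis t"]] mob_cayley[OF elim a] by simp
    then have "(\<lambda>m. inverse u * cayley_approx a (Suc m) (mob a u (cis t))) \<longlonglongrightarrow> inverse u * (u * cis t)"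
      by (intro tendsto_intros)
    moreover have "inverse u * (u * cis t) = cis t" using u0 by simp
    ultimately have "(\<lambda>m. inverse u * cayley_approx a (Suc m) (mob a u (cis t))) \<longlonglongrightarrow> cis t"
      by (simp only:)
    then show ?case
      unfolding S_def boundary_val_exp_span[OF s elim] by (unfold s_def) (rule isCont_tendsto_compose[OF contQ])
  qed
  have "(\<lambda>m. LINT t|circ. cmod (Q (cis t) - boundary_val (S m) t) * h t) \<longlonglongrightarrow> 0"
    by (rule circ_dominated_mult[OF bs(4) Qm h bs(3) _ lim]) (use QM in auto)
  then have "\<forall>\<^sub>F m in sequentially. (LINT t|circ. cmod (Q (cis t) - boundary_val (S m) t) * h t) < e/3"
    using e by (intro order_tendstoD(2)) auto
  then obtain m where m: "(LINT t|circ. cmod (Q (cis t) - boundary_val (S m) t) * h t) < e/3"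
    by (auto simp: eventually_sequentially)
  have mid: "(LINT t|circ. cmod (?gr (rad n) t - Q (cis t)) * h t) \<le> e/3"
  proof -
    have "(LINT t|circ. cmod (?gr (rad n) t - Q (cis t)) * h t) \<le> (LINT t|circ. \<eta> * h t)"
    proof (rule integral_mono)
      show "integrable circ (\<lambda>t. cmod (?gr (rad n) t - Q (cis t)) * h t)"
        by (rule circ_integrable_bounded_mult[where B = \<eta>, OF _ _ h])
          (use bg(5) Qm c in \<open>auto simp: Q_def intro!: less_imp_le\<close>)
      show "cmod (?gr (rad n) t - Q (cis t)) * h t \<le> \<eta> * h t" for t
        using c[of "cis t"] h0 by (intro mult_right_mono) (auto simp: Q_def)
    qed (use h in auto)
    also have "\<dots> = \<eta> * H" by (simp add: H_def)
    also have "\<dots> \<le> e / (3 * (1 + H)) * H" using H0 by (intro mult_right_mono) (auto simp: \<eta>_def)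
    also have "\<dots> \<le> e / (3 * (1 + H)) * (1 + H)" using H0 e by (intro mult_left_mono) auto
    also have "\<dots> = e / 3" using H0 by (simp add: field_simps)
    finally show ?thesis .
  qed
  show ?thesis
  proof (rule that[OF s sM])
    let ?b = "boundary_val (S m)"
    have i1: "integrable circ (\<lambda>t. cmod (boundary_val g t - ?gr (rad n) t) * h t)"
    proof (rule circ_integrable_bounded_mult[where B = "M + M", OF _ _ h])
      show "AE t in circ. cmod (boundary_val g t - ?gr (rad n) t) \<le> M + M"
        using bg(3)
      proof eventually_elim
        case (elim t)
        then show ?case using norm_triangle_ineq4[of "boundary_val g t" "?gr (rad n) t"] grM[of n t] by linarith
      qed
    qed (use bg(4,5) in auto)
    have i2: "integrable circ (\<lambda>t. cmod (?gr (rad n) t - Q (cis t)) * h t)"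
      by (rule circ_integrable_bounded_mult[where B = \<eta>, OF _ _ h])
        (use bg(5) Qm c in \<open>auto simp: Q_def intro!: less_imp_le\<close>)
    have i3: "integrable circ (\<lambda>t. cmod (Q (cis t) - ?b t) * h t)"
    proof (rule circ_integrable_bounded_mult[where B = "(M + 1) + (M + 1)", OF _ _ h])
      show "AE t in circ. cmod (Q (cis t) - ?b t) \<le> (M + 1) + (M + 1)"
        using bs(3)[of m]
      proof eventually_elim
        case (elim t)
        then show ?case using norm_triangle_ineq4[of "Q (cis t)" "?b t"] QM[of "cis t"] by simp
      qed
    qed (use bs(4) Qm in auto)
    have "(LINT t|circ. cmod (boundary_val g t - ?b t) * h t) \<le>
      (LINT t|circ. cmod (boundary_val g t - ?gr (rad n) t) * h t + cmod (?gr (rad n) t - Q (cis t)) * h t + cmod (Q (cis t) - ?b t) * h t)"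
    proof (rule integral_mono')
      show "cmod (boundary_val g t - ?b t) * h t \<le>
         cmod (boundary_val g t - ?gr (rad n) t) * h t + cmod (?gr (rad n) t - Q (cis t)) * h t + cmod (Q (cis t) - ?b t) * h t" for t
      proof -
        have "cmod (boundary_val g t - ?b t) \<le> cmod (boundary_val g t - ?gr (rad n) t) + cmod (?gr (rad n) t - Q (cis t)) + cmod (Q (cis t) - ?b t)"
          using norm_triangle_ineq[of "(boundary_val g t - ?gr (rad n) t) + (?gr (rad n) t - Q (cis t))" "Q (cis t) - ?b t"]
            norm_triangle_ineq[of "boundary_val g t - ?gr (rad n) t" "?gr (rad n) t - Q (cis t)"] by simp
        from mult_right_mono[OF this h0[of t]] show ?thesis by (simp only: distrib_right)
      qed
    qed (use i1 i2 i3 h0 in auto)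
    also have "\<dots> = (LINT t|circ. cmod (boundary_val g t - ?gr (rad n) t) * h t) + (LINT t|circ. cmod (?gr (rad n) t - Q (cis t)) * h t) + (LINT t|circ. cmod (Q (cis t) - ?b t) * h t)"
      using i1 i2 i3 by simp
    also have "\<dots> < e" using n mid m by linarith
    finally show "(LINT t|circ. cmod (boundary_val g t - boundary_val (s m \<circ> mob a u) t) * h t) < e"
      by (simp only: S_def)
  qed
qed

theorem weak_star_dense_exp_span:
  assumes hol: "\<phi> holomorphic_on ball 0 1" and bij: "bij_betw \<phi> (ball 0 1) C_plus"
  shows "weak_star_dense \<phi> exp_span"
  unfolding weak_star_dense_def weak_star_closure_pt_def
proof (intro allI impI)
  fix f and hs :: "(real \<Rightarrow> complex) list" and \<epsilon> :: real
  assume f: "hardy_inf C_plus f" and e: "\<epsilon> > 0" and hs: "\<forall>h\<in>set hs. integrable circ h"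
  obtain u where u: "cmod u = 1" "\<And>w. cmod w < 1 \<Longrightarrow> \<phi> w = mob (\<phi> 0) u w"
    using riemann_map_C_plus[OF hol bij] by blast
  have im: "\<phi> w \<in> C_plus" if "cmod w < 1" for w using bij_betwE[OF bij] that by simp
  have a: "Re (\<phi> 0) > 0" using im[of 0] by (simp add: C_plus_def)
  obtain M where M: "\<And>z. z \<in> C_plus \<Longrightarrow> cmod (f z) \<le> M"
    using f by (auto simp: hardy_inf_def bounded_iff)
  have fh: "(f \<circ> \<phi>) holomorphic_on ball 0 1"
    by (rule holomorphic_on_compose_gen[OF hol, of f C_plus]) (use f im in \<open>auto simp: hardy_inf_def\<close>)
  have fMb: "\<forall>w\<in>ball 0 1. cmod ((f \<circ> \<phi>) w) \<le> M" using M[OF im] by simp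
  \<comment> \<open>One weight dominating every test function in the list, so that a single element
    of the span serves all of them.\<close>
  define h where "h = (\<lambda>t. \<Sum>k\<in>set hs. cmod (k t))"
  have h: "integrable circ h" unfolding h_def using hs by auto
  have h0: "0 \<le> h t" for t by (simp add: h_def sum_nonneg)
  have "\<exists>s\<in>exp_span. (\<forall>z. Re z \<ge> 0 \<longrightarrow> cmod (s z) \<le> M + 1) \<and>
    (LINT t|circ. cmod (boundary_val (f \<circ> \<phi>) t - boundary_val (s \<circ> mob (\<phi> 0) u) t) * h t) < \<epsilon>"
    by (rule exp_span_approx[OF a u(1) fh fMb h h0 e]) blast
  then obtain s where s: "s \<in> exp_span" and s23: "(\<forall>z. Re z \<ge> 0 \<longrightarrow> cmod (s z) \<le> M + 1) \<and>
    (LINT t|circ. cmod (boundary_val (f \<circ> \<phi>) t - boundary_val (s \<circ> mob (\<phi> 0) u) t) * h t) < \<epsilon>"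
    by (rule bexE)
  note s2 = s23[THEN conjunct1, rule_format] and s3 = s23[THEN conjunct2]
  have sb: "boundary_val (s \<circ> \<phi>) t = boundary_val (s \<circ> mob (\<phi> 0) u) t" for t
    by (rule boundary_val_cong) (unfold o_def, rule arg_cong[OF u(2)])
  have sh: "(s \<circ> \<phi>) holomorphic_on ball 0 1"
    by (rule holomorphic_on_compose_gen[OF hol exp_span_holomorphic[OF s, of UNIV]]) auto
  have sM: "\<forall>w\<in>ball 0 1. cmod ((s \<circ> \<phi>) w) \<le> M + 1"
    using s2 im by (auto simp: C_plus_def less_imp_le)
  let ?d = "\<lambda>t. boundary_val (f \<circ> \<phi>) t - boundary_val (s \<circ> \<phi>) t"
  note bf = bounded_boundary_val[OF fh fMb] and bs = bounded_boundary_val[OF sh sM]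
  have dm: "?d \<in> borel_measurable circ" by (rule borel_measurable_diff[OF bf(4) bs(4)])
  have dB: "AE t in circ. cmod (?d t) \<le> M + (M + 1)"
    using bf(3) bs(3)
  proof eventually_elim
    case (elim t)
    then show ?case
      using norm_triangle_ineq4[of "boundary_val (f \<circ> \<phi>) t" "boundary_val (s \<circ> \<phi>) t"] by linarith
  qed
  show "\<exists>s\<in>exp_span. \<forall>h\<in>set hs.
      cmod (LINT t|circ. (boundary_val (f \<circ> \<phi>) t - boundary_val (s \<circ> \<phi>) t) * h t) < \<epsilon>"
  proof (intro bexI ballI)
    fix k assume k: "k \<in> set hs"
    have "cmod (LINT t|circ. ?d t * k t) \<le> (LINT t|circ. cmod (?d t * k t))"
      by (rule integral_norm_bound)
    also have "\<dots> \<le> (LINT t|circ. cmod (?d t) * h t)"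
    proof (rule integral_mono')
      show "integrable circ (\<lambda>t. cmod (?d t) * h t)"
        by (rule circ_integrable_bounded_mult[OF dm dB h])
      show "cmod (?d t * k t) \<le> cmod (?d t) * h t" for t
        unfolding norm_mult h_def by (intro mult_left_mono member_le_sum k) auto
    qed (use h0 in simp)
    also have "\<dots> < \<epsilon>" using s3 by (simp add: sb)
    finally show "cmod (LINT t|circ. ?d t * k t) < \<epsilon>" .
  qed (rule s)
qed

section \<open>Harmonic majorants\<close>

text \<open>The bare function \<open>|f|\<^sup>q - Re T\<close> is only locally dominated from below by harmonic functions, so a
  multiple of \<open>|z|\<^sup>2\<close> is added: at an interior maximum this forces \<open>exp \<Psi>\<close>, with \<open>\<Psi>\<close> holomorphic, to have
  a strict local maximum of its modulus.\<close>

lemma norm_powr_le_Re_maximum_principle: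
  assumes f: "f holomorphic_on ball 0 R" and T: "T holomorphic_on ball 0 R" and R: "R > 1" and q: "q > 0"
    and le: "\<And>z. cmod z = 1 \<Longrightarrow> cmod (f z) powr q \<le> Re (T z)" and w: "cmod w \<le> 1"
  shows "cmod (f w) powr q \<le> Re (T w)"
proof (rule ccontr)
  assume neg: "\<not> cmod (f w) powr q \<le> Re (T w)"
  \<comment> \<open>Half of the violation: the perturbation \<open>\<eta> * (cmod z)\<^sup>2\<close>
    is at most \<open>\<eta>\<close>, while the maximum of \<open>\<Phi>\<close> is at least
    \<open>2 * \<eta>\<close>. The maximum therefore lies neither on the circle nor at a zero of
    \<open>f\<close>.\<close>
  define \<eta> where "\<eta> = (cmod (f w) powr q - Re (T w)) / 2"
  have \<eta>: "\<eta> > 0" using neg by (simp add: \<eta>_def)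
  have sub: "cball 0 1 \<subseteq> ball (0::complex) R" using R by auto
  have cf: "continuous_on (cball 0 1) f" and cT: "continuous_on (cball 0 1) T"
    using f T sub by (meson continuous_on_subset holomorphic_on_imp_continuous_on)+
  have hf: "f holomorphic_on ball 0 1" and hT: "T holomorphic_on ball 0 1"
    using f T R by (auto elim!: holomorphic_on_subset)
  \<comment> \<open>This excludes zeros of \<open>f\<close> at the maximum of \<open>\<Phi>\<close>,
    where a logarithm of \<open>f\<close> would not exist.\<close>
  have ReT: "Re (T z) \<ge> 0" if "cmod z \<le> 1" for z
  proof -
    have "cmod (exp (- T z)) \<le> 1"
    proof (rule maximum_modulus_frontier[of "\<lambda>z. exp (- T z)" "cball 0 1"])
      show "(\<lambda>z. exp (- T z)) holomorphic_on interior (cball 0 1)"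
        using hT by (auto intro!: holomorphic_intros)
      show "continuous_on (closure (cball 0 1)) (\<lambda>z. exp (- T z))"
        using cT by (auto intro!: continuous_intros)
      fix z assume "z \<in> frontier (cball (0::complex) 1)"
      then have "cmod (f z) powr q \<le> Re (T z)" by (intro le) (simp add: frontier_cball)
      then have "0 \<le> Re (T z)" using powr_ge_zero[of "cmod (f z)" q] by linarith
      then show "cmod (exp (- T z)) \<le> 1" by simp
    qed (use that in auto)
    then show ?thesis by simp
  qed
  define \<Phi> where "\<Phi> = (\<lambda>z. cmod (f z) powr q - Re (T z) + \<eta> * (cmod z)\<^sup>2)"
  have "continuous_on (cball 0 1) \<Phi>"
    unfolding \<Phi>_def using q by (auto intro!: continuous_intros cf cT continuous_on_powr')
  then obtain w0 where w0: "cmod w0 \<le> 1" and max: "\<And>z. cmod z \<le> 1 \<Longrightarrow> \<Phi> z \<le> \<Phi> w0"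
    using continuous_attains_sup[of "cball 0 1" \<Phi>] by auto
  have big: "2 * \<eta> \<le> \<Phi> w0"
  proof -
    have "2 * \<eta> = cmod (f w) powr q - Re (T w)" by (simp add: \<eta>_def)
    also have "\<dots> \<le> \<Phi> w" using \<eta> by (simp add: \<Phi>_def)
    also have "\<dots> \<le> \<Phi> w0" by (rule max[OF w])
    finally show ?thesis .
  qed
  have "cmod w0 \<noteq> 1"
  proof
    assume "cmod w0 = 1"
    then show False using big le[of w0] \<eta> by (simp add: \<Phi>_def)
  qed
  then have w01: "cmod w0 < 1" using w0 by simp
  have fw0: "f w0 \<noteq> 0"
  proof
    assume "f w0 = 0"
    then have "\<Phi> w0 = - Re (T w0) + \<eta> * (cmod w0)\<^sup>2" by (simp add: \<Phi>_def)
    also have "\<dots> \<le> 0 + \<eta> * 1"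
      using ReT[OF w0] \<eta> w0 by (intro add_mono mult_left_mono) (auto simp: abs_square_le_1)
    finally show False using big \<eta> by simp
  qed
  have "isCont f w0"
    using holomorphic_on_imp_continuous_on[OF hf] w01 by (simp add: continuous_on_eq_continuous_at)
  then have "\<forall>\<^sub>F z in nhds w0. f z \<noteq> 0"
    using fw0 by (simp add: isCont_def tendsto_at_iff_tendsto_nhds t1_space_nhds tendsto_imp_eventually_ne)
  moreover have "\<forall>\<^sub>F z in nhds w0. z \<in> ball 0 1" using w01 by (intro eventually_nhds_in_open) auto
  ultimately have "\<forall>\<^sub>F z in nhds w0. f z \<noteq> 0 \<and> z \<in> ball 0 1" by (rule eventually_conj)
  then obtain d where d: "d > 0" "\<And>z. z \<in> ball w0 d \<Longrightarrow> f z \<noteq> 0" "\<And>z. z \<in> ball w0 d \<Longrightarrow> cmod z < 1"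
    unfolding eventually_nhds_metric by (auto simp: dist_commute)
  have dsub: "ball w0 d \<subseteq> ball 0 1" using d(3) by auto
  obtain L where L: "L holomorphic_on ball w0 d" "\<And>z. z \<in> ball w0 d \<Longrightarrow> f z = exp (L z)"
    using contractible_imp_holomorphic_log[OF holomorphic_on_subset[OF hf dsub] convex_imp_contractible[OF convex_ball] d(2)]
    by blast
  \<comment> \<open>A local branch of the power \<open>q\<close> of \<open>f\<close>, rotated to be
    positive at \<open>w0\<close>: its real part equals \<open>cmod (f w0) powr q\<close> there and
    stays below \<open>cmod (f z) powr q\<close> nearby.\<close>
  define K where "K = (\<lambda>z. exp (of_real q * L z - \<i> * of_real (q * Im (L w0))))"
  have K: "cmod (K z) = cmod (f z) powr q" if "z \<in> ball w0 d" for z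
    using L(2)[OF that] d(2)[OF that] by (simp add: K_def powr_def)
  have Kw0: "Re (K w0) = cmod (f w0) powr q"
  proof -
    have "of_real q * L w0 - \<i> * of_real (q * Im (L w0)) = of_real (q * Re (L w0))"
      by (simp add: complex_eq_iff)
    then have "K w0 = of_real (exp (q * Re (L w0)))" by (simp only: K_def exp_of_real)
    then have "Re (K w0) = cmod (K w0)" by simp
    then show ?thesis using K[of w0] d(1) by simp
  qed
  \<comment> \<open>The linear term is the holomorphic part of the expansion of
    \<open>\<eta> * (cmod z)\<^sup>2\<close> about \<open>w0\<close>; what remains is the strictly
    negative \<open>- \<eta> * (cmod (z - w0))\<^sup>2\<close>.\<close>
  define \<Psi> where "\<Psi> = (\<lambda>z. K z - T z + 2 * of_real \<eta> * cnj w0 * (z - w0) - (K w0 - T w0))"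
  have \<Psi>h: "\<Psi> holomorphic_on ball w0 d"
    unfolding \<Psi>_def K_def using L(1) holomorphic_on_subset[OF hT dsub] by (intro holomorphic_intros)
  have \<Psi>: "Re (\<Psi> z) \<le> - \<eta> * (cmod (z - w0))\<^sup>2" if z: "z \<in> ball w0 d" for z
  proof -
    have e: "(cmod z)\<^sup>2 = (cmod w0)\<^sup>2 + 2 * Re (cnj w0 * (z - w0)) + (cmod (z - w0))\<^sup>2"
      unfolding cmod_power2 by (simp add: power2_eq_square algebra_simps)
    have "Re (\<Psi> z) = Re (K z) - Re (T z) + \<eta> * (2 * Re (cnj w0 * (z - w0))) - (Re (K w0) - Re (T w0))"
      by (simp add: \<Psi>_def algebra_simps)
    also have "\<dots> \<le> cmod (f z) powr q - Re (T z) + \<eta> * (2 * Re (cnj w0 * (z - w0))) - (Re (K w0) - Re (T w0))"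
      using complex_Re_le_cmod[of "K z"] K[OF z] by simp
    also have "\<dots> = \<Phi> z - \<Phi> w0 - \<eta> * (cmod (z - w0))\<^sup>2"
      unfolding \<Phi>_def Kw0 e by (simp add: algebra_simps)
    also have "\<dots> \<le> - \<eta> * (cmod (z - w0))\<^sup>2" using max[of z] d(3)[OF z] by simp
    finally show ?thesis .
  qed
  have \<Psi>0: "\<Psi> w0 = 0" by (simp add: \<Psi>_def)
  have "(\<lambda>z. exp (\<Psi> z)) constant_on ball w0 d"
  proof (rule maximum_modulus_principle[of _ _ "ball w0 d" w0])
    show "(\<lambda>z. exp (\<Psi> z)) holomorphic_on ball w0 d" by (intro holomorphic_intros \<Psi>h)
    show "cmod (exp (\<Psi> z)) \<le> cmod (exp (\<Psi> w0))" if "z \<in> ball w0 d" for z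
    proof -
      have "- \<eta> * (cmod (z - w0))\<^sup>2 \<le> 0" using \<eta> by simp
      then show ?thesis using \<Psi>[OF that] by (simp add: \<Psi>0)
    qed
  qed (use d in auto)
  then have "exp (\<Psi> z) = exp (\<Psi> w0)" if "z \<in> ball w0 d" for z
    using that d(1) unfolding constant_on_def by (metis centre_in_ball)
  from this[of "w0 + of_real (d/2)"] have "exp (\<Psi> (w0 + of_real (d/2))) = 1"
    using d(1) by (simp add: \<Psi>0 dist_norm)
  then have "cmod (exp (\<Psi> (w0 + of_real (d/2)))) = 1" by simp
  then have "Re (\<Psi> (w0 + of_real (d/2))) = 0" by simp
  moreover have "Re (\<Psi> (w0 + of_real (d/2))) \<le> - \<eta> * (cmod (of_real (d/2)))\<^sup>2"
    using \<Psi>[of "w0 + of_real (d/2)"] d(1) by (simp add: dist_norm)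
  moreover have "- \<eta> * (cmod (of_real (d/2) :: complex))\<^sup>2 < 0" using \<eta> d(1) by simp
  ultimately show False by linarith
qed

section \<open>Harmonic polynomials on the circle\<close>

text \<open>On the circle these are the real trigonometric polynomials. Restricting to the circle
  makes them an algebra, although products of harmonic polynomials are in general not
  harmonic.\<close>

definition Re_poly_circle :: "(complex \<Rightarrow> real) set" where
  "Re_poly_circle = {k. \<exists>p. \<forall>z. cmod z = 1 \<longrightarrow> k z = Re (poly p z)}"

lemma Re_poly_circle_add:
  assumes "k \<in> Re_poly_circle" "l \<in> Re_poly_circle"
  shows "(\<lambda>z. k z + l z) \<in> Re_poly_circle"
proof -
  obtain p q where "\<And>z. cmod z = 1 \<Longrightarrow> k z = Re (poly p z)" "\<And>z. cmod z = 1 \<Longrightarrow> l z = Re (poly q z)"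
    using assms by (auto simp: Re_poly_circle_def)
  then show ?thesis unfolding Re_poly_circle_def by (auto intro!: exI[of _ "p + q"])
qed

lemma Re_poly_circle_const: "(\<lambda>z. c) \<in> Re_poly_circle"
  unfolding Re_poly_circle_def by (auto intro!: exI[of _ "[:of_real c:]"])

lemma Re_poly_circle_sum:
  "(\<And>i. i \<in> A \<Longrightarrow> k i \<in> Re_poly_circle) \<Longrightarrow> (\<lambda>z. \<Sum>i\<in>A. k i z) \<in> Re_poly_circle"
  by (induction A rule: infinite_finite_induct) (auto intro: Re_poly_circle_const Re_poly_circle_add)

text \<open>Use \<open>2 * Re x * Re y = Re (x * y + x * cnj y)\<close>. On the circle
  \<open>z ^ i * cnj z ^ j\<close> collapses to \<open>z ^ (i - j)\<close> for
  \<open>j \<le> i\<close>; the other case is symmetric.\<close>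

lemma Re_monom_mult:
  "(\<lambda>z. Re (c * z ^ i) * Re (d * z ^ j)) \<in> Re_poly_circle"
proof -
  have *: "\<exists>p. \<forall>z. cmod z = 1 \<longrightarrow> Re (c * z ^ i) * Re (d * z ^ j) = Re (poly p z)" if "j \<le> i" for c d i j
  proof (intro exI allI impI)
    fix z :: complex assume z: "cmod z = 1"
    have zz: "z * cnj z = 1" using z by (simp flip: complex_norm_square)
    have "z ^ i * cnj z ^ j = z ^ (i - j) * (z * cnj z) ^ j"
      using that by (simp add: power_mult_distrib flip: power_add mult.assoc)
    then have e: "z ^ i * cnj z ^ j = z ^ (i - j)" by (simp add: zz)
    have "Re (c * z ^ i) * Re (d * z ^ j) = Re (((c * z ^ i) * (d * z ^ j) + (c * z ^ i) * cnj (d * z ^ j)) / 2)"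
    proof -
      have "Re x * Re y = Re ((x * y + x * cnj y) / 2)" for x y :: complex by simp
      then show ?thesis .
    qed
    also have "(c * z ^ i) * (d * z ^ j) = c * d * z ^ (i + j)" by (simp add: power_add)
    also have "(c * z ^ i) * cnj (d * z ^ j) = c * cnj d * (z ^ i * cnj z ^ j)" by simp
    also have "\<dots> = c * cnj d * z ^ (i - j)" by (simp only: e)
    finally show "Re (c * z ^ i) * Re (d * z ^ j) = Re (poly (monom (c * d / 2) (i + j) + monom (c * cnj d / 2) (i - j)) z)"
      by (simp add: poly_monom add_divide_distrib)
  qed
  show ?thesis
  proof (cases "j \<le> i")
    case True then show ?thesis using *[OF True] by (simp add: Re_poly_circle_def)
  next
    case False then show ?thesis using *[of i j d c] by (simp add: Re_poly_circle_def mult.commute)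
  qed
qed

lemma Re_poly_circle_mult:
  assumes "k \<in> Re_poly_circle" "l \<in> Re_poly_circle"
  shows "(\<lambda>z. k z * l z) \<in> Re_poly_circle"
proof -
  obtain p q where pq: "\<And>z. cmod z = 1 \<Longrightarrow> k z = Re (poly p z)" "\<And>z. cmod z = 1 \<Longrightarrow> l z = Re (poly q z)"
    using assms by (auto simp: Re_poly_circle_def)
  have "(\<lambda>z. \<Sum>i\<le>degree p. \<Sum>j\<le>degree q. Re (coeff p i * z ^ i) * Re (coeff q j * z ^ j)) \<in> Re_poly_circle"
    by (intro Re_poly_circle_sum Re_monom_mult)
  then obtain r where r: "\<And>z. cmod z = 1 \<Longrightarrow>
      (\<Sum>i\<le>degree p. \<Sum>j\<le>degree q. Re (coeff p i * z ^ i) * Re (coeff q j * z ^ j)) = Re (poly r z)"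
    by (auto simp: Re_poly_circle_def)
  have "Re (poly p z) * Re (poly q z) = (\<Sum>i\<le>degree p. \<Sum>j\<le>degree q. Re (coeff p i * z ^ i) * Re (coeff q j * z ^ j))" for z
    unfolding poly_altdef Re_sum sum_product ..
  then show ?thesis unfolding Re_poly_circle_def using pq r by auto
qed

lemma real_polynomial_function_Re_poly_circle:
  fixes k :: "complex \<Rightarrow> real"
  shows "real_polynomial_function k \<Longrightarrow> k \<in> Re_poly_circle"
proof (induction rule: real_polynomial_function.induct)
  case (linear k)
  interpret bounded_linear k by fact
  have "k z = Re (poly [:0, of_real (k 1) - \<i> * of_real (k \<i>):] z)" for z
  proof -
    have "k z = k (Re z *\<^sub>R 1 + Im z *\<^sub>R \<i>)" by (rule arg_cong[of _ _ k]) (simp add: complex_eq_iff)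
    also have "\<dots> = Re z * k 1 + Im z * k \<i>" by (simp only: add scaleR real_scaleR_def)
    finally show ?thesis by (simp add: algebra_simps)
  qed
  then show ?case unfolding Re_poly_circle_def by blast
qed (auto intro: Re_poly_circle_const Re_poly_circle_add Re_poly_circle_mult)

lemma circle_Re_poly_approx:
  fixes k :: "complex \<Rightarrow> real"
  assumes "continuous_on (sphere 0 1) k" "e > 0"
  obtains p where "\<And>z. cmod z = 1 \<Longrightarrow> \<bar>k z - Re (poly p z)\<bar> < e"
proof -
  obtain l where l: "real_polynomial_function l" "\<And>z. z \<in> sphere 0 1 \<Longrightarrow> \<bar>k z - l z\<bar> < e"
    using Stone_Weierstrass_real_polynomial_function[OF compact_sphere assms] by blast
  obtain p where "\<And>z. cmod z = 1 \<Longrightarrow> l z = Re (poly p z)"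
    using real_polynomial_function_Re_poly_circle[OF l(1)] by (auto simp: Re_poly_circle_def)
  then show ?thesis using l(2) by (intro that[of p]) auto
qed

text \<open>Approximating \<open>cmod (F z) powr q + 2 * e / 3\<close> within \<open>e/3\<close> on
  the circle leaves a margin of \<open>e/3\<close> below and a total of at most \<open>e\<close>
  above. The maximum principle carries the lower margin inside, where it gives strict
  positivity.\<close>

lemma exists_dominating_poly:
  assumes F: "F holomorphic_on ball 0 R" and R: "R > 1" and q: "q > 0" and e: "e > 0"
  obtains p where "Im (poly p 0) = 0" "\<And>z. cmod z \<le> 1 \<Longrightarrow> cmod (F z) powr q \<le> Re (poly p z)"
    "\<And>z. cmod z \<le> 1 \<Longrightarrow> 0 < Re (poly p z)"
    "\<And>z. cmod z = 1 \<Longrightarrow> Re (poly p z) \<le> cmod (F z) powr q + e"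
proof -
  have sub: "sphere 0 1 \<subseteq> ball (0::complex) R" using R by auto
  have "continuous_on (sphere 0 1) F"
    using F sub by (meson continuous_on_subset holomorphic_on_imp_continuous_on)
  then have "continuous_on (sphere 0 1) (\<lambda>z. cmod (F z) powr q + 2 * e / 3)"
    using q by (auto intro!: continuous_intros continuous_on_powr')
  then obtain p0 where p0: "\<And>z. cmod z = 1 \<Longrightarrow> \<bar>(cmod (F z) powr q + 2 * e / 3) - Re (poly p0 z)\<bar> < e/3"
    using circle_Re_poly_approx[of _ "e/3"] e by auto
  define p where "p = p0 - [:\<i> * of_real (Im (poly p0 0)):]"
  have Rep: "Re (poly p z) = Re (poly p0 z)" for z by (simp add: p_def)
  have dom: "cmod (F z) powr q \<le> Re (poly p z) - e/3" if "cmod z \<le> 1" for z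
  proof -
    have "cmod (F z) powr q \<le> Re (poly p z - of_real (e/3))"
    proof (rule norm_powr_le_Re_maximum_principle[OF F _ R q _ that])
      fix w :: complex assume "cmod w = 1"
      from p0[OF this] show "cmod (F w) powr q \<le> Re (poly p w - of_real (e/3))"
        unfolding minus_complex.sel Rep Re_complex_of_real by linarith
    qed (auto intro!: holomorphic_intros)
    then show ?thesis by simp
  qed
  show ?thesis
  proof (rule that[of p])
    show "Im (poly p 0) = 0" by (simp add: p_def)
    show "cmod (F z) powr q \<le> Re (poly p z)" if "cmod z \<le> 1" for z using dom[OF that] e by simp
    show "0 < Re (poly p z)" if "cmod z \<le> 1" for z
      using dom[OF that] e powr_ge_zero[of "cmod (F z)" q] by linarith
    show "Re (poly p z) \<le> cmod (F z) powr q + e" if "cmod z = 1" for z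
      using p0[OF that] unfolding Rep by linarith
  qed
qed

section \<open>Normal families and square means of majorants\<close>

text \<open>The Schwarz lemma for the Cayley transform of \<open>T\<close> centred at
  \<open>T 0\<close>. It supplies the local bounds for Montel's theorem.\<close>

lemma Re_pos_growth:
  assumes T: "T holomorphic_on ball 0 1" and pos: "\<And>z. cmod z < 1 \<Longrightarrow> Re (T z) > 0"
    and Im0: "Im (T 0) = 0" and C: "Re (T 0) \<le> C" and z: "cmod z \<le> r" and r: "r < 1"
  shows "cmod (T z) \<le> C * (1 + r) / (1 - r)"
proof -
  define c where "c = Re (T 0)"
  have c: "c > 0" unfolding c_def by (rule pos) simp
  have T0: "T 0 = of_real c" using Im0 by (simp add: c_def complex_eq_iff)
  have z1: "cmod z < 1" using z r by simp
  define \<omega> where "\<omega> = (\<lambda>z. (T z - of_real c) / (T z + cnj (of_real c)))"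
  have nz: "T w + of_real c \<noteq> 0" if "cmod w < 1" for w
    using plus_cnj_nonzero[of "of_real c" "T w"] pos[OF that] c by simp
  have "\<omega> holomorphic_on ball 0 1"
    unfolding \<omega>_def using nz by (auto intro!: holomorphic_intros T)
  moreover have "\<omega> 0 = 0" by (simp add: \<omega>_def T0)
  moreover have "cmod (\<omega> w) < 1" if "cmod w < 1" for w
    unfolding \<omega>_def by (rule cayley_lt_1) (use pos[OF that] c in auto)
  ultimately have \<omega>: "cmod (\<omega> z) \<le> cmod z" using Schwarz_Lemma(1) z1 by blast
  have "\<omega> z * (T z + of_real c) = T z - of_real c" using nz[OF z1] by (simp add: \<omega>_def)
  then have "T z * (1 - \<omega> z) = of_real c * (1 + \<omega> z)" by algebra
  then have "cmod (T z) * cmod (1 - \<omega> z) = c * cmod (1 + \<omega> z)"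
    using c by (metis norm_mult norm_of_real abs_of_pos)
  moreover have "cmod (T z) * (1 - r) \<le> cmod (T z) * cmod (1 - \<omega> z)"
    using norm_triangle_ineq2[of 1 "\<omega> z"] \<omega> z by (intro mult_left_mono) auto
  moreover have "c * cmod (1 + \<omega> z) \<le> c * (1 + r)"
    using norm_triangle_ineq[of 1 "\<omega> z"] \<omega> z c by (intro mult_left_mono) auto
  ultimately have "cmod (T z) * (1 - r) \<le> c * (1 + r)" by linarith
  also have "\<dots> \<le> C * (1 + r)" using C order_trans[OF norm_ge_zero z] by (intro mult_right_mono) (auto simp: c_def)
  finally show ?thesis using r by (simp add: pos_le_divide_eq)
qed

lemma circ_poly_mean: "(LINT t|circ. Re (poly p (cis t))) = 2 * pi * Re (poly p 0)"
proof -
  have i: "integrable circ (\<lambda>t. poly p (cis t))"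
    by (rule circ_integrable_continuous) (intro continuous_intros)
  have "(LINT t|circ. poly p (of_real 1 * cis t)) = 2 * pi * poly p 0"
    by (rule circ_mean_value) (auto intro!: continuous_intros holomorphic_intros)
  then have "Re (LINT t|circ. poly p (cis t)) = 2 * pi * Re (poly p 0)" by simp
  then show ?thesis by (simp only: integral_Re[OF i])
qed

text \<open>Since \<open>|w|^2 = 2 (Re w)^2 - Re (w^2)\<close>, it suffices that the mean of
  \<open>Re (p^2)\<close> is nonnegative; it is the square of the real number
  \<open>poly p 0\<close>. This is the mean square bound for the conjugate function.\<close>

lemma circ_poly_square_le:
  assumes "Im (poly p 0) = 0"
  shows "(LINT t|circ. (cmod (poly p (cis t)))\<^sup>2) \<le> 2 * (LINT t|circ. (Re (poly p (cis t)))\<^sup>2)"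
proof -
  have "(LINT t|circ. Re (poly (p * p) (cis t))) = 2 * pi * (Re (poly p 0))\<^sup>2"
    unfolding circ_poly_mean using assms by (simp add: power2_eq_square)
  then have nn: "0 \<le> (LINT t|circ. Re (poly (p * p) (cis t)))" by simp
  have i: "integrable circ (\<lambda>t. 2 * (Re (poly p (cis t)))\<^sup>2)" "integrable circ (\<lambda>t. Re (poly (p * p) (cis t)))"
    by (intro circ_integrable_continuous continuous_intros)+
  have "(LINT t|circ. (cmod (poly p (cis t)))\<^sup>2) = (LINT t|circ. 2 * (Re (poly p (cis t)))\<^sup>2 - Re (poly (p * p) (cis t)))"
    by (intro Bochner_Integration.integral_cong refl) (simp add: cmod_power2, simp add: power2_eq_square)
  also have "\<dots> = (LINT t|circ. 2 * (Re (poly p (cis t)))\<^sup>2) - (LINT t|circ. Re (poly (p * p) (cis t)))"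
    by (rule Bochner_Integration.integral_diff[OF i])
  also have "\<dots> \<le> (LINT t|circ. 2 * (Re (poly p (cis t)))\<^sup>2)" using nn by simp
  finally show ?thesis by simp
qed

lemma circ_square_mono:
  assumes f: "f holomorphic_on ball 0 R" and r: "0 \<le> s" "s \<le> r" "r < R"
  shows "(LINT t|circ. (cmod (f (of_real s * cis t)))\<^sup>2) \<le> (LINT t|circ. (cmod (f (of_real r * cis t)))\<^sup>2)"
proof -
  have "(LINT t|circ. (cmod (f (of_real s * cis t)))\<^sup>2) / (2*pi) \<le> (LINT t|circ. (cmod (f (of_real r * cis t)))\<^sup>2) / (2*pi)"
    by (rule sums_le[OF _ circ_parseval_holomorphic[OF f] circ_parseval_holomorphic[OF f]])
      (use r in \<open>auto intro!: mult_left_mono power_mono\<close>)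
  then show ?thesis by (simp add: divide_le_cancel)
qed

text \<open>The harmonic function \<open>Re H\<close> is a limit of harmonic polynomials approximating the boundary values of
  \<open>|F (\<rho> z)|\<^sup>q\<close> from above; no Poisson integral is needed.\<close>

theorem exists_harmonic_majorant:
  assumes F: "F holomorphic_on ball 0 1" and q: "q > 0"
    and \<rho>: "\<And>j. 0 < \<rho> j" "\<And>j. \<rho> j < 1" "\<rho> \<longlonglongrightarrow> 1"
    and mean: "\<And>j. (LINT t|circ. cmod (F (of_real (\<rho> j) * cis t)) powr q) \<le> 2 * pi * C"
  obtains H where "H holomorphic_on ball 0 1" "\<And>z. cmod z < 1 \<Longrightarrow> cmod (F z) powr q \<le> Re (H z)"
    "Re (H 0) \<le> C"
    "\<And>D r. \<lbrakk>\<And>j. (LINT t|circ. cmod (F (of_real (\<rho> j) * cis t)) powr (2 * q)) \<le> D; 0 \<le> r; r < 1\<rbrakk>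
       \<Longrightarrow> (LINT t|circ. (cmod (H (of_real r * cis t)))\<^sup>2) \<le> 4 * D + 8 * pi"
proof -
  define \<eta> where "\<eta> = (\<lambda>j. inverse (real (Suc j)))"
  have \<eta>: "\<eta> j > 0" "\<eta> j \<le> 1" for j by (auto simp: \<eta>_def inverse_le_1_iff)
  have \<eta>0: "\<eta> \<longlonglongrightarrow> 0" unfolding \<eta>_def[abs_def] by (rule LIMSEQ_inverse_real_of_nat)
  have Fj: "(\<lambda>z. F (of_real (\<rho> j) * z)) holomorphic_on ball 0 (1 / \<rho> j)" for j
  proof -
    have "(F \<circ> (\<lambda>z. of_real (\<rho> j) * z)) holomorphic_on ball 0 (1 / \<rho> j)"
      by (rule holomorphic_on_compose_gen[OF _ F]) (use \<rho>(1)[of j] in \<open>auto intro!: holomorphic_intros simp: norm_mult field_simps\<close>)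
    then show ?thesis by (simp add: o_def)
  qed
  have R: "1 / \<rho> j > 1" for j using \<rho>(1,2)[of j] by simp
  have "\<exists>p. Im (poly p 0) = 0 \<and> (\<forall>z. cmod z \<le> 1 \<longrightarrow> cmod (F (of_real (\<rho> j) * z)) powr q \<le> Re (poly p z)) \<and>
      (\<forall>z. cmod z \<le> 1 \<longrightarrow> 0 < Re (poly p z)) \<and>
      (\<forall>z. cmod z = 1 \<longrightarrow> Re (poly p z) \<le> cmod (F (of_real (\<rho> j) * z)) powr q + \<eta> j)" for j
    by (rule exists_dominating_poly[OF Fj R q \<eta>(1)]) blast
  then obtain p where p0: "\<And>j. Im (poly (p j) 0) = 0"
    and p1: "\<And>j z. cmod z \<le> 1 \<Longrightarrow> cmod (F (of_real (\<rho> j) * z)) powr q \<le> Re (poly (p j) z)"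
    and p2: "\<And>j z. cmod z \<le> 1 \<Longrightarrow> 0 < Re (poly (p j) z)"
    and p3: "\<And>j z. cmod z = 1 \<Longrightarrow> Re (poly (p j) z) \<le> cmod (F (of_real (\<rho> j) * z)) powr q + \<eta> j"
    by metis
  have cF: "continuous_on {0..2*pi} (\<lambda>t. F (of_real (\<rho> j) * cis t))" for j
    by (rule circ_continuous_radial[OF F]) (use \<rho>(1,2)[of j] in auto)
  have iF: "integrable circ (\<lambda>t. cmod (F (of_real (\<rho> j) * cis t)) powr q')" if "q' > 0" for q' j
    by (rule circ_integrable_continuous) (use that in \<open>auto intro!: continuous_intros continuous_on_powr' cF\<close>)
  have C0: "Re (poly (p j) 0) \<le> C + \<eta> j" for j
  proof -
    have "2 * pi * Re (poly (p j) 0) = (LINT t|circ. Re (poly (p j) (cis t)))"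
      by (rule circ_poly_mean[symmetric])
    also have "\<dots> \<le> (LINT t|circ. cmod (F (of_real (\<rho> j) * cis t)) powr q + \<eta> j)"
    proof (rule integral_mono)
      show "integrable circ (\<lambda>t. Re (poly (p j) (cis t)))"
        by (intro circ_integrable_continuous continuous_intros)
      show "integrable circ (\<lambda>t. cmod (F (of_real (\<rho> j) * cis t)) powr q + \<eta> j)"
        using iF[OF q] by (intro Bochner_Integration.integrable_add) auto
    qed (use p3 in auto)
    also have "\<dots> = (LINT t|circ. cmod (F (of_real (\<rho> j) * cis t)) powr q) + 2 * pi * \<eta> j"
      using iF[OF q] by (subst Bochner_Integration.integral_add) auto
    also have "\<dots> \<le> 2 * pi * (C + \<eta> j)" using mean[of j] by (simp add: algebra_simps)
    finally show ?thesis by simp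
  qed
  \<comment> \<open>\<open>C + 1\<close> covers \<open>C + \<eta> j\<close> for every
    \<open>j\<close>. Positivity of the real part takes the place of a uniform bound, which control
    of the means alone does not give.\<close>
  define \<H> where "\<H> = {h. h holomorphic_on ball 0 1 \<and> (\<forall>z. cmod z < 1 \<longrightarrow> Re (h z) > 0) \<and> Im (h 0) = 0 \<and> Re (h 0) \<le> C + 1}"
  obtain H \<sigma> where H: "H holomorphic_on ball 0 1" and \<sigma>: "strict_mono (\<sigma> :: nat \<Rightarrow> nat)"
    and lim: "\<And>z. z \<in> ball 0 1 \<Longrightarrow> (\<lambda>n. poly (p (\<sigma> n)) z) \<longlonglongrightarrow> H z"
    and unif: "\<And>K. compact K \<Longrightarrow> K \<subseteq> ball 0 1 \<Longrightarrow> uniform_limit K ((\<lambda>n. poly (p n)) \<circ> \<sigma>) H sequentially"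
  proof (rule Montel[of "ball 0 1" \<H> "\<lambda>n. poly (p n)"])
    show "\<And>h. h \<in> \<H> \<Longrightarrow> h holomorphic_on ball 0 1" by (simp add: \<H>_def)
    show "range (\<lambda>n. poly (p n)) \<subseteq> \<H>"
    proof safe
      fix n
      have "Re (poly (p n) 0) \<le> C + 1" using C0[of n] \<eta>(2)[of n] by linarith
      then show "poly (p n) \<in> \<H>"
        unfolding \<H>_def using p0 p2 by (auto intro!: holomorphic_intros)
    qed
    fix K :: "complex set" assume K: "compact K" "K \<subseteq> ball 0 1"
    obtain r where r: "r < 1" "K \<subseteq> cball 0 r"
    proof (cases "K = {}")
      case False
      obtain x where x: "x \<in> K" "\<And>y. y \<in> K \<Longrightarrow> cmod y \<le> cmod x"
        using continuous_attains_sup[OF K(1) False, of cmod] by (auto intro: continuous_intros)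
      then show ?thesis using K(2) by (intro that[of "cmod x"]) auto
    qed (use that[of 0] in auto)
    show "\<exists>B. \<forall>h\<in>\<H>. \<forall>z\<in>K. cmod (h z) \<le> B"
    proof (intro exI ballI)
      fix h z assume h: "h \<in> \<H>" and z: "z \<in> K"
      show "cmod (h z) \<le> (C + 1) * (1 + r) / (1 - r)"
        by (rule Re_pos_growth) (use h z r in \<open>auto simp: \<H>_def\<close>)
    qed
  qed auto
  show ?thesis
  proof (rule that[OF H])
    have \<rho>\<sigma>: "(\<lambda>n. \<rho> (\<sigma> n)) \<longlonglongrightarrow> 1" "(\<lambda>n. \<eta> (\<sigma> n)) \<longlonglongrightarrow> 0"
      using LIMSEQ_subseq_LIMSEQ[OF \<rho>(3) \<sigma>] LIMSEQ_subseq_LIMSEQ[OF \<eta>0 \<sigma>] by (auto simp: o_def)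
    show "cmod (F z) powr q \<le> Re (H z)" if z: "cmod z < 1" for z
    proof (rule LIMSEQ_le)
      have "isCont F z"
        using holomorphic_on_imp_continuous_on[OF F] z by (simp add: continuous_on_eq_continuous_at)
      moreover have "(\<lambda>n. of_real (\<rho> (\<sigma> n)) * z) \<longlonglongrightarrow> of_real 1 * z" by (intro tendsto_intros \<rho>\<sigma>)
      ultimately have "(\<lambda>n. F (of_real (\<rho> (\<sigma> n)) * z)) \<longlonglongrightarrow> F z"
        by (intro isCont_tendsto_compose[of z F]) auto
      then show "(\<lambda>n. cmod (F (of_real (\<rho> (\<sigma> n)) * z)) powr q) \<longlonglongrightarrow> cmod (F z) powr q"
        using q by (intro tendsto_powr' tendsto_norm tendsto_const) auto
      show "(\<lambda>n. Re (poly (p (\<sigma> n)) z)) \<longlonglongrightarrow> Re (H z)" by (intro tendsto_Re lim) (use z in auto)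
      show "\<exists>N. \<forall>n\<ge>N. cmod (F (of_real (\<rho> (\<sigma> n)) * z)) powr q \<le> Re (poly (p (\<sigma> n)) z)"
        using p1 z by auto
    qed
    show "Re (H 0) \<le> C"
    proof (rule LIMSEQ_le)
      show "(\<lambda>n. Re (poly (p (\<sigma> n)) 0)) \<longlonglongrightarrow> Re (H 0)" by (intro tendsto_Re lim) auto
      have "(\<lambda>n. C + \<eta> (\<sigma> n)) \<longlonglongrightarrow> C + 0" by (intro tendsto_intros \<rho>\<sigma>)
      then show "(\<lambda>n. C + \<eta> (\<sigma> n)) \<longlonglongrightarrow> C" by simp
    qed (use C0 in auto)
    fix D r :: real
    assume D: "\<And>j. (LINT t|circ. cmod (F (of_real (\<rho> j) * cis t)) powr (2 * q)) \<le> D" and r: "0 \<le> r" "r < 1"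
    \<comment> \<open>On the circle \<open>Re p \<le> v + 1\<close> with \<open>v = |F|^q\<close>,
      and \<open>(v + 1)^2 \<le> 2 v^2 + 2\<close>. Doubling to include the imaginary part and
      integrating over length \<open>2 * pi\<close> produces \<open>4 * D + 8 * pi\<close>.\<close>
    have bound: "(LINT t|circ. (cmod (poly (p j) (of_real r * cis t)))\<^sup>2) \<le> 4 * D + 8 * pi" for j
    proof -
      have "(LINT t|circ. (cmod (poly (p j) (of_real r * cis t)))\<^sup>2) \<le> (LINT t|circ. (cmod (poly (p j) (of_real 1 * cis t)))\<^sup>2)"
        by (rule circ_square_mono[where R = 2]) (use r in \<open>auto intro!: holomorphic_intros\<close>)
      also have "\<dots> \<le> 2 * (LINT t|circ. (Re (poly (p j) (cis t)))\<^sup>2)"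
        using circ_poly_square_le[OF p0] by simp
      also have "\<dots> \<le> 2 * (LINT t|circ. 2 * cmod (F (of_real (\<rho> j) * cis t)) powr (2 * q) + 2)"
      proof (intro mult_left_mono integral_mono)
        show "integrable circ (\<lambda>t. (Re (poly (p j) (cis t)))\<^sup>2)"
          by (intro circ_integrable_continuous continuous_intros)
        show "integrable circ (\<lambda>t. 2 * cmod (F (of_real (\<rho> j) * cis t)) powr (2 * q) + 2)"
          using iF[of "2 * q"] q by (intro Bochner_Integration.integrable_add) auto
        fix t
        let ?v = "cmod (F (of_real (\<rho> j) * cis t)) powr q"
        have "(Re (poly (p j) (cis t)))\<^sup>2 \<le> (?v + 1)\<^sup>2"
          using p3[of "cis t" j] p2[of "cis t" j] \<eta>(2)[of j] by (intro power_mono) auto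
        also have "\<dots> \<le> 2 * ?v\<^sup>2 + 2"
          using zero_le_power2[of "?v - 1"] by (simp add: power2_eq_square algebra_simps)
        also have "?v\<^sup>2 = cmod (F (of_real (\<rho> j) * cis t)) powr (2 * q)"
          by (simp add: power2_eq_square flip: powr_add)
        finally show "(Re (poly (p j) (cis t)))\<^sup>2 \<le> 2 * cmod (F (of_real (\<rho> j) * cis t)) powr (2 * q) + 2" .
      qed simp
      also have "\<dots> = 4 * (LINT t|circ. cmod (F (of_real (\<rho> j) * cis t)) powr (2 * q)) + 8 * pi"
        using iF[of "2 * q" j] q by (subst Bochner_Integration.integral_add) auto
      also have "\<dots> \<le> 4 * D + 8 * pi" using D[of j] by simp
      finally show ?thesis .
    qed
    have "uniform_limit (sphere 0 r) ((\<lambda>n. poly (p n)) \<circ> \<sigma>) H sequentially"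
      by (rule unif) (use r in auto)
    then have "\<forall>\<^sub>F n in sequentially. \<forall>z\<in>sphere 0 r. dist (poly (p (\<sigma> n)) z) (H z) < e" if "e > 0" for e
      using uniform_limitD[OF _ that] by (simp add: o_def)
    note ev = this
    have ul: "uniform_limit {0..2*pi} (\<lambda>n t. poly (p (\<sigma> n)) (of_real r * cis t)) (\<lambda>t. H (of_real r * cis t)) sequentially"
    proof (rule uniform_limitI)
      fix e :: real assume "e > 0"
      from ev[OF this] show "\<forall>\<^sub>F n in sequentially. \<forall>t\<in>{0..2*pi}. dist (poly (p (\<sigma> n)) (of_real r * cis t)) (H (of_real r * cis t)) < e"
        by eventually_elim (use r in \<open>auto simp: norm_mult\<close>)
    qed
    have lim2: "(\<lambda>n. LINT t|circ. (cmod (poly (p (\<sigma> n)) (of_real r * cis t)))\<^sup>2) \<longlonglongrightarrow> (LINT t|circ. (cmod (H (of_real r * cis t)))\<^sup>2)"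
    proof (rule circ_integral_uniform_limit)
      have cH: "continuous_on {0..2*pi} (\<lambda>t. cmod (H (of_real r * cis t)))"
        by (intro continuous_intros circ_continuous_radial[OF H] r)
      have b: "bounded ((\<lambda>t. cmod (H (of_real r * cis t))) ` {0..2*pi})"
        using compact_continuous_image[OF cH] compact_imp_bounded by auto
      have u: "uniform_limit {0..2*pi} (\<lambda>n t. cmod (poly (p (\<sigma> n)) (of_real r * cis t))) (\<lambda>t. cmod (H (of_real r * cis t))) sequentially"
        by (rule uniform_limit_norm[OF ul])
      show "uniform_limit {0..2*pi} (\<lambda>n t. (cmod (poly (p (\<sigma> n)) (of_real r * cis t)))\<^sup>2) (\<lambda>t. (cmod (H (of_real r * cis t)))\<^sup>2) sequentially"
        unfolding power2_eq_square by (rule uniform_lim_mult[OF u u b b])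
    qed (intro continuous_intros)
    show "(LINT t|circ. (cmod (H (of_real r * cis t)))\<^sup>2) \<le> 4 * D + 8 * pi"
      by (rule LIMSEQ_le_const2[OF lim2]) (use bound in auto)
  qed
qed

section \<open>Harmonic functions as real parts of holomorphic functions\<close>

text \<open>The mean value theorem in direction \<open>a\<close> and differentiability of
  \<open>P\<close> at the single point \<open>z0\<close>. The two values of \<open>P\<close> each
  cost \<open>e/4 * (2 * h)\<close>. The second difference is symmetric in \<open>a\<close> and
  \<open>b\<close>, which is the source of equal mixed partials.\<close>

lemma second_difference_approx:
  fixes u P :: "complex \<Rightarrow> real"
  assumes d: "d > 0" and u: "\<And>z. z \<in> ball z0 d \<Longrightarrow> (u has_derivative Du z) (at z)"
    and P: "\<And>z. z \<in> ball z0 d \<Longrightarrow> Du z a = P z" and DP: "(P has_derivative DP) (at z0)"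
    and ab: "cmod a = 1" "cmod b = 1" and e: "e > 0"
  shows "\<exists>\<delta>>0. \<forall>h. 0 < h \<and> h < \<delta> \<longrightarrow>
    \<bar>(u (z0 + h *\<^sub>R a + h *\<^sub>R b) - u (z0 + h *\<^sub>R a) - u (z0 + h *\<^sub>R b) + u z0) - h\<^sup>2 * DP b\<bar> \<le> e * h\<^sup>2"
proof -
  interpret bounded_linear DP using DP by (rule has_derivative_bounded_linear)
  obtain d1 where d1: "d1 > 0" "\<And>w. cmod (w - z0) < d1 \<Longrightarrow> \<bar>P w - P z0 - DP (w - z0)\<bar> \<le> e/4 * cmod (w - z0)"
    using DP e unfolding has_derivative_at_alt by (metis real_norm_def zero_less_divide_iff zero_less_numeral)
  have "\<bar>(u (z0 + h *\<^sub>R a + h *\<^sub>R b) - u (z0 + h *\<^sub>R a) - u (z0 + h *\<^sub>R b) + u z0) - h\<^sup>2 * DP b\<bar> \<le> e * h\<^sup>2"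
    if h: "0 < h" "h < min (d/2) (d1/2)" for h
  proof -
    have n1: "cmod (s *\<^sub>R a + h *\<^sub>R b) \<le> 2 * h" if "0 \<le> s" "s \<le> h" for s
      using norm_triangle_ineq[of "s *\<^sub>R a" "h *\<^sub>R b"] that ab by simp
    have n2: "cmod (s *\<^sub>R a) \<le> 2 * h" if "0 \<le> s" "s \<le> h" for s
      using that ab by simp
    define \<phi> where "\<phi> = (\<lambda>s. u (z0 + s *\<^sub>R a + h *\<^sub>R b) - u (z0 + s *\<^sub>R a))"
    have D: "((\<lambda>s. u (z0 + s *\<^sub>R a + c)) has_real_derivative P (z0 + s *\<^sub>R a + c)) (at s)"
      if "cmod (s *\<^sub>R a + c) \<le> 2 * h" for s c
    proof -
      have "dist z0 (z0 + s *\<^sub>R a + c) = cmod (s *\<^sub>R a + c)"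
        by (metis add.assoc add_diff_cancel_left' dist_commute dist_norm)
      then have mem: "z0 + s *\<^sub>R a + c \<in> ball z0 d" using that h unfolding mem_ball by linarith
      have "((\<lambda>s. z0 + s *\<^sub>R a + c) has_derivative (\<lambda>s. s *\<^sub>R a)) (at s)"
        by (auto intro!: derivative_eq_intros)
      from has_derivative_compose[OF this u[OF mem]]
      have "((\<lambda>s. u (z0 + s *\<^sub>R a + c)) has_derivative (\<lambda>s'. Du (z0 + s *\<^sub>R a + c) (s' *\<^sub>R a))) (at s)" .
      moreover have "Du (z0 + s *\<^sub>R a + c) (s' *\<^sub>R a) = s' * P (z0 + s *\<^sub>R a + c)" for s'
        using linear_scale[OF bounded_linear.linear[OF has_derivative_bounded_linear[OF u[OF mem]]], of s' a] P[OF mem] by simp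
      then have "(\<lambda>s'. Du (z0 + s *\<^sub>R a + c) (s' *\<^sub>R a)) = (*) (P (z0 + s *\<^sub>R a + c))"
        by (intro ext) (simp only: mult.commute)
      ultimately show ?thesis by (simp only: has_field_derivative_def)
    qed
    have "\<exists>s. 0 < s \<and> s < h \<and> \<phi> h - \<phi> 0 = (h - 0) * (P (z0 + s *\<^sub>R a + h *\<^sub>R b) - P (z0 + s *\<^sub>R a))"
    proof (rule MVT2[OF h(1)])
      fix s assume s: "0 \<le> s" "s \<le> h"
      show "(\<phi> has_real_derivative P (z0 + s *\<^sub>R a + h *\<^sub>R b) - P (z0 + s *\<^sub>R a)) (at s)"
        unfolding \<phi>_def using D[of s "h *\<^sub>R b"] D[of s 0] n1[OF s] n2[OF s] by (intro DERIV_diff) auto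
    qed
    then obtain s where s: "0 < s" "s < h" and eq: "\<phi> h - \<phi> 0 = h * (P (z0 + s *\<^sub>R a + h *\<^sub>R b) - P (z0 + s *\<^sub>R a))" by auto
    have m1: "cmod (s *\<^sub>R a + h *\<^sub>R b) \<le> 2 * h" by (rule n1) (use s in auto)
    have m2: "cmod (s *\<^sub>R a) \<le> 2 * h" by (rule n2) (use s in auto)
    have "\<bar>P (z0 + s *\<^sub>R a + h *\<^sub>R b) - P z0 - DP (s *\<^sub>R a + h *\<^sub>R b)\<bar> \<le> e/4 * cmod (s *\<^sub>R a + h *\<^sub>R b)"
      using d1(2)[of "z0 + s *\<^sub>R a + h *\<^sub>R b"] m1 h by (simp add: add.assoc)
    also have "\<dots> \<le> e/4 * (2 * h)" using m1 e by (intro mult_left_mono) auto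
    finally have A: "\<bar>P (z0 + s *\<^sub>R a + h *\<^sub>R b) - P z0 - DP (s *\<^sub>R a + h *\<^sub>R b)\<bar> \<le> e/4 * (2 * h)" .
    have "\<bar>P (z0 + s *\<^sub>R a) - P z0 - DP (s *\<^sub>R a)\<bar> \<le> e/4 * cmod (s *\<^sub>R a)"
      using d1(2)[of "z0 + s *\<^sub>R a"] m2 h by simp
    also have "\<dots> \<le> e/4 * (2 * h)" using m2 e by (intro mult_left_mono) auto
    finally have B: "\<bar>P (z0 + s *\<^sub>R a) - P z0 - DP (s *\<^sub>R a)\<bar> \<le> e/4 * (2 * h)" .
    have "DP (s *\<^sub>R a + h *\<^sub>R b) = DP (s *\<^sub>R a) + h * DP b" by (simp add: add scaleR)
    with A B have "\<bar>(P (z0 + s *\<^sub>R a + h *\<^sub>R b) - P (z0 + s *\<^sub>R a)) - h * DP b\<bar> \<le> e * h" by linarith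
    then have "h * \<bar>(P (z0 + s *\<^sub>R a + h *\<^sub>R b) - P (z0 + s *\<^sub>R a)) - h * DP b\<bar> \<le> h * (e * h)"
      using h by (intro mult_left_mono) auto
    also have "h * \<bar>(P (z0 + s *\<^sub>R a + h *\<^sub>R b) - P (z0 + s *\<^sub>R a)) - h * DP b\<bar> = \<bar>(\<phi> h - \<phi> 0) - h\<^sup>2 * DP b\<bar>"
    proof -
      have "h * (A - h * DP b) = h * A - h\<^sup>2 * DP b" for A by (simp add: right_diff_distrib power2_eq_square)
      moreover have "h * \<bar>x\<bar> = \<bar>h * x\<bar>" for x using h(1) by (simp add: abs_mult)
      ultimately show ?thesis unfolding eq by presburger
    qed
    also have "\<phi> h - \<phi> 0 = u (z0 + h *\<^sub>R a + h *\<^sub>R b) - u (z0 + h *\<^sub>R a) - u (z0 + h *\<^sub>R b) + u z0"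
      by (simp add: \<phi>_def)
    also have "h * (e * h) = e * h\<^sup>2" by (simp add: power2_eq_square)
    finally show ?thesis .
  qed
  then show ?thesis using d d1(1) by (intro exI[of _ "min (d/2) (d1/2)"]) auto
qed

text \<open>\<open>harmonic_on\<close> lists both mixed partials as separate functions; their
  equality is one of the Cauchy-Riemann equations for \<open>ux - \<i> * uy\<close>.\<close>

lemma mixed_partials_eq:
  fixes u ux uy :: "complex \<Rightarrow> real"
  assumes S: "open S" "z0 \<in> S"
    and u: "\<And>z. z \<in> S \<Longrightarrow> (u has_derivative (\<lambda>h. Re h * ux z + Im h * uy z)) (at z)"
    and ux: "(ux has_derivative (\<lambda>h. Re h * uxx + Im h * uxy)) (at z0)"
    and uy: "(uy has_derivative (\<lambda>h. Re h * uyx + Im h * uyy)) (at z0)"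
  shows "uxy = uyx"
proof (rule ccontr)
  assume ne: "uxy \<noteq> uyx"
  \<comment> \<open>Two errors of size \<open>e\<close> cannot bridge a gap of
    \<open>3 * e\<close>.\<close>
  define e where "e = \<bar>uxy - uyx\<bar> / 3"
  have e: "e > 0" using ne by (simp add: e_def)
  obtain d where d: "d > 0" "ball z0 d \<subseteq> S" using S open_contains_ball by blast
  let ?D = "\<lambda>a b h::real. u (z0 + h *\<^sub>R a + h *\<^sub>R b) - u (z0 + h *\<^sub>R a) - u (z0 + h *\<^sub>R b) + u z0"
  have "\<exists>\<delta>>0. \<forall>h. 0 < h \<and> h < \<delta> \<longrightarrow> \<bar>?D 1 \<i> h - h\<^sup>2 * (Re \<i> * uxx + Im \<i> * uxy)\<bar> \<le> e * h\<^sup>2"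
    by (rule second_difference_approx[where P = ux and Du = "\<lambda>z h. Re h * ux z + Im h * uy z", OF d(1) _ _ ux _ _ e])
      (use u d(2) in auto)
  then obtain d1 where d1: "d1 > 0" "\<And>h. 0 < h \<Longrightarrow> h < d1 \<Longrightarrow> \<bar>?D 1 \<i> h - h\<^sup>2 * uxy\<bar> \<le> e * h\<^sup>2"
    by auto
  have "\<exists>\<delta>>0. \<forall>h. 0 < h \<and> h < \<delta> \<longrightarrow> \<bar>?D \<i> 1 h - h\<^sup>2 * (Re 1 * uyx + Im 1 * uyy)\<bar> \<le> e * h\<^sup>2"
    by (rule second_difference_approx[where P = uy and Du = "\<lambda>z h. Re h * ux z + Im h * uy z", OF d(1) _ _ uy _ _ e])
      (use u d(2) in auto)
  then obtain d2 where d2: "d2 > 0" "\<And>h. 0 < h \<Longrightarrow> h < d2 \<Longrightarrow> \<bar>?D \<i> 1 h - h\<^sup>2 * uyx\<bar> \<le> e * h\<^sup>2"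
    by auto
  define h where "h = min d1 d2 / 2"
  have h: "h > 0" "h < d1" "h < d2" using d1(1) d2(1) by (auto simp: h_def)
  have "?D 1 \<i> h = ?D \<i> 1 h" by (simp add: add_ac)
  then have "\<bar>h\<^sup>2 * uxy - h\<^sup>2 * uyx\<bar> \<le> 2 * (e * h\<^sup>2)"
    using d1(2)[OF h(1,2)] d2(2)[OF h(1,3)] by linarith
  also have "\<bar>h\<^sup>2 * uxy - h\<^sup>2 * uyx\<bar> = h\<^sup>2 * \<bar>uxy - uyx\<bar>"
    by (simp add: abs_mult flip: right_diff_distrib)
  also have "\<dots> = 3 * (e * h\<^sup>2)" by (simp add: e_def)
  finally show False using e h(1) by simp
qed

text \<open>The function \<open>ux - \<i> * uy\<close> is holomorphic, and on a convex set it has a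
  primitive; the real part of that primitive has the same gradient as \<open>u\<close>.\<close>

lemma harmonic_on_imp_Re_holomorphic:
  assumes u: "harmonic_on S u" and S: "convex S"
  obtains K where "K holomorphic_on S" "\<And>z. z \<in> S \<Longrightarrow> u z = Re (K z)"
proof (cases "S = {}")
  case True then show ?thesis using that[of "\<lambda>_. 0"] by auto
next
  case False
  then obtain a where a: "a \<in> S" by blast
  have o: "open S" using u by (simp add: harmonic_on_def)
  obtain ux uy uxx uxy uyx uyy where
    D: "\<And>z. z \<in> S \<Longrightarrow> (u has_derivative (\<lambda>h. Re h * ux z + Im h * uy z)) (at z)"
       "\<And>z. z \<in> S \<Longrightarrow> (ux has_derivative (\<lambda>h. Re h * uxx z + Im h * uxy z)) (at z)"
       "\<And>z. z \<in> S \<Longrightarrow> (uy has_derivative (\<lambda>h. Re h * uyx z + Im h * uyy z)) (at z)"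
       "\<And>z. z \<in> S \<Longrightarrow> uxx z + uyy z = 0"
    using u unfolding harmonic_on_def by blast
  define F where "F = (\<lambda>z. of_real (ux z) - \<i> * of_real (uy z))"
  have F: "(F has_field_derivative (of_real (uxx z) - \<i> * of_real (uyx z))) (at z)" if z: "z \<in> S" for z
  proof -
    have mp: "uxy z = uyx z" by (rule mixed_partials_eq[OF o z D(1) D(2)[OF z] D(3)[OF z]])
    have "(F has_derivative (\<lambda>h. of_real (Re h * uxx z + Im h * uxy z) - \<i> * of_real (Re h * uyx z + Im h * uyy z))) (at z)"
      unfolding F_def
      by (intro has_derivative_diff has_derivative_mult_right has_derivative_of_real D z)
    moreover have "of_real (Re h * uxx z + Im h * uxy z) - \<i> * of_real (Re h * uyx z + Im h * uyy z)
        = (of_real (uxx z) - \<i> * of_real (uyx z)) * h" for h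
    proof -
      have "uyy z = - uxx z" using D(4)[OF z] by linarith
      then show ?thesis using mp by (simp add: complex_eq_iff algebra_simps)
    qed
    then have "(\<lambda>h. of_real (Re h * uxx z + Im h * uxy z) - \<i> * of_real (Re h * uyx z + Im h * uyy z))
        = (*) (of_real (uxx z) - \<i> * of_real (uyx z))"
      by (rule ext)
    ultimately show ?thesis by (simp only: has_field_derivative_def)
  qed
  have "F holomorphic_on S" unfolding holomorphic_on_open[OF o] by (intro ballI exI) (rule F)
  then obtain G where G: "\<And>z. z \<in> S \<Longrightarrow> (G has_field_derivative F z) (at z within S)"
    using holomorphic_convex_primitive'[OF S o] by blast
  have "\<exists>c. \<forall>z\<in>S. Re (G z) - u z = c"
  proof (rule has_derivative_zero_constant[OF S])
    fix z assume z: "z \<in> S"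
    have "(G has_derivative (*) (F z)) (at z)"
      using G[OF z] unfolding has_field_derivative_def at_within_open[OF z o] .
    then have "((\<lambda>z. Re (G z) - u z) has_derivative (\<lambda>h. Re (F z * h) - (Re h * ux z + Im h * uy z))) (at z)"
      by (intro has_derivative_diff has_derivative_Re D z)
    moreover have "(\<lambda>h. Re (F z * h) - (Re h * ux z + Im h * uy z)) = (\<lambda>h. 0)" by (auto simp: F_def)
    ultimately have "((\<lambda>z. Re (G z) - u z) has_derivative (\<lambda>h. 0)) (at z)" by (simp only:)
    then show "((\<lambda>z. Re (G z) - u z) has_derivative (\<lambda>h. 0)) (at z within S)"
      by (rule has_derivative_at_withinI)
  qed
  then obtain c where c: "\<And>z. z \<in> S \<Longrightarrow> Re (G z) - u z = c" by blast
  show ?thesis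
  proof (rule that[of "\<lambda>z. G z - of_real c"])
    have "G holomorphic_on S"
      unfolding holomorphic_on_def field_differentiable_def by (intro ballI exI) (rule G)
    then show "(\<lambda>z. G z - of_real c) holomorphic_on S" by (intro holomorphic_intros)
    show "u z = Re (G z - of_real c)" if "z \<in> S" for z using c[OF that] by simp
  qed
qed

lemma Re_holomorphic_harmonic_on:
  assumes K: "K holomorphic_on S" and S: "open S"
  shows "harmonic_on S (\<lambda>z. Re (K z))"
proof -
  have h: "deriv K holomorphic_on S" "deriv (deriv K) holomorphic_on S"
    using K S by (auto intro: holomorphic_deriv)
  have c: "continuous_on S (deriv (deriv K))" using h by (auto intro: holomorphic_on_imp_continuous_on)
  have D: "(K has_derivative (*) (deriv K z)) (at z)" "(deriv K has_derivative (*) (deriv (deriv K) z)) (at z)" if "z \<in> S" for z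
    using holomorphic_derivI[OF K S that] holomorphic_derivI[OF h(1) S that] by (auto simp: has_field_derivative_def)
  have "((\<lambda>z. Re (K z)) has_derivative (\<lambda>h. Re h * Re (deriv K z) + Im h * (- Im (deriv K z)))) (at z)"
    "((\<lambda>z. Re (deriv K z)) has_derivative (\<lambda>h. Re h * Re (deriv (deriv K) z) + Im h * (- Im (deriv (deriv K) z)))) (at z)"
    "((\<lambda>z. - Im (deriv K z)) has_derivative (\<lambda>h. Re h * (- Im (deriv (deriv K) z)) + Im h * (- Re (deriv (deriv K) z)))) (at z)"
    if z: "z \<in> S" for z
    using has_derivative_Re[OF D(1)[OF z]] has_derivative_Re[OF D(2)[OF z]]
      has_derivative_minus[OF has_derivative_Im[OF D(2)[OF z]]]
    by (simp_all add: algebra_simps)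
  then show ?thesis
    unfolding harmonic_on_def
    apply (intro conjI S)
    apply (rule exI[of _ "\<lambda>z. Re (deriv K z)"], rule exI[of _ "\<lambda>z. - Im (deriv K z)"],
        rule exI[of _ "\<lambda>z. Re (deriv (deriv K) z)"], rule exI[of _ "\<lambda>z. - Im (deriv (deriv K) z)"],
        rule exI[of _ "\<lambda>z. - Im (deriv (deriv K) z)"], rule exI[of _ "\<lambda>z. - Re (deriv (deriv K) z)"])
    apply (intro conjI ballI continuous_intros c)
    apply auto
    done
qed

section \<open>Uniformly small tails of square means\<close>

text \<open>Bounded square means give square summable Taylor coefficients, and \<open>Q\<close> is a
  partial sum: by Parseval the remainder has square means below the coefficient tail at every radius
  at once.\<close>

lemma square_mean_tail:
  assumes H: "H holomorphic_on ball 0 1"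
    and D: "\<And>r. 0 \<le> r \<Longrightarrow> r < 1 \<Longrightarrow> (LINT t|circ. (cmod (H (of_real r * cis t)))\<^sup>2) \<le> D" and e: "e > 0"
  obtains Q K where "Q holomorphic_on ball 0 1" "\<And>w. cmod w < 1 \<Longrightarrow> cmod (Q w) \<le> K"
    "\<And>r. 0 \<le> r \<Longrightarrow> r < 1 \<Longrightarrow> (LINT t|circ. (cmod (H (of_real r * cis t) - Q (of_real r * cis t)))\<^sup>2) \<le> e"
proof -
  define b where "b = (\<lambda>n. (deriv ^^ n) H 0 / fact n)"
  have pw: "(\<lambda>n. b n * w ^ n) sums H w" if "cmod w < 1" for w
    using holomorphic_power_series[OF H, of w] that by (simp add: b_def)
  have part: "(\<Sum>n<N. (cmod (b n))\<^sup>2) \<le> D / (2*pi)" for N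
  proof (rule tendsto_upperbound)
    show "((\<lambda>r. \<Sum>n<N. (cmod (b n))\<^sup>2 * r^(2*n)) \<longlongrightarrow> (\<Sum>n<N. (cmod (b n))\<^sup>2)) (at_left (1::real))"
    proof -
      have "((\<lambda>r. \<Sum>n<N. (cmod (b n))\<^sup>2 * r^(2*n)) \<longlongrightarrow> (\<Sum>n<N. (cmod (b n))\<^sup>2 * 1^(2*n))) (at_left (1::real))"
        by (intro tendsto_intros)
      then show ?thesis by simp
    qed
    have "(\<Sum>n<N. (cmod (b n))\<^sup>2 * r^(2*n)) \<le> D / (2*pi)" if r: "r \<in> {0<..<1}" for r
    proof -
      have s: "(\<lambda>n. (cmod (b n))\<^sup>2 * r^(2*n)) sums ((LINT t|circ. (cmod (H (of_real r * cis t)))\<^sup>2) / (2*pi))"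
        unfolding b_def by (rule circ_parseval_holomorphic[OF H]) (use r in auto)
      have "(\<Sum>n<N. (cmod (b n))\<^sup>2 * r^(2*n)) \<le> (LINT t|circ. (cmod (H (of_real r * cis t)))\<^sup>2) / (2*pi)"
        unfolding sums_unique[OF s] by (rule sum_le_suminf) (use s in \<open>auto simp: sums_iff\<close>)
      also have "\<dots> \<le> D / (2*pi)" by (intro divide_right_mono D) (use r in auto)
      finally show ?thesis .
    qed
    then show "\<forall>\<^sub>F r in at_left 1. (\<Sum>n<N. (cmod (b n))\<^sup>2 * r^(2*n)) \<le> D / (2*pi)"
      using eventually_at_left_real[of "0::real" 1] by (auto elim!: eventually_mono)
  qed simp
  have sm: "summable (\<lambda>n. (cmod (b n))\<^sup>2)"
    by (rule summableI_nonneg_bounded[OF _ part]) auto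
  have "\<exists>N. norm (\<Sum>n. (cmod (b (n + N)))\<^sup>2) < e / (2*pi)"
    using suminf_exist_split[OF _ sm, of "e / (2*pi)"] e by (auto simp: add.commute)
  then obtain N where N: "(\<Sum>n. (cmod (b (n + N)))\<^sup>2) < e / (2*pi)"
    unfolding real_norm_def abs_less_iff by blast
  define Q where "Q = (\<lambda>w. \<Sum>n<N. b n * w ^ n)"
  show ?thesis
  proof (rule that[of Q "\<Sum>n<N. cmod (b n)"])
    show "Q holomorphic_on ball 0 1" unfolding Q_def by (intro holomorphic_intros)
    show "cmod (Q w) \<le> (\<Sum>n<N. cmod (b n))" if "cmod w < 1" for w
      unfolding Q_def by (rule sum_norm_le) (use that in \<open>auto simp: norm_mult norm_power mult_left_le power_le_one\<close>)
    fix r :: real assume r: "0 \<le> r" "r < 1"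
    define c where "c = (\<lambda>n. if n < N then 0 else b n)"
    have s: "(\<lambda>n. (cmod (c n))\<^sup>2 * r^(2*n)) sums ((LINT t|circ. (cmod ((\<lambda>w. H w - Q w) (of_real r * cis t)))\<^sup>2) / (2*pi))"
    proof (rule circ_parseval[OF _ r])
      fix w :: complex assume w: "cmod w < 1"
      have "(\<lambda>n. if n \<in> {..<N} then b n * w ^ n else 0) sums Q w"
        unfolding Q_def by (rule sums_If_finite_set) auto
      from sums_diff[OF pw[OF w] this] show "(\<lambda>n. c n * w ^ n) sums (H w - Q w)"
        by (rule sums_cong[THEN iffD1, rotated]) (auto simp: c_def)
    qed
    have cs: "summable (\<lambda>n. (cmod (c n))\<^sup>2)"
      by (rule summable_comparison_test'[OF sm, of 0]) (auto simp: c_def)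
    have "(\<Sum>n. (cmod (c n))\<^sup>2) = (\<Sum>n. (cmod (b (n + N)))\<^sup>2)"
      using suminf_split_initial_segment[OF cs, of N] by (simp add: c_def)
    moreover have "(LINT t|circ. (cmod ((\<lambda>w. H w - Q w) (of_real r * cis t)))\<^sup>2) / (2*pi) \<le> (\<Sum>n. (cmod (c n))\<^sup>2)"
      by (rule sums_le[OF _ s summable_sums[OF cs]]) (use r in \<open>auto intro!: mult_left_le power_le_one\<close>)
    ultimately have "(LINT t|circ. (cmod (H (of_real r * cis t) - Q (of_real r * cis t)))\<^sup>2) / (2*pi) < e / (2*pi)"
      using N by simp
    then show "(LINT t|circ. (cmod (H (of_real r * cis t) - Q (of_real r * cis t)))\<^sup>2) \<le> e"
      by (simp add: divide_less_cancel)
  qed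
qed

section \<open>Density in Hardy spaces\<close>

lemma rad_Suc_pos: "0 < rad (Suc n)"
  by (simp add: rad_def field_simps)

lemma circ_mean_Re:
  assumes K: "K holomorphic_on ball 0 1" and r: "0 < r" "r < 1"
  shows "(LINT t|circ. Re (K (of_real r * cis t))) = 2 * pi * Re (K 0)"
proof -
  have i: "integrable circ (\<lambda>t. K (of_real r * cis t))"
    by (rule circ_integrable_continuous, rule circ_continuous_radial[OF K]) (use r in auto)
  have "(LINT t|circ. K (of_real r * cis t)) = 2 * pi * K 0"
  proof (rule circ_mean_value)
    show "continuous_on (cball 0 r) K"
      by (rule continuous_on_subset[OF holomorphic_on_imp_continuous_on[OF K]]) (use r in auto)
    show "K holomorphic_on ball 0 r" by (rule holomorphic_on_subset[OF K]) (use r in auto)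
  qed (use r in auto)
  then have "Re (LINT t|circ. K (of_real r * cis t)) = 2 * pi * Re (K 0)" by simp
  then show ?thesis by (simp only: integral_Re[OF i])
qed

lemma damping_bounds:
  fixes y :: complex
  assumes n: "n > 0" and y: "Re y \<ge> 1"
  shows "cmod y \<le> cmod (of_real n + y)" "n \<le> cmod (of_real n + y)" "of_real n + y \<noteq> 0"
proof -
  have "(cmod y)\<^sup>2 \<le> (cmod (of_real n + y))\<^sup>2"
    unfolding cmod_power2 using n y by (simp add: power2_eq_square algebra_simps)
  then show "cmod y \<le> cmod (of_real n + y)" by (rule power2_le_imp_le) simp
  show 1: "n \<le> cmod (of_real n + y)"
    using complex_Re_le_cmod[of "of_real n + y"] y by simp
  show "of_real n + y \<noteq> 0" using 1 n by auto
qed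

text \<open>This allows the same squared damping factor for every \<open>p \<ge> 1\<close>.\<close>

lemma norm_powr_le_square:
  assumes p: "1 \<le> p" and le: "cmod x powr p \<le> Y\<^sup>2" and Y: "1 \<le> Y"
  shows "cmod x \<le> Y\<^sup>2"
proof (cases "cmod x \<le> 1")
  case True
  moreover have "1 \<le> Y\<^sup>2" using Y by simp
  ultimately show ?thesis by linarith
next
  case False
  then have "cmod x powr 1 \<le> cmod x powr p" using p by (intro powr_mono) auto
  then show ?thesis using le by simp
qed

text \<open>With \<open>\<theta> = |y| / |n + y|\<close> the damping error is at most
  \<open>2 powr p * |y|^2 * \<theta>\<close>, because \<open>\<theta> \<le> 1\<close> and
  \<open>p \<ge> 1\<close> give \<open>\<theta> powr p \<le> \<theta>\<close>. Split
  \<open>y\<close> into \<open>y - q\<close> and the bounded \<open>q\<close>: use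
  \<open>\<theta> \<le> 1\<close> on the first part and \<open>\<theta> \<le> |y| / n\<close> on the
  second.\<close>

lemma damping_error:
  fixes x y q :: complex
  assumes p: "1 \<le> p" and xy: "cmod x powr p \<le> (cmod y)\<^sup>2" and y: "Re y \<ge> 1" and n: "n > 0" and q: "cmod q \<le> K"
  shows "cmod (x - x * (of_real n / (of_real n + y))\<^sup>2) powr p
    \<le> 2 powr p * (2 * (cmod (y - q))\<^sup>2 + 2 * K\<^sup>2 * (1 + (cmod y)\<^sup>2) / n)"
proof -
  note d = damping_bounds[OF n y]
  define \<theta> where "\<theta> = cmod y / cmod (of_real n + y)"
  have pos: "cmod (of_real n + y) > 0" using d(3) by simp
  have \<theta>: "0 \<le> \<theta>" "\<theta> \<le> 1" unfolding \<theta>_def using d(1) pos by (auto simp: divide_le_eq_1)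
  have \<theta>n: "\<theta> \<le> cmod y / n" unfolding \<theta>_def using d(2) n pos by (intro divide_left_mono mult_pos_pos) auto
  have "1 - (of_real n / (of_real n + y))\<^sup>2 = (1 - of_real n / (of_real n + y)) * (1 + of_real n / (of_real n + y))"
    by (simp add: power2_eq_square algebra_simps)
  also have "1 - of_real n / (of_real n + y) = y / (of_real n + y)" using d(3) by (simp add: diff_divide_eq_iff)
  finally have "cmod (1 - (of_real n / (of_real n + y))\<^sup>2) = \<theta> * cmod (1 + of_real n / (of_real n + y))"
    by (simp add: norm_mult norm_divide \<theta>_def)
  also have "\<dots> \<le> \<theta> * 2"
  proof (rule mult_left_mono[OF _ \<theta>(1)])
    have "cmod (of_real n / (of_real n + y)) \<le> 1" unfolding norm_divide using d(2) pos n by (simp add: divide_le_eq_1)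
    then show "cmod (1 + of_real n / (of_real n + y)) \<le> 2"
      using norm_triangle_ineq[of 1 "of_real n / (of_real n + y)"] by simp
  qed
  finally have f: "cmod (1 - (of_real n / (of_real n + y))\<^sup>2) \<le> 2 * \<theta>" by simp
  have "x - x * (of_real n / (of_real n + y))\<^sup>2 = x * (1 - (of_real n / (of_real n + y))\<^sup>2)" by (simp add: algebra_simps)
  then have "cmod (x - x * (of_real n / (of_real n + y))\<^sup>2) powr p
     = cmod x powr p * cmod (1 - (of_real n / (of_real n + y))\<^sup>2) powr p"
    by (simp only: norm_mult) (simp add: powr_mult)
  also have "\<dots> \<le> (cmod y)\<^sup>2 * (2 * \<theta>) powr p"
    using xy f p \<theta> by (intro mult_mono powr_mono2) auto
  finally have 1: "cmod (x - x * (of_real n / (of_real n + y))\<^sup>2) powr p \<le> (cmod y)\<^sup>2 * (2 * \<theta>) powr p" .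
  have "\<theta> powr p \<le> \<theta>" using powr_mono'[of 1 p \<theta>] p \<theta> by simp
  then have "(2 * \<theta>) powr p \<le> 2 powr p * \<theta>" using \<theta> by (simp add: powr_mult)
  then have "(cmod y)\<^sup>2 * (2 * \<theta>) powr p \<le> (cmod y)\<^sup>2 * (2 powr p * \<theta>)" by (rule mult_left_mono) simp
  also have "\<dots> = 2 powr p * ((cmod y)\<^sup>2 * \<theta>)" by simp
  finally have 2: "(cmod y)\<^sup>2 * (2 * \<theta>) powr p \<le> 2 powr p * ((cmod y)\<^sup>2 * \<theta>)" .
  have "(cmod y)\<^sup>2 * \<theta> \<le> 2 * (cmod (y - q))\<^sup>2 + 2 * K\<^sup>2 * (1 + (cmod y)\<^sup>2) / n"
  proof -
    have "cmod y \<le> cmod (y - q) + cmod q" using norm_triangle_ineq[of "y - q" q] by simp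
    also have "\<dots> \<le> cmod (y - q) + K" using q by simp
    finally have "(cmod y)\<^sup>2 \<le> (cmod (y - q) + K)\<^sup>2" by (intro power_mono) auto
    also have "\<dots> \<le> 2 * (cmod (y - q))\<^sup>2 + 2 * K\<^sup>2"
      using zero_le_power2[of "cmod (y - q) - K"] by (simp add: power2_eq_square algebra_simps)
    finally have "(cmod y)\<^sup>2 * \<theta> \<le> (2 * (cmod (y - q))\<^sup>2 + 2 * K\<^sup>2) * \<theta>" using \<theta> by (intro mult_right_mono)
    also have "\<dots> = 2 * (cmod (y - q))\<^sup>2 * \<theta> + 2 * K\<^sup>2 * \<theta>" by (simp add: distrib_right)
    also have "\<dots> \<le> 2 * (cmod (y - q))\<^sup>2 * 1 + 2 * K\<^sup>2 * ((1 + (cmod y)\<^sup>2) / n)"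
    proof (intro add_mono mult_left_mono)
      have "cmod y \<le> 1 + (cmod y)\<^sup>2" using zero_le_power2[of "cmod y - 1/2"] by (simp add: power2_eq_square algebra_simps)
      then have "cmod y / n \<le> (1 + (cmod y)\<^sup>2) / n" using n by (intro divide_right_mono) auto
      with \<theta>n show "\<theta> \<le> (1 + (cmod y)\<^sup>2) / n" by simp
    qed (use \<theta> in auto)
    finally show ?thesis by simp
  qed
  then show ?thesis by (intro order_trans[OF 1 order_trans[OF 2 mult_left_mono]]) auto
qed

text \<open>Truncation by the factor \<open>(n / (n + H))\<^sup>2\<close>: since \<open>|F|\<^sup>p \<le> |H|\<^sup>2\<close> the result is bounded by \<open>n\<^sup>2\<close>, and the
  error is small because \<open>|H|\<^sup>2\<close>, unlike a general harmonic majorant of \<open>|F|\<^sup>p\<close>, has uniformly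
  integrable circular means.\<close>

lemma bounded_holomorphic_approx:
  assumes p: "1 \<le> p" and F: "F holomorphic_on ball 0 1" and H: "H holomorphic_on ball 0 1"
    and FH: "\<And>w. cmod w < 1 \<Longrightarrow> cmod (F w) powr p \<le> (cmod (H w))\<^sup>2"
    and H1: "\<And>w. cmod w < 1 \<Longrightarrow> Re (H w) \<ge> 1"
    and D: "\<And>r. 0 \<le> r \<Longrightarrow> r < 1 \<Longrightarrow> (LINT t|circ. (cmod (H (of_real r * cis t)))\<^sup>2) \<le> D" and e: "e > 0"
  obtains g M where "g holomorphic_on ball 0 1" "\<forall>w\<in>ball 0 1. cmod (g w) \<le> M"
    "\<And>r. 0 \<le> r \<Longrightarrow> r < 1 \<Longrightarrow> (LINT t|circ. cmod (F (of_real r * cis t) - g (of_real r * cis t)) powr p) \<le> e"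
proof -
  define P where "P = (2::real) powr p"
  have P: "P > 0" by (simp add: P_def)
  obtain Q K where Q: "Q holomorphic_on ball 0 1" and QK: "\<And>w. cmod w < 1 \<Longrightarrow> cmod (Q w) \<le> K"
    and R: "\<And>r. 0 \<le> r \<Longrightarrow> r < 1 \<Longrightarrow> (LINT t|circ. (cmod (H (of_real r * cis t) - Q (of_real r * cis t)))\<^sup>2) \<le> e / (4 * P)"
    using square_mean_tail[OF H D, of "e / (4 * P)"] e P by auto
  have D0: "0 \<le> D" using D[of 0] by (rule order_trans[rotated]) auto
  \<comment> \<open>Chosen so that the error from the bounded part of \<open>H\<close> is at most
    \<open>e/2\<close>; the tail, multiplied by \<open>2 * P\<close>, takes the other half.\<close>
  define n where "n = 1 + 4 * P * K\<^sup>2 * (2 * pi + D) / e"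
  have n: "n > 0" unfolding n_def using e P D0 by (intro add_pos_nonneg divide_nonneg_pos mult_nonneg_nonneg) auto
  define g where "g = (\<lambda>w. F w * (of_real n / (of_real n + H w))\<^sup>2)"
  show ?thesis
  proof (rule that)
    show "g holomorphic_on ball 0 1"
      unfolding g_def using damping_bounds(3)[OF n H1] by (auto intro!: holomorphic_intros F H)
    show "\<forall>w\<in>ball 0 1. cmod (g w) \<le> n\<^sup>2"
    proof
      fix w :: complex assume "w \<in> ball 0 1"
      then have w: "cmod w < 1" by simp
      note d = damping_bounds[OF n H1[OF w]]
      have pos: "cmod (of_real n + H w) > 0" using d(3) by simp
      have H1': "1 \<le> cmod (H w)" using H1[OF w] complex_Re_le_cmod[of "H w"] by linarith
      have "cmod (g w) = cmod (F w) * n\<^sup>2 / (cmod (of_real n + H w))\<^sup>2"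
        unfolding g_def using n by (simp add: norm_mult norm_divide norm_power power_divide)
      also have "\<dots> \<le> (cmod (of_real n + H w))\<^sup>2 * n\<^sup>2 / (cmod (of_real n + H w))\<^sup>2"
      proof (intro divide_right_mono mult_right_mono)
        have "(cmod (H w))\<^sup>2 \<le> (cmod (of_real n + H w))\<^sup>2" using d(1) by (intro power_mono) auto
        then show "cmod (F w) \<le> (cmod (of_real n + H w))\<^sup>2"
          using norm_powr_le_square[OF p FH[OF w] H1'] by linarith
      qed auto
      also have "\<dots> = n\<^sup>2" using pos by simp
      finally show "cmod (g w) \<le> n\<^sup>2" .
    qed
    fix r :: real assume r: "0 \<le> r" "r < 1"
    have w: "cmod (of_real r * cis t) < 1" for t using r by (simp add: norm_mult)
    have cH: "continuous_on {0..2*pi} (\<lambda>t. H (of_real r * cis t))" and cQ: "continuous_on {0..2*pi} (\<lambda>t. Q (of_real r * cis t))"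
      using circ_continuous_radial[OF H r] circ_continuous_radial[OF Q r] by auto
    have i1: "integrable circ (\<lambda>t. (cmod (H (of_real r * cis t) - Q (of_real r * cis t)))\<^sup>2)"
      by (rule circ_integrable_continuous) (intro continuous_intros cH cQ)
    have i2: "integrable circ (\<lambda>t. (cmod (H (of_real r * cis t)))\<^sup>2)"
      by (rule circ_integrable_continuous) (intro continuous_intros cH)
    have "(LINT t|circ. cmod (F (of_real r * cis t) - g (of_real r * cis t)) powr p) \<le>
      (LINT t|circ. (2 * P) * (cmod (H (of_real r * cis t) - Q (of_real r * cis t)))\<^sup>2 + (2 * P * K\<^sup>2 / n) * (1 + (cmod (H (of_real r * cis t)))\<^sup>2))"
    proof (rule integral_mono')
      show "integrable circ (\<lambda>t. (2 * P) * (cmod (H (of_real r * cis t) - Q (of_real r * cis t)))\<^sup>2 + (2 * P * K\<^sup>2 / n) * (1 + (cmod (H (of_real r * cis t)))\<^sup>2))"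
        using i1 i2 by (intro Bochner_Integration.integrable_add Bochner_Integration.integrable_mult_right) auto
      fix t
      have "cmod (F (of_real r * cis t) - g (of_real r * cis t)) powr p \<le>
          P * (2 * (cmod (H (of_real r * cis t) - Q (of_real r * cis t)))\<^sup>2 + 2 * K\<^sup>2 * (1 + (cmod (H (of_real r * cis t)))\<^sup>2) / n)"
        unfolding g_def P_def by (rule damping_error[OF p FH[OF w] H1[OF w] n QK[OF w]])
      also have "\<dots> = (2 * P) * (cmod (H (of_real r * cis t) - Q (of_real r * cis t)))\<^sup>2 + (2 * P * K\<^sup>2 / n) * (1 + (cmod (H (of_real r * cis t)))\<^sup>2)"
        by (simp add: distrib_left add_divide_distrib mult_ac)
      finally show "cmod (F (of_real r * cis t) - g (of_real r * cis t)) powr p \<le> (2 * P) * (cmod (H (of_real r * cis t) - Q (of_real r * cis t)))\<^sup>2 + (2 * P * K\<^sup>2 / n) * (1 + (cmod (H (of_real r * cis t)))\<^sup>2)" .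
      show "0 \<le> (2 * P) * (cmod (H (of_real r * cis t) - Q (of_real r * cis t)))\<^sup>2 + (2 * P * K\<^sup>2 / n) * (1 + (cmod (H (of_real r * cis t)))\<^sup>2)"
        using P n by (intro add_nonneg_nonneg mult_nonneg_nonneg) auto
    qed
    also have "\<dots> = (2 * P) * (LINT t|circ. (cmod (H (of_real r * cis t) - Q (of_real r * cis t)))\<^sup>2) + (2 * P * K\<^sup>2 / n) * (2 * pi + (LINT t|circ. (cmod (H (of_real r * cis t)))\<^sup>2))"
    proof -
      have "(LINT t|circ. 1 + (cmod (H (of_real r * cis t)))\<^sup>2) = 2 * pi + (LINT t|circ. (cmod (H (of_real r * cis t)))\<^sup>2)"
        using i2 by (subst Bochner_Integration.integral_add) auto
      moreover have "(LINT t|circ. (2 * P) * (cmod (H (of_real r * cis t) - Q (of_real r * cis t)))\<^sup>2 + (2 * P * K\<^sup>2 / n) * (1 + (cmod (H (of_real r * cis t)))\<^sup>2))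
         = (LINT t|circ. (2 * P) * (cmod (H (of_real r * cis t) - Q (of_real r * cis t)))\<^sup>2) + (LINT t|circ. (2 * P * K\<^sup>2 / n) * (1 + (cmod (H (of_real r * cis t)))\<^sup>2))"
        using i1 i2 by (intro Bochner_Integration.integral_add Bochner_Integration.integrable_mult_right) auto
      ultimately show ?thesis by (simp only: integral_mult_right_zero)
    qed
    also have "\<dots> \<le> (2 * P) * (e / (4 * P)) + (2 * P * K\<^sup>2 / n) * (2 * pi + D)"
      using P n by (intro add_mono mult_left_mono R D r order_refl) auto
    also have "(2 * P) * (e / (4 * P)) = e / 2" using P by simp
    also have "(2 * P * K\<^sup>2 / n) * (2 * pi + D) \<le> e / 2"
    proof -
      have "4 * P * K\<^sup>2 * (2 * pi + D) / e \<le> n" by (simp add: n_def)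
      then have "4 * P * K\<^sup>2 * (2 * pi + D) \<le> n * e" using e by (simp add: pos_divide_le_eq)
      then show ?thesis using n by (simp add: pos_divide_le_eq field_simps)
    qed
    finally show "(LINT t|circ. cmod (F (of_real r * cis t) - g (of_real r * cis t)) powr p) \<le> e" by simp
  qed
qed

lemma norm_add_powr_le:
  fixes x y :: complex
  assumes "0 \<le> p"
  shows "cmod (x + y) powr p \<le> 2 powr p * (cmod x powr p + cmod y powr p)"
proof -
  have "cmod (x + y) powr p \<le> (2 * max (cmod x) (cmod y)) powr p"
    using norm_triangle_ineq[of x y] assms by (intro powr_mono2) auto
  also have "\<dots> = 2 powr p * max (cmod x) (cmod y) powr p" by (simp add: powr_mult)
  also have "max (cmod x) (cmod y) powr p \<le> cmod x powr p + cmod y powr p" by (simp add: max_def)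
  finally show ?thesis by simp
qed

lemma exp_span_hardy_means:
  assumes p: "1 \<le> p" and a: "Re a > 0" and F: "F holomorphic_on ball 0 1"
    and mean: "\<And>r. 0 < r \<Longrightarrow> r < 1 \<Longrightarrow> (LINT t|circ. cmod (F (of_real r * cis t)) powr p) \<le> 2 * pi * C"
    and e: "e > 0"
  obtains s N where "s \<in> exp_span"
    "\<And>j. (LINT t|circ. cmod (F (of_real (rad (N + j)) * cis t) - s (mob a 1 (of_real (rad (N + j)) * cis t))) powr p) \<le> e"
proof -
  define \<rho> where "\<rho> = (\<lambda>j. rad (Suc j))"
  have \<rho>: "0 < \<rho> j" "\<rho> j < 1" for j using rad(2)[of "Suc j"] by (auto simp: \<rho>_def rad_Suc_pos)
  have \<rho>1: "\<rho> \<longlonglongrightarrow> 1" unfolding \<rho>_def by (rule LIMSEQ_Suc[OF rad(3)])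
  have cF: "continuous_on {0..2*pi} (\<lambda>t. F (of_real r * cis t))" if "0 \<le> r" "r < 1" for r
    by (rule circ_continuous_radial[OF F that])
  have iF: "integrable circ (\<lambda>t. cmod (F (of_real r * cis t)) powr q)" if "0 \<le> r" "r < 1" "q > 0" for r q
    by (rule circ_integrable_continuous) (use that in \<open>auto intro!: continuous_intros continuous_on_powr' cF\<close>)
  \<comment> \<open>From \<open>x powr (p/2) \<le> 1 + x powr p\<close>: the majorant needs a bound
    on the means of the halved exponent to control its value at 0.\<close>
  have mean2: "(LINT t|circ. cmod (F (of_real (\<rho> j) * cis t)) powr (p/2)) \<le> 2 * pi * (1 + C)" for j
  proof -
    have "(LINT t|circ. cmod (F (of_real (\<rho> j) * cis t)) powr (p/2)) \<le> (LINT t|circ. 1 + cmod (F (of_real (\<rho> j) * cis t)) powr p)"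
    proof (rule integral_mono)
      show "integrable circ (\<lambda>t. cmod (F (of_real (\<rho> j) * cis t)) powr (p/2))"
        using iF[of "\<rho> j" "p/2"] \<rho>[of j] p by simp
      show "integrable circ (\<lambda>t. 1 + cmod (F (of_real (\<rho> j) * cis t)) powr p)"
        using iF[of "\<rho> j" p] \<rho>[of j] p by simp
      fix t
      let ?x = "cmod (F (of_real (\<rho> j) * cis t))"
      have "?x powr p = (?x powr (p/2))\<^sup>2" by (simp add: power2_eq_square flip: powr_add)
      then show "?x powr (p/2) \<le> 1 + ?x powr p"
        using zero_le_power2[of "?x powr (p/2) - 1/2"] by (simp add: power2_eq_square algebra_simps)
    qed
    also have "\<dots> = 2 * pi + (LINT t|circ. cmod (F (of_real (\<rho> j) * cis t)) powr p)"
      using iF[of "\<rho> j" p] \<rho>[of j] p by (subst Bochner_Integration.integral_add) auto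
    also have "\<dots> \<le> 2 * pi * (1 + C)" using mean[OF \<rho>, of j] by (simp add: algebra_simps)
    finally show ?thesis .
  qed
  have p2: "p / 2 > 0" using p by simp
  obtain H0 where H0: "H0 holomorphic_on ball 0 1" and FH0: "\<And>z. cmod z < 1 \<Longrightarrow> cmod (F z) powr (p/2) \<le> Re (H0 z)"
    and H0D: "\<And>D r. \<lbrakk>\<And>j. (LINT t|circ. cmod (F (of_real (\<rho> j) * cis t)) powr (2 * (p/2))) \<le> D; 0 \<le> r; r < 1\<rbrakk>
       \<Longrightarrow> (LINT t|circ. (cmod (H0 (of_real r * cis t)))\<^sup>2) \<le> 4 * D + 8 * pi"
    using exists_harmonic_majorant[OF F p2 \<rho> \<rho>1 mean2] by metis
  \<comment> \<open>Adding 1 forces \<open>Re H \<ge> 1\<close>, as the truncation requires, and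
    keeps the majorization.\<close>
  define H where "H = (\<lambda>z. H0 z + 1)"
  \<comment> \<open>From \<open>|H0 + 1|^2 \<le> 2 |H0|^2 + 2\<close>, with the square mean bound
    for \<open>H0\<close> taken at \<open>2 * pi * C\<close>.\<close>
  define D where "D = 2 * (4 * (2 * pi * C) + 8 * pi) + 4 * pi"
  have Hh: "H holomorphic_on ball 0 1" unfolding H_def by (intro holomorphic_intros H0)
  have Re0: "0 \<le> Re (H0 z)" if "cmod z < 1" for z
    using FH0[OF that] powr_ge_zero[of "cmod (F z)" "p/2"] by linarith
  have H1: "1 \<le> Re (H z)" if "cmod z < 1" for z using Re0[OF that] by (simp add: H_def)
  have FH: "cmod (F z) powr p \<le> (cmod (H z))\<^sup>2" if "cmod z < 1" for z
  proof -
    have "cmod (F z) powr (p/2) \<le> cmod (H z)"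
      using FH0[OF that] complex_Re_le_cmod[of "H z"] by (simp add: H_def)
    then have "(cmod (F z) powr (p/2))\<^sup>2 \<le> (cmod (H z))\<^sup>2" by (intro power_mono) auto
    then show ?thesis by (simp add: power2_eq_square flip: powr_add)
  qed
  have HD: "(LINT t|circ. (cmod (H (of_real r * cis t)))\<^sup>2) \<le> D" if r: "0 \<le> r" "r < 1" for r
  proof -
    have i: "integrable circ (\<lambda>t. (cmod (H0 (of_real r * cis t)))\<^sup>2)" "integrable circ (\<lambda>t. (cmod (H (of_real r * cis t)))\<^sup>2)"
      by (intro circ_integrable_continuous continuous_intros circ_continuous_radial[OF H0 r] circ_continuous_radial[OF Hh r])+
    have "(LINT t|circ. (cmod (H (of_real r * cis t)))\<^sup>2) \<le> (LINT t|circ. 2 * (cmod (H0 (of_real r * cis t)))\<^sup>2 + 2)"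
    proof (rule integral_mono[OF i(2)])
      show "integrable circ (\<lambda>t. 2 * (cmod (H0 (of_real r * cis t)))\<^sup>2 + 2)"
        using i(1) by simp
      fix t
      have "cmod (H (of_real r * cis t)) \<le> cmod (H0 (of_real r * cis t)) + 1"
        unfolding H_def using norm_triangle_ineq[of "H0 (of_real r * cis t)" 1] by simp
      then have "(cmod (H (of_real r * cis t)))\<^sup>2 \<le> (cmod (H0 (of_real r * cis t)) + 1)\<^sup>2" by (intro power_mono) auto
      then show "(cmod (H (of_real r * cis t)))\<^sup>2 \<le> 2 * (cmod (H0 (of_real r * cis t)))\<^sup>2 + 2"
        using zero_le_power2[of "cmod (H0 (of_real r * cis t)) - 1"] by (simp add: power2_eq_square algebra_simps)
    qed
    also have "\<dots> = 2 * (LINT t|circ. (cmod (H0 (of_real r * cis t)))\<^sup>2) + 4 * pi"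
      using i(1) by (subst Bochner_Integration.integral_add) auto
    also have "\<dots> \<le> D"
      using H0D[of "2 * pi * C" r] mean[OF \<rho>] r by (simp add: D_def)
    finally show ?thesis .
  qed
  define P where "P = (2::real) powr p"
  have P: "P > 0" by (simp add: P_def)
  obtain g M where g: "g holomorphic_on ball 0 1" "\<forall>w\<in>ball 0 1. cmod (g w) \<le> M"
    and gF: "\<And>r. 0 \<le> r \<Longrightarrow> r < 1 \<Longrightarrow> (LINT t|circ. cmod (F (of_real r * cis t) - g (of_real r * cis t)) powr p) \<le> e / (2 * P)"
    using bounded_holomorphic_approx[OF p F Hh FH H1 HD, of "e / (2 * P)"] e P by auto
  \<comment> \<open>The bounds \<open>M\<close> and \<open>M + 1\<close> of the two functions add up
    to \<open>B\<close>. Hence the p-th power of their difference is at most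
    \<open>B powr (p - 1)\<close> times the difference, and smallness in mean suffices.\<close>
  define B where "B = 2 * M + 1"
  have M0: "0 \<le> M" using g(2) norm_ge_zero[of "g 0"] order_trans by (metis centre_in_ball zero_less_one)
  define B' where "B' = B powr (p - 1)"
  have B: "B > 0" "B' > 0" using M0 by (auto simp: B_def B'_def)
  have "\<exists>s\<in>exp_span. (\<forall>z. Re z \<ge> 0 \<longrightarrow> cmod (s z) \<le> M + 1) \<and>
      (LINT t|circ. cmod (boundary_val g t - boundary_val (s \<circ> mob a 1) t) * 1) < e / (2 * P * B')"
    by (rule exp_span_approx[OF a norm_one g, where h = "\<lambda>_. 1" and e = "e / (2 * P * B')"])
      (use e P B in auto)
  then obtain s where s: "s \<in> exp_span" and s23: "(\<forall>z. Re z \<ge> 0 \<longrightarrow> cmod (s z) \<le> M + 1) \<and>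
      (LINT t|circ. cmod (boundary_val g t - boundary_val (s \<circ> mob a 1) t) * 1) < e / (2 * P * B')"
    by (rule bexE)
  note sM = s23[THEN conjunct1, rule_format]
  define S where "S = s \<circ> mob a 1"
  have sI: "(LINT t|circ. cmod (boundary_val g t - boundary_val S t)) < e / (2 * P * B')"
    using s23[THEN conjunct2] unfolding S_def[symmetric] mult_1_right .
  have Sh: "S holomorphic_on ball 0 1"
    unfolding S_def by (rule holomorphic_on_compose_gen[OF mob_holomorphic[OF norm_one] exp_span_holomorphic[OF s, where A = UNIV]]) auto
  have SM: "\<forall>w\<in>ball 0 1. cmod (S w) \<le> M + 1"
    unfolding S_def o_def by (intro ballI sM Re_mob_nonneg[OF norm_one a]) auto
  note bg = bounded_boundary_val[OF g] and bS = bounded_boundary_val[OF Sh SM]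
  have GB: "cmod (g w - S w) \<le> B" if "cmod w < 1" for w
    using norm_triangle_ineq4[of "g w" "S w"] bspec[OF g(2), of w] bspec[OF SM, of w] that by (simp add: B_def)
  have wr: "cmod (of_real (rad j) * cis t) < 1" for j t using rad(1,2)[of j] by (simp add: norm_mult)
  \<comment> \<open>Dominated convergence carries the estimate from the boundary back to circles
    inside the disc, where \<open>F\<close> is defined and the majorant is built.\<close>
  have "(\<lambda>j. LINT t|circ. cmod (g (of_real (rad j) * cis t) - S (of_real (rad j) * cis t))) \<longlonglongrightarrow>
      (LINT t|circ. cmod (boundary_val g t - boundary_val S t))"
  proof (rule integral_dominated_convergence[where w = "\<lambda>t. B"])
    show "AE t in circ. (\<lambda>j. cmod (g (of_real (rad j) * cis t) - S (of_real (rad j) * cis t))) \<longlonglongrightarrow> cmod (boundary_val g t - boundary_val S t)"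
      using bg(2) bS(2) by eventually_elim (intro tendsto_intros)
    show "AE t in circ. norm (cmod (g (of_real (rad j) * cis t) - S (of_real (rad j) * cis t))) \<le> B" for j
      using GB[OF wr] by simp
    show "(\<lambda>t. cmod (boundary_val g t - boundary_val S t)) \<in> borel_measurable circ"
      using bg(4) bS(4) by auto
    show "(\<lambda>t. cmod (g (of_real (rad j) * cis t) - S (of_real (rad j) * cis t))) \<in> borel_measurable circ" for j
      using bg(5) bS(5) by auto
  qed simp
  from order_tendstoD(2)[OF this sI] obtain N where
    N: "\<And>j. N \<le> j \<Longrightarrow> (LINT t|circ. cmod (g (of_real (rad j) * cis t) - S (of_real (rad j) * cis t))) < e / (2 * P * B')"
    unfolding eventually_sequentially by blast
  show ?thesis
  proof (rule that[OF s])
    fix j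
    define r where "r = rad (N + j)"
    have r: "0 \<le> r" "r < 1" using rad(1,2)[of "N + j"] by (auto simp: r_def)
    have w: "cmod (of_real r * cis t) < 1" for t using r by (simp add: norm_mult)
    have cg: "continuous_on {0..2*pi} (\<lambda>t. g (of_real r * cis t))" and cS: "continuous_on {0..2*pi} (\<lambda>t. S (of_real r * cis t))"
      using circ_continuous_radial[OF g(1) r] circ_continuous_radial[OF Sh r] by auto
    have i1: "integrable circ (\<lambda>t. cmod (F (of_real r * cis t) - g (of_real r * cis t)) powr p)"
      by (rule circ_integrable_continuous) (use p in \<open>auto intro!: continuous_intros continuous_on_powr' cF[OF r] cg\<close>)
    have i2: "integrable circ (\<lambda>t. cmod (g (of_real r * cis t) - S (of_real r * cis t)))"
      by (rule circ_integrable_continuous) (intro continuous_intros cg cS)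
    have "(LINT t|circ. cmod (F (of_real r * cis t) - S (of_real r * cis t)) powr p) \<le>
      (LINT t|circ. P * cmod (F (of_real r * cis t) - g (of_real r * cis t)) powr p + P * B' * cmod (g (of_real r * cis t) - S (of_real r * cis t)))"
    proof (rule integral_mono')
      show "integrable circ (\<lambda>t. P * cmod (F (of_real r * cis t) - g (of_real r * cis t)) powr p + P * B' * cmod (g (of_real r * cis t) - S (of_real r * cis t)))"
        using i1 i2 by (intro Bochner_Integration.integrable_add Bochner_Integration.integrable_mult_right) auto
      fix t
      let ?x = "F (of_real r * cis t) - g (of_real r * cis t)" and ?y = "g (of_real r * cis t) - S (of_real r * cis t)"
      show "0 \<le> P * cmod ?x powr p + P * B' * cmod ?y" using P B by simp
      have "cmod ?y powr p = cmod ?y powr (p - 1) * cmod ?y"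
        by (cases "cmod ?y = 0") (auto simp: powr_diff)
      also have "\<dots> \<le> B' * cmod ?y"
        unfolding B'_def using GB[OF w] p by (intro mult_right_mono powr_mono2) auto
      finally have y: "cmod ?y powr p \<le> B' * cmod ?y" .
      have "cmod (?x + ?y) powr p \<le> P * (cmod ?x powr p + cmod ?y powr p)"
        unfolding P_def by (rule norm_add_powr_le) (use p in simp)
      also have "\<dots> \<le> P * (cmod ?x powr p + B' * cmod ?y)" using y P by simp
      finally show "cmod (F (of_real r * cis t) - S (of_real r * cis t)) powr p \<le> P * cmod ?x powr p + P * B' * cmod ?y"
        by (simp add: distrib_left mult.assoc)
    qed
    also have "\<dots> = P * (LINT t|circ. cmod (F (of_real r * cis t) - g (of_real r * cis t)) powr p) + P * B' * (LINT t|circ. cmod (g (of_real r * cis t) - S (of_real r * cis t)))"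
      using i1 i2 by (subst Bochner_Integration.integral_add) auto
    also have "\<dots> \<le> P * (e / (2 * P)) + P * B' * (e / (2 * P * B'))"
      using P B gF[OF r] N[of "N + j"] by (intro add_mono mult_left_mono) (auto simp: r_def)
    also have "\<dots> = e" using P B by simp
    finally show "(LINT t|circ. cmod (F (of_real (rad (N + j)) * cis t) - s (mob a 1 (of_real (rad (N + j)) * cis t))) powr p) \<le> e"
      by (simp add: r_def S_def)
  qed
qed

theorem hardy_dense_exp_span:
  assumes p: "1 \<le> p" and z0: "z0 \<in> C_plus" and f: "hardy C_plus p f" and e: "\<epsilon> > 0"
  shows "\<exists>s\<in>exp_span. hardy_norm C_plus p z0 (\<lambda>z. f z - s z) < \<epsilon>"
proof -
  have a: "Re z0 > 0" using z0 by (simp add: C_plus_def)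
  have opn: "open C_plus" unfolding C_plus_def by (rule open_halfspace_Re_gt)
  have cvx: "convex C_plus" unfolding C_plus_def by (rule convex_halfspace_Re_gt)
  have mC: "mob z0 1 w \<in> C_plus" if "cmod w < 1" for w
    using Re_mob_pos[OF norm_one a that] by (simp add: C_plus_def)
  have mh: "mob z0 1 holomorphic_on ball 0 1" by (rule mob_holomorphic) simp
  obtain u where fh: "f holomorphic_on C_plus" and u: "harmonic_on C_plus u" and fu: "\<And>z. z \<in> C_plus \<Longrightarrow> norm (f z) powr p \<le> u z"
    using f by (auto simp: hardy_def)
  obtain K where K: "K holomorphic_on C_plus" "\<And>z. z \<in> C_plus \<Longrightarrow> u z = Re (K z)"
    using harmonic_on_imp_Re_holomorphic[OF u cvx] by blast
  \<comment> \<open>Centring the Moebius map at \<open>z0\<close> makes the value of a harmonic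
    majorant at the base point its mean over every circle about 0.\<close>
  define F where "F = f \<circ> mob z0 1"
  have F: "F holomorphic_on ball 0 1"
    unfolding F_def by (rule holomorphic_on_compose_gen[OF mh fh]) (use mC in auto)
  have Kh: "(K \<circ> mob z0 1) holomorphic_on ball 0 1"
    by (rule holomorphic_on_compose_gen[OF mh K(1)]) (use mC in auto)
  have mean: "(LINT t|circ. cmod (F (of_real r * cis t)) powr p) \<le> 2 * pi * u z0" if r: "0 < r" "r < 1" for r
  proof -
    have w: "cmod (of_real r * cis t) < 1" for t using r by (simp add: norm_mult)
    have "(LINT t|circ. cmod (F (of_real r * cis t)) powr p) \<le> (LINT t|circ. Re ((K \<circ> mob z0 1) (of_real r * cis t)))"
    proof (rule integral_mono)
      show "integrable circ (\<lambda>t. cmod (F (of_real r * cis t)) powr p)"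
        by (rule circ_integrable_continuous)
          (use p r in \<open>auto intro!: continuous_intros continuous_on_powr' circ_continuous_radial[OF F]\<close>)
      show "integrable circ (\<lambda>t. Re ((K \<circ> mob z0 1) (of_real r * cis t)))"
        by (rule circ_integrable_continuous, intro continuous_intros circ_continuous_radial[OF Kh]) (use r in auto)
      show "cmod (F (of_real r * cis t)) powr p \<le> Re ((K \<circ> mob z0 1) (of_real r * cis t))" for t
        using fu[OF mC[OF w]] K(2)[OF mC[OF w]] by (simp add: F_def)
    qed
    also have "\<dots> = 2 * pi * Re ((K \<circ> mob z0 1) 0)" by (rule circ_mean_Re[OF Kh r])
    finally show ?thesis using K(2)[OF z0] by simp
  qed
  \<comment> \<open>A majorant with value at most \<open>c\<close> at the base point contributes
    \<open>c powr (1 / p) = \<epsilon> / 2\<close> to the norm, leaving room for the strict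
    inequality.\<close>
  define c where "c = (\<epsilon> / 2) powr p"
  have c: "c > 0" using e by (simp add: c_def)
  have "\<exists>s N. s \<in> exp_span \<and> (\<forall>j. (LINT t|circ. cmod (F (of_real (rad (N + j)) * cis t) - s (mob z0 1 (of_real (rad (N + j)) * cis t))) powr p) \<le> 2 * pi * c)"
    by (rule exp_span_hardy_means[OF p a F mean, of "2 * pi * c"]) (use c in auto)
  then obtain s N where s: "s \<in> exp_span" and
    sN: "\<And>j. (LINT t|circ. cmod (F (of_real (rad (N + j)) * cis t) - s (mob z0 1 (of_real (rad (N + j)) * cis t))) powr p) \<le> 2 * pi * c"
    by blast
  define G where "G = (\<lambda>w. F w - s (mob z0 1 w))"
  have "(s \<circ> mob z0 1) holomorphic_on ball 0 1"
    by (rule holomorphic_on_compose_gen[OF mh exp_span_holomorphic[OF s, where A = UNIV]]) auto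
  then have G: "G holomorphic_on ball 0 1" unfolding G_def by (intro holomorphic_intros F) (simp add: o_def)
  define \<rho> where "\<rho> = (\<lambda>j. rad (N + Suc j))"
  have \<rho>: "0 < \<rho> j" "\<rho> j < 1" for j using rad(2)[of "N + Suc j"] by (auto simp: \<rho>_def rad_Suc_pos)
  have \<rho>1: "\<rho> \<longlonglongrightarrow> 1"
    unfolding \<rho>_def using LIMSEQ_ignore_initial_segment[OF rad(3), of "Suc N"] by (simp add: add.commute)
  have Gm: "(LINT t|circ. cmod (G (of_real (\<rho> j) * cis t)) powr p) \<le> 2 * pi * c" for j
    using sN[of "Suc j"] by (simp add: G_def \<rho>_def)
  have p0: "p > 0" using p by simp
  obtain H where H: "H holomorphic_on ball 0 1" "\<And>z. cmod z < 1 \<Longrightarrow> cmod (G z) powr p \<le> Re (H z)" "Re (H 0) \<le> c"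
    using exists_harmonic_majorant[OF G p0 \<rho> \<rho>1 Gm] by metis
  \<comment> \<open>The inverse of \<open>mob z0 1\<close>; it transports the majorant back to the
    half-plane and sends \<open>z0\<close> to 0.\<close>
  define k where "k = (\<lambda>z. (z - z0) / (z + cnj z0))"
  have k1: "cmod (k z) < 1" if "z \<in> C_plus" for z
    unfolding k_def using cayley_lt_1[OF a, of z] that by (simp add: C_plus_def)
  have mk: "mob z0 1 (k z) = z" if z: "z \<in> C_plus" for z
  proof -
    have nz: "z + cnj z0 \<noteq> 0" using plus_cnj_nonzero[OF a, of z] z by (simp add: C_plus_def)
    have nz2: "z0 + cnj z0 \<noteq> 0" using plus_cnj_nonzero[OF a, of z0] a by simp
    have "z0 + cnj z0 * k z = z * (1 - k z)"
    proof -
      have kz: "k z * (z + cnj z0) = z - z0" using nz by (simp add: k_def)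
      then show ?thesis by algebra
    qed
    moreover have "1 - k z \<noteq> 0" using k1[OF z] by auto
    ultimately show ?thesis by (simp add: mob_def)
  qed
  have kh: "k holomorphic_on C_plus"
    unfolding k_def using plus_cnj_nonzero[OF a] by (intro holomorphic_intros) (auto simp: C_plus_def)
  have Hk: "(H \<circ> k) holomorphic_on C_plus"
    by (rule holomorphic_on_compose_gen[OF kh H(1)]) (use k1 in auto)
  define v where "v = (\<lambda>z. Re ((H \<circ> k) z))"
  have v: "harmonic_on C_plus v" unfolding v_def by (rule Re_holomorphic_harmonic_on[OF Hk opn])
  have fv: "norm (f z - s z) powr p \<le> v z" if z: "z \<in> C_plus" for z
    using H(2)[OF k1[OF z]] by (simp add: G_def F_def mk[OF z] v_def)
  have v0: "v z0 \<le> c" using H(3) by (simp add: v_def k_def)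
  have v0': "0 \<le> v z0" using fv[OF z0] powr_ge_zero[of "norm (f z0 - s z0)" p] by linarith
  have "hardy_norm C_plus p z0 (\<lambda>z. f z - s z) \<le> v z0 powr (1 / p)"
    unfolding hardy_norm_def
  proof (rule cInf_lower)
    show "v z0 powr (1 / p) \<in> {u z0 powr (1 / p) | u. harmonic_on C_plus u \<and> (\<forall>z\<in>C_plus. norm (f z - s z) powr p \<le> u z)}"
      using v fv by blast
    show "bdd_below {u z0 powr (1 / p) | u. harmonic_on C_plus u \<and> (\<forall>z\<in>C_plus. norm (f z - s z) powr p \<le> u z)}"
      by (rule bdd_belowI[of _ 0]) auto
  qed
  also have "\<dots> \<le> c powr (1 / p)" using v0 v0' p by (intro powr_mono2) auto
  also have "\<dots> = \<epsilon> / 2" using e p by (simp add: c_def powr_powr)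
  also have "\<dots> < \<epsilon>" using e by simp
  finally show ?thesis using s by blast
qed

theorem theorem4p2:
  shows "(\<forall>\<phi>. \<phi> holomorphic_on ball 0 1 \<and> bij_betw \<phi> (ball 0 1) C_plus
            \<longrightarrow> weak_star_dense \<phi> exp_span)
       \<and> (\<forall>p z0 f \<epsilon>. 1 \<le> p \<and> z0 \<in> C_plus \<and> hardy C_plus p f \<and> \<epsilon> > 0
            \<longrightarrow> (\<exists>s\<in>exp_span. hardy_norm C_plus p z0 (\<lambda>z. f z - s z) < \<epsilon>))"
  using weak_star_dense_exp_span hardy_dense_exp_span by blast

end
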